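(* Let $k\ge4$ be a fixed integer and let $j,\ell$ be integers with $1\le j\le\ell$ and $\gcd(j,\ell)=1$. Then, as $x\to\infty$, $$\sum_{\substack{2\le n\le x\\ p_1(n)\equiv j\ (\mathrm{mod}\ \ell)}}\mu(n)\omega(n)^{k-1}\left\{\frac{x}{n}\right\}\ll\frac{x(\log\log x)^{k+\frac12}}{\sqrt{\log x}}.$$
   Context: $\mu$ is the Möbius function, $\omega(n)$ the number of distinct prime factors of $n$, $p_1(n)$ the smallest prime factor of $n\ge2$, and $\{w\}=w-\lfloor w\rfloor$ the fractional part of $w$. Implied constants may depend on $k$ and $\ell$. *)

theory Defs
  imports Complex_Main "HOL-Number_Theory.Number_Theory"
    "HOL-Computational_Algebra.Squarefree"
begin

definition omega :: "nat \<Rightarrow> nat" where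
  "omega n = card (prime_factors n)"

definition moebius_mu :: "nat \<Rightarrow> int" where
  "moebius_mu n = (if squarefree n then (-1) ^ omega n else 0)"

(* Only meaningful for n \<ge> 2, where the set of prime factors is non-empty. *)
definition least_prime_factor :: "nat \<Rightarrow> nat" where
  "least_prime_factor n = Min (prime_factors n)"

end

theory Submission
  imports Defs "HOL-Complex_Analysis.Complex_Analysis" "HOL-Probability.Probability"
    "HOL-Real_Asymp.Real_Asymp"
begin

text \<open>
  Write \<open>f(n) = \<mu>(n) \<omega>(n)\<^sup>i [p\<^sub>1(n) \<equiv> j]\<close> with \<open>i = k - 1\<close> and \<open>g(m) = \<mu>(m) (\<omega>(m) + 1)\<^sup>i [p\<^sub>1(m) \<equiv> j]\<close>.
  Inserting \<open>ln n = \<Sum>\<^sub>d\<^sub>|\<^sub>n \<Lambda>(d)\<close> into \<open>\<Sum> f(n) {x/n} ln n\<close> and writing \<open>n = d m\<close>, one has \<open>f(d m) = - g(m)\<close>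
  unless \<open>m = 1\<close>, \<open>d\<close> is not prime, \<open>d\<close> divides \<open>m\<close>, or \<open>d < p\<^sub>1(m)\<close>; an upper bound sieve makes these exceptional
  pairs negligible. The rest is \<open>- \<Sum> g(m) D(x/m)\<close> with \<open>D(y) = \<Sum>\<^sub>d \<Lambda>(d) {y/d} = (1 - b) y + y h(y) + O(\<surd>y)\<close>,
  where \<open>h(y) = \<Sum>\<^sub>d\<^sub>\<le>\<^sub>y \<Lambda>(d)/d - ln y + b\<close>. The main term \<open>x \<Sum> g(m)/m\<close> is elementary: the divisor sums of \<open>g\<close>
  are \<open>O(\<omega>)\<close>, because an alternating sum of a polynomial over the subsets of a large set is zero. In particular no
  equidistribution of primes modulo \<open>l\<close> is needed. Everything else is estimated by the Cauchy-Schwarz inequality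
  against \<open>\<Sum> (\<omega>(m) + 1)\<^sup>2\<^sup>i/m\<close>, which costs exactly the factor \<open>\<surd>(ln x)\<close>; it remains to bound
  \<open>\<Sum> h(x/m)\<^sup>2/m\<close>, or, \<open>h\<close> being increasing up to a logarithm, \<open>\<integral> h(e\<^sup>v)\<^sup>2 dv\<close>. By Plancherel this follows from a bound for the
  Laplace transform of \<open>h(e\<^sup>v)\<close>, hence for \<open>\<zeta>'/\<zeta>\<close>, just to the right of the line \<open>Re s = 1\<close>.
\<close>

section \<open>Sums over positive integers and Chebyshev estimates\<close>

text \<open>A pointwise estimate of \<open>h\<close> would call for a prime number theorem with an
  error term; in mean square, polynomial bounds for zeta'/zeta near Re s = 1 suffice. The exponents
  form a budget. Zeta is O(|t|^(1/20)) slightly to the left of the line. The 3-4-1 inequality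
  converts this into |zeta| >> |t|^(-1/5) on the line and hence zeta'/zeta = O(|t|^(1/4)). Dividing
  by s leaves |t|^(-3/4), whose square is integrable at infinity; any growth exponent below 1/10
  would lead to a square-integrable transform. The abscissa 39/40 matches 1/20: the series for (s -
  1) zeta(s) is then dominated by N^(-39/40 - 1/20) = N^(-41/40). As for powers of ln ln x, the
  moment of order 2i contributes i after the square root, and the sieve bound for exceptional pairs
  contributes 1/2. This gives i + 1/2 = k - 1/2, one less than claimed.\<close>

definition nats_upto :: "real \<Rightarrow> nat set" where
  "nats_upto y = {n. 0 < n \<and> real n \<le> y}"

lemma nats_upto_iff: "n \<in> nats_upto y \<longleftrightarrow> 0 < n \<and> real n \<le> y"
  by (simp add: nats_upto_def)

lemma nats_upto_eq_atLeastAtMost: "nats_upto y = {1..nat \<lfloor>y\<rfloor>}"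
  by (auto simp: nats_upto_def le_nat_floor) linarith+

lemma finite_nats_upto [simp]: "finite (nats_upto y)"
  by (simp add: nats_upto_eq_atLeastAtMost)

lemma card_nats_upto: "y \<ge> 0 \<Longrightarrow> real (card (nats_upto y)) = of_int \<lfloor>y\<rfloor>"
  by (simp add: nats_upto_eq_atLeastAtMost)

lemma nats_upto_empty: "y < 1 \<Longrightarrow> nats_upto y = {}"
  by (auto simp: nats_upto_def)

lemma nats_upto_mono: "x \<le> y \<Longrightarrow> nats_upto x \<subseteq> nats_upto y"
  by (auto simp: nats_upto_def)

lemma sum_divisors_swap:
  fixes F :: "nat \<Rightarrow> nat \<Rightarrow> 'a :: comm_monoid_add"
  shows "(\<Sum>n\<in>nats_upto x. \<Sum>d | d dvd n. F d (n div d)) = (\<Sum>m\<in>nats_upto x. \<Sum>d\<in>nats_upto (x / real m). F d m)"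
proof -
  have "(\<Sum>n\<in>nats_upto x. \<Sum>d | d dvd n. F d (n div d))
      = (\<Sum>(n,d)\<in>Sigma (nats_upto x) (\<lambda>n. {d. d dvd n}). F d (n div d))"
    by (rule sum.Sigma) (auto simp: nats_upto_iff)
  also have "\<dots> = (\<Sum>(m,d)\<in>Sigma (nats_upto x) (\<lambda>m. nats_upto (x / real m)). F d m)"
  proof (rule sum.reindex_bij_witness[where i = "\<lambda>(m,d). (d * m, d)" and j = "\<lambda>(n,d). (n div d, d)"], goal_cases)
    case (2 a)
    then obtain n d where a: "a = (n, d)" "n > 0" "real n \<le> x" "d dvd n" by (auto simp: nats_upto_iff)
    then obtain m where m: "n = d * m" by auto
    have "d > 0" "m > 0" using a m by (auto intro: Nat.gr0I)
    moreover have "real m \<le> real n" using m \<open>d > 0\<close> by (simp del: of_nat_mult)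
    hence "real m \<le> x" using a by linarith
    ultimately show ?case using a m by (auto simp: nats_upto_iff field_simps)
  next
    case (4 b)
    then show ?case by (auto simp: nats_upto_iff field_simps)
  qed (auto simp: nats_upto_iff field_simps)
  also have "\<dots> = (\<Sum>m\<in>nats_upto x. \<Sum>d\<in>nats_upto (x / real m). F d m)"
    by (rule sum.Sigma [symmetric]) auto
  finally show ?thesis .
qed

lemma sum_nats_upto_swap:
  fixes F :: "nat \<Rightarrow> nat \<Rightarrow> 'a :: comm_monoid_add"
  shows "(\<Sum>m\<in>nats_upto x. \<Sum>d\<in>nats_upto (x / real m). F d m) = (\<Sum>d\<in>nats_upto x. \<Sum>m\<in>nats_upto (x / real d). F d m)"
proof -
  have sub: "(\<Sum>m\<in>nats_upto x. \<Sum>d\<in>nats_upto (x / real m). G d m) = (\<Sum>m\<in>nats_upto x. \<Sum>d\<in>nats_upto x. if real (d * m) \<le> x then G d m else 0)"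
    for G :: "nat \<Rightarrow> nat \<Rightarrow> 'a"
  proof (rule sum.cong[OF refl])
    fix m assume m: "m \<in> nats_upto x"
    have "(\<Sum>d\<in>nats_upto x. if real (d * m) \<le> x then G d m else 0) = (\<Sum>d\<in>nats_upto x \<inter> {d. real (d * m) \<le> x}. G d m)"
      by (simp add: sum.inter_restrict)
    also have "nats_upto x \<inter> {d. real (d * m) \<le> x} = nats_upto (x / real m)"
    proof -
      have *: "real d \<le> x" if "real d * real m \<le> x" for d
      proof -
        have "real d * 1 \<le> real d * real m" using m by (intro mult_left_mono) (auto simp: nats_upto_iff)
        with that show ?thesis by simp
      qed
      show ?thesis using m * by (auto simp: nats_upto_iff field_simps)
    qed
    finally show "(\<Sum>d\<in>nats_upto (x / real m). G d m) = (\<Sum>d\<in>nats_upto x. if real (d * m) \<le> x then G d m else 0)" ..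
  qed
  show ?thesis unfolding sub sub[of "\<lambda>d m. F m d"]
    by (subst sum.swap) (simp add: mult.commute)
qed

section \<open>Chebyshev's bound and the first theorem of Mertens\<close>

definition chebyshev_psi :: "real \<Rightarrow> real" where
  "chebyshev_psi y = (\<Sum>d\<in>nats_upto y. mangoldt d)"

definition mertens_sum :: "real \<Rightarrow> real" where
  "mertens_sum y = (\<Sum>d\<in>nats_upto y. mangoldt d / real d)"

definition log_factorial :: "real \<Rightarrow> real" where
  "log_factorial y = (\<Sum>n\<in>nats_upto y. ln (real n))"

text \<open>This is \<open>D\<close> of the overview: the amount by which
  \<open>y * mertens_sum y\<close> exceeds \<open>log_factorial y\<close>, so that Stirling's
  formula makes it as informative as the Mertens sum.\<close>

definition frac_mangoldt_sum :: "real \<Rightarrow> real" where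
  "frac_mangoldt_sum y = (\<Sum>d\<in>nats_upto y. mangoldt d * frac (y / real d))"

lemma mertens_sum_mono: "x \<le> y \<Longrightarrow> mertens_sum x \<le> mertens_sum y"
  unfolding mertens_sum_def by (intro sum_mono2 nats_upto_mono) (auto intro!: divide_nonneg_nonneg mangoldt_nonneg)

text \<open>Legendre's identity: \<open>ln n\<close> is the divisor sum of \<open>mangoldt\<close>,
  and the floor of y/d counts the multiples of d up to y.\<close>

lemma log_factorial_eq_floor_sum:
  assumes "y \<ge> 0"
  shows "log_factorial y = (\<Sum>d\<in>nats_upto y. mangoldt d * of_int \<lfloor>y / real d\<rfloor>)"
proof -
  have "log_factorial y = (\<Sum>n\<in>nats_upto y. \<Sum>d | d dvd n. mangoldt d)"
    unfolding log_factorial_def by (intro sum.cong refl) (auto simp: mangoldt_sum nats_upto_iff)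
  also have "\<dots> = (\<Sum>m\<in>nats_upto y. \<Sum>d\<in>nats_upto (y / real m). mangoldt d)"
    by (rule sum_divisors_swap)
  also have "\<dots> = (\<Sum>d\<in>nats_upto y. mangoldt d * of_int \<lfloor>y / real d\<rfloor>)"
    by (subst sum_nats_upto_swap) (use assms in \<open>simp add: card_nats_upto mult.commute\<close>)
  finally show ?thesis .
qed

lemma frac_mangoldt_sum_eq:
  assumes "y \<ge> 0"
  shows "frac_mangoldt_sum y = y * mertens_sum y - log_factorial y"
  unfolding frac_mangoldt_sum_def mertens_sum_def log_factorial_eq_floor_sum[OF assms] frac_def
  by (simp add: sum_distrib_left sum_subtractf [symmetric] algebra_simps)

lemma sum_ln_bounds:
  assumes "N \<ge> (1::nat)"
  shows "real N * ln (real N) - real N \<le> (\<Sum>n=1..N. ln (real n))"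
    and "(\<Sum>n=1..N. ln (real n)) \<le> real N * ln (real N) - real N + 1 + ln (real N)"
proof -
  have "real N * ln (real N) - real N \<le> (\<Sum>n=1..N. ln (real n)) \<and> (\<Sum>n=1..N. ln (real n)) \<le> real N * ln (real N) - real N + 1 + ln (real N)"
    using assms
  proof (induction N rule: dec_induct)
    case (step n)
    define r where "r = real n"
    have r: "r \<ge> 1" using step by (simp add: r_def)
    have l: "ln (1 + r) - ln r \<le> 1 / r"
      using ln_diff_le[of "1 + r" r] r by simp
    have u: "ln r - ln (1 + r) \<le> -(1 / (1 + r))"
      using ln_diff_le[of r "1+r"] r by simp
    have 1: "r * (ln (1 + r) - ln r) \<le> 1" using mult_left_mono[OF l, of r] r by simp
    have 2: "(1 + r) * (ln r - ln (1 + r)) \<le> -1" using mult_left_mono[OF u, of "1+r"] r by simp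
    show ?case using step.IH 1 2 by (simp add: r_def algebra_simps)
  qed auto
  thus "real N * ln (real N) - real N \<le> (\<Sum>n=1..N. ln (real n))"
    and "(\<Sum>n=1..N. ln (real n)) \<le> real N * ln (real N) - real N + 1 + ln (real N)" by auto
qed

lemma log_factorial_bounds:
  assumes "y \<ge> 1"
  shows "log_factorial y \<ge> y * ln y - y - ln y" and "log_factorial y \<le> y * ln y - y + 1 + ln y"
proof -
  define N where "N = nat \<lfloor>y\<rfloor>"
  have N: "N \<ge> 1" "real N \<le> y" "y \<le> real N + 1" using assms by (auto simp: N_def le_nat_floor; linarith)+
  have lf: "log_factorial y = (\<Sum>n=1..N. ln (real n))"
    by (simp add: log_factorial_def nats_upto_eq_atLeastAtMost N_def)
  have Npos: "real N > 0" "y > 0" using N by auto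
  have l: "ln y \<ge> ln (real N)" using N by simp
  have a: "real N * (ln y - ln (real N)) \<le> y - real N"
    using mult_left_mono[OF ln_diff_le[OF Npos(2,1)], of "real N"] Npos by simp
  have c: "y * (ln (real N) - ln y) \<le> real N - y"
    using mult_left_mono[OF ln_diff_le[OF Npos], of y] Npos by simp
  have b: "(y - real N) * ln y \<le> 1 * ln y" using assms N by (intro mult_right_mono) auto
  have d: "(y - real N) * ln (real N) \<ge> 0" using N by (intro mult_nonneg_nonneg) auto
  show "log_factorial y \<ge> y * ln y - y - ln y"
    using sum_ln_bounds(1)[OF N(1)] a b unfolding lf by (simp add: algebra_simps)
  show "log_factorial y \<le> y * ln y - y + 1 + ln y"
    using sum_ln_bounds(2)[OF N(1)] l c d unfolding lf by (simp add: algebra_simps)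
qed

text \<open>Chebyshev's device: for w = y/d, floor(w) - 2 floor(w/2) is nonnegative, and it is at
  least 1 when y/2 < d \<le> y. So the increment of psi is at most
  \<open>log_factorial y - 2 * log_factorial (y / 2)\<close>, in which the terms of size y ln y
  cancel.\<close>

lemma chebyshev_psi_step:
  assumes "y \<ge> 2"
  shows "chebyshev_psi y \<le> chebyshev_psi (y / 2) + 5 * y"
proof -
  have y: "y > 0" "y \<ge> 0" "y/2 \<ge> 0" "y \<ge> 1" "y/2 \<ge> 1" using assms by auto
  have "chebyshev_psi y - chebyshev_psi (y / 2) = (\<Sum>d\<in>nats_upto y - nats_upto (y/2). mangoldt d)"
    unfolding chebyshev_psi_def by (subst sum_diff) (use y in \<open>auto intro!: nats_upto_mono\<close>)
  also have "\<dots> = (\<Sum>d\<in>nats_upto y. if d \<in> nats_upto (y/2) then 0 else mangoldt d)"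
    by (intro sum.mono_neutral_cong_left) auto
  also have "\<dots> \<le> (\<Sum>d\<in>nats_upto y. mangoldt d * (real_of_int \<lfloor>y / real d\<rfloor> - 2 * real_of_int \<lfloor>y / 2 / real d\<rfloor>))"
  proof (rule sum_mono)
    fix d assume d: "d \<in> nats_upto y"
    hence d0: "real d > 0" "real d \<le> y" by (auto simp: nats_upto_iff)
    define f1 f2 where "f1 = real_of_int \<lfloor>y / real d\<rfloor>" and "f2 = real_of_int \<lfloor>y / 2 / real d\<rfloor>"
    have "2 * \<lfloor>y / 2 / real d\<rfloor> \<le> \<lfloor>y / real d\<rfloor>"
      by (simp add: le_floor_iff) linarith
    hence "f1 - 2 * f2 \<ge> 0" unfolding f1_def f2_def by linarith
    moreover have "f1 - 2 * f2 \<ge> 1" if "d \<notin> nats_upto (y/2)"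
    proof -
      have "y / 2 < real d" using that d by (auto simp: nats_upto_iff)
      hence "\<lfloor>y / 2 / real d\<rfloor> = 0" using d0 y by (simp add: floor_eq_iff field_simps)
      moreover have "\<lfloor>y / real d\<rfloor> \<ge> 1" using d0 by (simp add: le_floor_iff field_simps)
      ultimately show ?thesis unfolding f1_def f2_def by simp
    qed
    ultimately show "(if d \<in> nats_upto (y/2) then 0 else mangoldt d) \<le> mangoldt d * (real_of_int \<lfloor>y / real d\<rfloor> - 2 * real_of_int \<lfloor>y / 2 / real d\<rfloor>)"
      using mangoldt_nonneg[of d] mult_left_mono[of 1 "f1 - 2 * f2" "mangoldt d"]
      unfolding f1_def f2_def by auto
  qed
  also have "\<dots> = log_factorial y - 2 * (\<Sum>d\<in>nats_upto y. mangoldt d * real_of_int \<lfloor>y / 2 / real d\<rfloor>)"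
    unfolding log_factorial_eq_floor_sum[OF y(2)]
    by (simp add: sum_distrib_left sum_subtractf [symmetric] algebra_simps)
  also have "(\<Sum>d\<in>nats_upto y. mangoldt d * real_of_int \<lfloor>y / 2 / real d\<rfloor>) = log_factorial (y / 2)"
    unfolding log_factorial_eq_floor_sum[OF y(3)]
  proof (intro sum.mono_neutral_right nats_upto_mono ballI)
    fix i assume i: "i \<in> nats_upto y - nats_upto (y / 2)"
    hence "\<lfloor>y / 2 / real i\<rfloor> = 0" using y by (auto simp: floor_eq_iff field_simps nats_upto_iff)
    thus "mangoldt i * real_of_int \<lfloor>y / 2 / real i\<rfloor> = 0" by simp
  qed (use y in auto)
  also have "log_factorial y - 2 * log_factorial (y / 2) \<le> 5 * y"
  proof -
    have "ln (y / 2) = ln y - ln 2" using y by (simp add: ln_div)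
    moreover from this have "y * ln (y / 2) = y * ln y - y * ln 2" by (simp add: right_diff_distrib)
    moreover have "ln y \<le> y - 1" using y by (intro ln_le_minus_one) auto
    moreover have "y * ln 2 \<le> y * 1" using y ln_2_less_1 by (intro mult_left_mono) auto
    moreover have "ln 2 \<ge> (0::real)" by simp
    ultimately show ?thesis
      using log_factorial_bounds(2)[OF y(4)] log_factorial_bounds(1)[OF y(5)] y by (simp; linarith)
  qed
  finally show ?thesis by simp
qed

text \<open>Repeated halving yields a geometric series: 5 y + 10 (y/2) = 10 y. The floor strictly
  decreases under halving once y \<ge> 2; below 2 only d = 1 occurs, where \<open>mangoldt\<close>
  vanishes.\<close>

lemma chebyshev_psi_le:
  assumes "y \<ge> 0"
  shows "chebyshev_psi y \<le> 10 * y"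
  using assms
proof (induction "nat \<lfloor>y\<rfloor>" arbitrary: y rule: less_induct)
  case less
  show ?case
  proof (cases "y < 2")
    case True
    have "chebyshev_psi y = 0" unfolding chebyshev_psi_def
    proof (rule sum.neutral, rule ballI)
      fix d assume "d \<in> nats_upto y"
      hence "d = 1" using True by (auto simp: nats_upto_iff)
      thus "mangoldt d = (0::real)" by simp
    qed
    thus ?thesis using less by simp
  next
    case False
    have "nat \<lfloor>y / 2\<rfloor> < nat \<lfloor>y\<rfloor>" using False by linarith
    hence "chebyshev_psi (y / 2) \<le> 10 * (y / 2)" using False by (intro less) auto
    thus ?thesis using chebyshev_psi_step[of y] False by simp
  qed
qed

lemma frac_mangoldt_sum_bounds:
  assumes "y \<ge> 0"
  shows "frac_mangoldt_sum y \<ge> 0" "frac_mangoldt_sum y \<le> 10 * y"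
proof -
  show "frac_mangoldt_sum y \<ge> 0" unfolding frac_mangoldt_sum_def
    by (intro sum_nonneg mult_nonneg_nonneg mangoldt_nonneg frac_ge_0)
  have "frac_mangoldt_sum y \<le> chebyshev_psi y" unfolding frac_mangoldt_sum_def chebyshev_psi_def
    by (intro sum_mono mult_left_le mangoldt_nonneg less_imp_le frac_lt_1)
  thus "frac_mangoldt_sum y \<le> 10 * y" using chebyshev_psi_le[OF assms] by simp
qed

text \<open>Stirling's formula gives \<open>log_factorial y\<close>, and by Chebyshev's bound the
  fractional parts change \<open>y * mertens_sum y\<close> by O(y) only.\<close>

lemma mertens_sum_bounds:
  assumes "y \<ge> 1"
  shows "\<bar>mertens_sum y - ln y\<bar> \<le> 12"
proof -
  have ln: "ln y \<le> y - 1" "ln y \<ge> 0" using assms by (auto intro!: ln_le_minus_one)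
  have "y * mertens_sum y = log_factorial y + frac_mangoldt_sum y"
    using frac_mangoldt_sum_eq[of y] assms by simp
  hence "y * (mertens_sum y - ln y) \<le> y * 12" "y * (ln y - mertens_sum y) \<le> y * 12"
    using log_factorial_bounds[OF assms] frac_mangoldt_sum_bounds[of y] ln assms
    by (simp_all add: algebra_simps)
  thus ?thesis using assms by (simp add: abs_le_iff)
qed

lemma card_multiples_nats_upto_le:
  assumes "d > 0" "y \<ge> 0"
  shows "real (card {n \<in> nats_upto y. d dvd n}) \<le> y / real d"
proof -
  have "{n \<in> nats_upto y. d dvd n} \<subseteq> (\<lambda>m. d * m) ` nats_upto (y / real d)"
    using assms by (auto simp: nats_upto_iff field_simps elim!: dvdE intro!: imageI)
  hence "card {n \<in> nats_upto y. d dvd n} \<le> card (nats_upto (y / real d))"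
    by (meson card_image_le card_mono finite_imageI finite_nats_upto le_trans)
  hence "real (card {n \<in> nats_upto y. d dvd n}) \<le> real (card (nats_upto (y / real d)))" by simp
  also have "\<dots> \<le> y / real d" using assms by (subst card_nats_upto) auto
  finally show ?thesis .
qed

lemma harmonic_nats_upto_bounds:
  assumes "y \<ge> 1"
  shows "ln y \<le> (\<Sum>n\<in>nats_upto y. 1 / real n)" and "(\<Sum>n\<in>nats_upto y. 1 / real n) \<le> 1 + ln y"
proof -
  define N where "N = nat \<lfloor>y\<rfloor>"
  have N: "N \<ge> 1" "real N \<le> y" "y \<le> real N + 1" using assms by (auto simp: N_def le_nat_floor; linarith)+
  have eq: "(\<Sum>n\<in>nats_upto y. 1 / real n) = harm N"
    by (simp add: nats_upto_eq_atLeastAtMost harm_def N_def inverse_eq_divide)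
  have "ln y \<le> ln (real N + 1)" using N assms by simp
  also have "\<dots> \<le> harm N" by (rule ln_le_harm)
  finally show "ln y \<le> (\<Sum>n\<in>nats_upto y. 1 / real n)" by (simp add: eq)
  have "harm N - ln (real N) \<le> (1 :: real)"
  proof -
    obtain M where M: "N = Suc M" using N by (cases N) auto
    have "harm (Suc M) - ln (real (Suc M)) \<le> harm (Suc 0) - ln (real (Suc 0))"
      using decseqD[OF decseq_harm_diff_ln, of 0 M] by simp
    thus ?thesis by (simp add: M harm_expand(1) harm_def)
  qed
  moreover have "ln (real N) \<le> ln y" using N by simp
  ultimately show "(\<Sum>n\<in>nats_upto y. 1 / real n) \<le> 1 + ln y" by (simp add: eq)
qed

lemma ln_le_2_sqrt: "x > 0 \<Longrightarrow> ln x \<le> 2 * sqrt x"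
  using ln_le_minus_one[of "sqrt x"] by (simp add: ln_sqrt)

section \<open>Sums of reciprocals of primes\<close>

definition prime_reciprocal_sum :: "real \<Rightarrow> real" where
  "prime_reciprocal_sum y = (\<Sum>p | p \<in> nats_upto y \<and> prime p. 1 / real p)"

text \<open>Raising i by one squares the range. A prime p > z has 1/p \<le>
  \<open>mangoldt p / (p ln z)\<close>, so going from z to at most z^2 adds at most (2 ln z + 12)/ln
  z \<le> 14, by the first theorem of Mertens and ln z \<ge> 1.\<close>

lemma prime_reciprocal_sum_le_aux: "y \<le> exp (2 ^ i) \<Longrightarrow> prime_reciprocal_sum y \<le> 14 * (real i + 1)"
proof (induction i arbitrary: y)
  case 0
  have "{p. p \<in> nats_upto y \<and> prime p} \<subseteq> {2..3}"
    using 0 exp_le by (auto simp: nats_upto_iff prime_ge_2_nat)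
  hence "prime_reciprocal_sum y \<le> (\<Sum>p\<in>{2..3::nat}. 1 / real p)"
    unfolding prime_reciprocal_sum_def by (intro sum_mono2) auto
  also have "{2..3::nat} = {2, 3}" by auto
  finally show ?case by simp
next
  case (Suc i)
  define z :: real where "z = exp (2 ^ i)"
  have lnz: "ln z = 2 ^ i" "ln z \<ge> 1" by (simp_all add: z_def)
  have z1: "z > 1" by (simp add: z_def)
  show ?case
  proof (cases "y \<le> z")
    case True
    thus ?thesis using Suc.IH[of y] by (simp add: z_def)
  next
    case False
    let ?P = "{p. p \<in> nats_upto y \<and> prime p \<and> p \<notin> nats_upto z}"
    have y: "y > z" "y \<ge> 1" using False z1 by auto
    have "ln y \<le> ln (exp (2 ^ Suc i))" using y Suc.prems by (subst ln_le_cancel_iff) auto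
    hence lny: "ln y \<le> 2 * ln z" by (simp add: lnz)
    have "prime_reciprocal_sum y \<le> prime_reciprocal_sum z + (\<Sum>p\<in>?P. 1 / real p)"
      unfolding prime_reciprocal_sum_def
      by (subst sum.union_disjoint[symmetric]) (auto intro!: sum_mono2)
    also have "prime_reciprocal_sum z \<le> 14 * (real i + 1)"
      by (rule Suc.IH) (simp add: z_def)
    also have "(\<Sum>p\<in>?P. 1 / real p) \<le> (\<Sum>p\<in>?P. (mangoldt p / real p) / ln z)"
    proof (rule sum_mono)
      fix p assume "p \<in> ?P"
      hence p: "real p > z" "prime p" "p > 0" by (auto simp: nats_upto_iff)
      have "ln (real p) \<ge> ln z" using p z1 by simp
      hence "1 \<le> ln (real p) / ln z" using lnz by (simp add: field_simps)
      from divide_right_mono[OF this, of "real p"] show "1 / real p \<le> mangoldt p / real p / ln z"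
        using p by (simp add: field_simps)
    qed
    also have "\<dots> \<le> mertens_sum y / ln z"
      unfolding sum_divide_distrib[symmetric] mertens_sum_def using lnz
      by (intro divide_right_mono sum_mono2) (auto intro!: divide_nonneg_nonneg[OF mangoldt_nonneg of_nat_0_le_iff])
    also have "\<dots> \<le> (2 * ln z + 12) / ln z"
      using mertens_sum_bounds[of y] y lny lnz by (intro divide_right_mono) linarith+
    also have "\<dots> \<le> 14" using lnz(2) by (simp add: divide_le_eq)
    finally show ?thesis by simp
  qed
qed

lemma prime_reciprocal_sum_le:
  assumes "y > 1" "ln (ln y) \<ge> 1"
  shows "prime_reciprocal_sum y \<le> 56 * ln (ln y)"
proof -
  \<comment> \<open>Because ln 2 > 1/2, this many squarings reach y.\<close>
  define i where "i = nat \<lceil>2 * ln (ln y)\<rceil>"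
  have i: "real i \<ge> 2 * ln (ln y)" "real i \<le> 2 * ln (ln y) + 1" using assms unfolding i_def by linarith+
  have lnpos: "ln y > 0" using assms by simp
  have "ln (ln y) = 2 * ln (ln y) * (1 / 2)" by simp
  also have "\<dots> \<le> real i * ln 2" using i assms ln2_ge_two_thirds by (intro mult_mono) auto
  also have "\<dots> = ln (2 ^ i)" by (simp add: ln_realpow)
  finally have "ln y \<le> 2 ^ i" using lnpos by simp
  hence "exp (ln y) \<le> exp (2 ^ i)" by simp
  hence "y \<le> exp (2 ^ i)" using assms by simp
  hence "prime_reciprocal_sum y \<le> 14 * (real i + 1)" by (rule prime_reciprocal_sum_le_aux)
  also have "\<dots> \<le> 14 * (2 * ln (ln y) + 1 + 1)" using i by (intro mult_left_mono add_right_mono) auto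
  also have "\<dots> \<le> 56 * ln (ln y)" using assms(2) by simp
  finally show ?thesis .
qed

section \<open>Proper prime powers, with zeta(3/2) as the absolute constant\<close>

definition powr_three_halves_sum :: real where
  "powr_three_halves_sum = (\<Sum>n. real n powr (-3/2))"

lemma powr_three_halves_sum_bound:
  assumes "finite A"
  shows "(\<Sum>n\<in>A. real n powr (-3/2)) \<le> powr_three_halves_sum"
  unfolding powr_three_halves_sum_def using assms
  by (intro sum_le_suminf) (auto simp: summable_real_powr_iff)

lemma ln_over_square_le: "n > 0 \<Longrightarrow> ln (real n) / (real n)^2 \<le> 2 * real n powr (-3/2)"
proof -
  assume n: "n > 0"
  have "real n powr (-3/2) = sqrt (real n) / (real n)^2"
    using n powr_diff[of "real n" "1/2" 2] by (simp add: powr_half_sqrt powr_numeral)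
  thus ?thesis using ln_le_2_sqrt[of "real n"] n by (simp add: field_simps)
qed

text \<open>Only p^a with a \<ge> 2 contribute. For fixed p the geometric series is at most twice
  its first term, which leaves a multiple of ln p / p^2, summable over p.\<close>

lemma sum_mangoldt_nonprime_le:
  "(\<Sum>d | d \<in> nats_upto y \<and> \<not> prime d. mangoldt d / real d) \<le> 4 * powr_three_halves_sum"
proof -
  define M where "M = nat \<lfloor>y\<rfloor>"
  define P where "P = {p. p \<in> nats_upto y \<and> prime p}"
  have [simp]: "finite P" by (simp add: P_def)
  let ?f = "\<lambda>(p,a). p ^ a :: nat"
  have sub: "{d. d \<in> nats_upto y \<and> \<not> prime d \<and> primepow d} \<subseteq> ?f ` (P \<times> {2..M})"
  proof safe
    fix d :: nat assume d: "d \<in> nats_upto y" "\<not> prime d" "primepow d"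
    then obtain p a where pa: "prime p" "a > 0" "d = p ^ a" by (auto simp: primepow_def)
    have "a \<noteq> 1" using d pa by auto
    hence a2: "a \<ge> 2" using pa by simp
    have dM: "d \<le> M" using d by (simp add: nats_upto_eq_atLeastAtMost M_def)
    have "p \<le> d" using pa a2 self_le_power[of p a] prime_ge_1_nat[of p] by simp
    hence "real p \<le> y" using d by (auto simp: nats_upto_iff)
    hence "p \<in> P" using pa by (auto simp: P_def nats_upto_iff prime_gt_0_nat)
    \<comment> \<open>Bounding the exponent by M as well puts all these prime powers into the image
      of one finite rectangle.\<close>
    moreover have "a \<le> M"
    proof -
      have "a < 2 ^ a" by (rule less_exp)
      also have "(2::nat) ^ a \<le> p ^ a" using prime_ge_2_nat[OF pa(1)] by (rule power_mono) simp
      finally show ?thesis using dM pa by simp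
    qed
    ultimately show "d \<in> ?f ` (P \<times> {2..M})" using a2 pa by (intro image_eqI[of _ _ "(p,a)"]) auto
  qed
  have "(\<Sum>d | d \<in> nats_upto y \<and> \<not> prime d. mangoldt d / real d) =
      (\<Sum>d | d \<in> nats_upto y \<and> \<not> prime d \<and> primepow d. mangoldt d / real d)"
    by (rule sum.mono_neutral_right) (auto simp: mangoldt_def)
  also have "\<dots> \<le> (\<Sum>d\<in>?f ` (P \<times> {2..M}). mangoldt d / real d)"
    using sub by (intro sum_mono2) (auto intro!: divide_nonneg_nonneg[OF mangoldt_nonneg] simp del: of_nat_power)
  also have "\<dots> \<le> (\<Sum>z\<in>P \<times> {2..M}. mangoldt (?f z) / real (?f z))"
    by (rule order.trans[OF sum_image_le]) (auto simp: o_def intro!: divide_nonneg_nonneg[OF mangoldt_nonneg])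
  also have "\<dots> = (\<Sum>p\<in>P. \<Sum>a=2..M. mangoldt (p ^ a) / real (p ^ a))"
    by (simp add: sum.cartesian_product case_prod_unfold)
  also have "\<dots> \<le> (\<Sum>p\<in>P. 4 * real p powr (-3/2))"
  proof (rule sum_mono)
    fix p assume "p \<in> P"
    hence p: "prime p" "p \<ge> 2" by (auto simp: P_def prime_ge_2_nat)
    define r where "r = 1 / real p"
    have r: "0 < r" "r \<le> 1/2" using p by (auto simp: r_def field_simps)
    have "(\<Sum>a=2..M. r ^ a) = r^2 * (\<Sum>a=2..M. r ^ (a - 2))"
      unfolding sum_distrib_left
    proof (rule sum.cong[OF refl])
      fix a assume "a \<in> {2..M}"
      hence "a = 2 + (a - 2)" by auto
      thus "r ^ a = r\<^sup>2 * r ^ (a - 2)" by (metis power_add)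
    qed
    also have "(\<Sum>a=2..M. r ^ (a - 2)) = (\<Sum>a\<in>(\<lambda>a. a - 2) ` {2..M}. r ^ a)"
      by (subst sum.reindex) (auto simp: inj_on_def)
    also have "\<dots> \<le> (\<Sum>a\<in>{..M}. r ^ a)" by (intro sum_mono2) (use r in auto)
    also have "\<dots> \<le> 2"
    proof -
      have "(\<Sum>a\<in>{..M}. r ^ a) = (1 - r ^ Suc M) / (1 - r)" using r by (simp add: sum_gp0)
      also have "\<dots> \<le> 1 / (1 - r)" using r by (intro divide_right_mono) auto
      also have "\<dots> \<le> 2" using r by (simp add: field_simps)
      finally show ?thesis .
    qed
    finally have geo: "(\<Sum>a=2..M. r ^ a) \<le> r^2 * 2" using r by simp
    have "(\<Sum>a=2..M. mangoldt (p ^ a) / real (p ^ a)) = ln (real p) * (\<Sum>a=2..M. r ^ a)"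
      unfolding sum_distrib_left using p by (intro sum.cong refl) (auto simp: r_def power_divide)
    also have "\<dots> \<le> ln (real p) * (r^2 * 2)" using geo p by (intro mult_left_mono) auto
    also have "\<dots> = 2 * (ln (real p) / (real p)^2)" by (simp add: r_def power_divide)
    also have "\<dots> \<le> 4 * real p powr (-3/2)" using ln_over_square_le[of p] p by simp
    finally show "(\<Sum>a=2..M. mangoldt (p ^ a) / real (p ^ a)) \<le> 4 * real p powr (-3/2)" .
  qed
  also have "\<dots> = 4 * (\<Sum>p\<in>P. real p powr (-3/2))" by (simp add: sum_distrib_left)
  also have "\<dots> \<le> 4 * powr_three_halves_sum" using powr_three_halves_sum_bound[of P] by simp
  finally show ?thesis .
qed

section \<open>Rough numbers and an upper bound sieve\<close>

definition rough :: "nat \<Rightarrow> nat set" where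
  "rough z = {m. m > 0 \<and> (\<forall>p. prime p \<and> p dvd m \<longrightarrow> z < p)}"

lemma rough_dvd: "m \<in> rough z \<Longrightarrow> d dvd m \<Longrightarrow> d \<in> rough z"
  unfolding rough_def using dvd_trans dvd_pos_nat by blast

text \<open>The products of an integer up to \<open>z\<close> and a \<open>z\<close>-rough number are pairwise distinct.\<close>

lemma sum_rough_reciprocals_le:
  assumes "2 \<le> z" "real z \<le> y"
  shows "(\<Sum>m\<in>nats_upto y \<inter> rough z. 1 / real m) \<le> 4 * ln y / ln (real z)"
proof -
  let ?R = "nats_upto y \<inter> rough z" and ?A = "nats_upto (real z)"
  have y: "y \<ge> 2" using assms by simp
  have lnz: "ln (real z) > 0" using assms by simp
  have inj: "inj_on (\<lambda>(a,m). a * m) (?A \<times> ?R)"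
  proof (rule inj_onI, clarify)
    fix a m a' m' assume A: "a \<in> ?A" "a' \<in> ?A" "m \<in> rough z" "m' \<in> rough z" "a * m = a' * m'"
    have cop: "coprime a m" if "a \<in> ?A" "m \<in> rough z" for a m
    proof (rule ccontr)
      assume "\<not> coprime a m"
      hence "gcd a m \<noteq> 1" using coprime_iff_gcd_eq_1 by blast
      then obtain p where "prime p" "p dvd gcd a m" using prime_factor_nat by blast
      hence p: "prime p" "p dvd a" "p dvd m" by auto
      hence "p \<le> a" using that by (auto simp: nats_upto_iff intro: dvd_imp_le)
      with p that show False by (auto simp: nats_upto_iff rough_def)
    qed
    have "a dvd a' * m'" unfolding A(5)[symmetric] by simp
    moreover have "a' dvd a * m" unfolding A(5) by simp
    ultimately
    have "a dvd a'" "a' dvd a" using cop[OF A(1,4)] cop[OF A(2,3)]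
      by (auto simp: coprime_dvd_mult_left_iff)
    hence "a = a'" by (rule dvd_antisym)
    thus "a = a' \<and> m = m'" using A by (auto simp: nats_upto_iff)
  qed
  have "ln (real z) * (\<Sum>m\<in>?R. 1 / real m) \<le> (\<Sum>a\<in>?A. 1 / real a) * (\<Sum>m\<in>?R. 1 / real m)"
    using assms by (intro mult_right_mono harmonic_nats_upto_bounds sum_nonneg) auto
  also have "\<dots> = (\<Sum>(a,m)\<in>?A \<times> ?R. 1 / real (a * m))"
    by (simp add: sum_product sum.cartesian_product)
  also have "\<dots> = (\<Sum>n\<in>(\<lambda>(a,m). a * m) ` (?A \<times> ?R). 1 / real n)"
    by (subst sum.reindex[OF inj]) (simp add: case_prod_unfold)
  also have "\<dots> \<le> (\<Sum>n\<in>nats_upto (y * y). 1 / real n)"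
  proof (intro sum_mono2)
    show "(\<lambda>(a,m). a * m) ` (?A \<times> ?R) \<subseteq> nats_upto (y * y)"
      using assms y by (auto simp: nats_upto_iff intro!: mult_mono)
  qed auto
  also have "\<dots> \<le> 1 + ln (y * y)" using y mult_mono[of 1 y 1 y] by (intro harmonic_nats_upto_bounds) auto
  also have "\<dots> = 1 + 2 * ln y" using y by (simp add: ln_mult)
  also have "\<dots> \<le> 4 * ln y"
  proof -
    have "ln 2 \<le> ln y" using y by simp
    thus ?thesis using ln2_ge_two_thirds by linarith
  qed
  finally show ?thesis using lnz by (simp add: field_simps)
qed

text \<open>The sieve bound comes from \<open>ln m = \<Sum>\<^sub>d\<^sub>|\<^sub>m \<Lambda>(d)\<close> and Chebyshev's estimate, since cofactors of rough numbers are rough.\<close>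

lemma card_rough_le:
  assumes "2 \<le> z" "real z \<le> y"
  shows "real (card (nats_upto y \<inter> rough z)) \<le> 44 * y / ln (real z)"
proof -
  let ?R = "nats_upto y \<inter> rough z"
  have y: "y \<ge> 2" using assms by simp
  have lny: "ln y > 0" using y by simp
  have "real (card ?R) * ln y = (\<Sum>m\<in>?R. ln y)" by simp
  also have "\<dots> = (\<Sum>m\<in>?R. ln (y / real m)) + (\<Sum>m\<in>?R. ln (real m))"
    unfolding sum.distrib[symmetric] using y by (intro sum.cong refl) (auto simp: nats_upto_iff ln_div)
  also have "(\<Sum>m\<in>?R. ln (y / real m)) \<le> (\<Sum>m\<in>?R. y / real m)"
  proof (rule sum_mono)
    fix m assume "m \<in> ?R"
    thus "ln (y / real m) \<le> y / real m" using y ln_le_minus_one[of "y / real m"] by (auto simp: nats_upto_iff)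
  qed
  also have "(\<Sum>m\<in>?R. ln (real m)) = (\<Sum>m\<in>?R. \<Sum>d | d dvd m. mangoldt d)"
    by (intro sum.cong refl) (auto simp: mangoldt_sum nats_upto_iff)
  also have "\<dots> \<le> (\<Sum>m\<in>?R. \<Sum>d | d dvd m. if m div d \<in> rough z then mangoldt d else 0)"
  proof (intro sum_mono eq_refl sum.cong refl)
    fix m d assume "m \<in> ?R" "d \<in> {d. d dvd m}"
    moreover from this have "m div d dvd m" by (metis dvd_div_mult_self dvd_triv_left mem_Collect_eq)
    ultimately have "m div d \<in> rough z" using rough_dvd[of m z "m div d"] by blast
    thus "mangoldt d = (if m div d \<in> rough z then mangoldt d else 0 :: real)" by simp
  qed
  also have "\<dots> \<le> (\<Sum>m\<in>nats_upto y. \<Sum>d | d dvd m. if m div d \<in> rough z then mangoldt d else 0)"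
    by (intro sum_mono2) (auto intro!: sum_nonneg mangoldt_nonneg)
  also have "\<dots> = (\<Sum>m\<in>nats_upto y. \<Sum>d\<in>nats_upto (y / real m). if m \<in> rough z then mangoldt d else 0)"
    by (rule sum_divisors_swap)
  also have "\<dots> = (\<Sum>m\<in>?R. chebyshev_psi (y / real m))"
    unfolding chebyshev_psi_def by (intro sum.mono_neutral_cong_right) auto
  also have "\<dots> \<le> (\<Sum>m\<in>?R. 10 * (y / real m))"
    using y by (intro sum_mono chebyshev_psi_le) auto
  also have "(\<Sum>m\<in>?R. y / real m) + (\<Sum>m\<in>?R. 10 * (y / real m)) = 11 * y * (\<Sum>m\<in>?R. 1 / real m)"
    by (simp add: sum_distrib_left sum.distrib[symmetric])
  also have "\<dots> \<le> 11 * y * (4 * ln y / ln (real z))"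
    using sum_rough_reciprocals_le[OF assms] y by (intro mult_left_mono) auto
  also have "\<dots> = (44 * y / ln (real z)) * ln y" by simp
  finally show ?thesis using lny by (simp only: mult_le_cancel_right_pos)
qed

section \<open>Exceptional pairs and moments of the number of prime factors\<close>

text \<open>These are the pairs for which \<open>f(d m) = - g(m)\<close> may fail.\<close>

definition exceptional :: "nat \<Rightarrow> nat \<Rightarrow> bool" where
  "exceptional d m \<longleftrightarrow> m = 1 \<or> \<not> prime d \<or> d dvd m \<or> m \<in> rough d"

definition exceptional_mass :: "real \<Rightarrow> nat \<Rightarrow> real" where
  "exceptional_mass x m = (\<Sum>d | d \<in> nats_upto (x / real m) \<and> exceptional d m. mangoldt d)"

lemma exceptional_mass_nonneg: "exceptional_mass x m \<ge> 0"
  unfolding exceptional_mass_def by (intro sum_nonneg mangoldt_nonneg)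

lemma exceptional_mass_le_psi: "exceptional_mass x m \<le> chebyshev_psi (x / real m)"
  unfolding exceptional_mass_def chebyshev_psi_def by (intro sum_mono2) (auto intro: mangoldt_nonneg)

lemma powr_three_halves_sum_nonneg: "powr_three_halves_sum \<ge> 0"
  using powr_three_halves_sum_bound[of "{}"] by simp

text \<open>The four causes of exceptionality are estimated separately. For m = 1 there is psi(x);
  proper prime powers d and primes d dividing m lead to convergent series. Only m being d-rough
  costs more: the sieve leaves O(x / (d ln d)) such m, the weight ln d cancels the logarithm, and
  the reciprocals of primes add up to O(ln ln x). This is the source of the half power of ln ln x in
  the final exponent.\<close>

lemma sum_exceptional_mass_le:
  assumes x: "x > 1" "ln (ln x) \<ge> 1"
  shows "(\<Sum>m\<in>nats_upto x. exceptional_mass x m) \<le> (2474 + 6 * powr_three_halves_sum) * (x * ln (ln x))"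
proof -
  let ?X = "nats_upto x" and ?U = "\<lambda>d. nats_upto (x / real d)" and ?c = powr_three_halves_sum
  let ?S = "\<lambda>Q. \<Sum>m\<in>?X. \<Sum>d\<in>?U m. if Q d m then mangoldt d else (0::real)"
  \<comment> \<open>With d as the outer variable, each cause becomes a count of the cofactors m of a
    given d.\<close>
  have swap: "?S Q = (\<Sum>d\<in>?X. mangoldt d * real (card {m \<in> ?U d. Q d m}))" for Q
  proof -
    have "?S Q = (\<Sum>d\<in>?X. \<Sum>m\<in>?U d. if Q d m then mangoldt d else 0)"
      by (rule sum_nats_upto_swap)
    also have "\<dots> = (\<Sum>d\<in>?X. mangoldt d * real (card {m \<in> ?U d. Q d m}))"
    proof (rule sum.cong[OF refl])
      fix d
      have "(\<Sum>m\<in>?U d. if Q d m then mangoldt d else (0::real))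
          = (\<Sum>m | m \<in> ?U d \<and> Q d m. mangoldt d)"
        by (rule sum.mono_neutral_cong_right) auto
      thus "(\<Sum>m\<in>?U d. if Q d m then mangoldt d else (0::real)) = mangoldt d * real (card {m \<in> ?U d. Q d m})"
        by simp
    qed
    finally show ?thesis .
  qed
  have "(\<Sum>m\<in>?X. exceptional_mass x m) = ?S exceptional"
    unfolding exceptional_mass_def
    by (rule sum.cong[OF refl]) (rule sum.mono_neutral_cong_left, auto)
  also have "\<dots> \<le> ?S (\<lambda>d m. m = 1) + ?S (\<lambda>d m. \<not> prime d) + ?S (\<lambda>d m. prime d \<and> d dvd m) + ?S (\<lambda>d m. prime d \<and> m \<noteq> 1 \<and> m \<in> rough d)"
    unfolding sum.distrib[symmetric]
    by (intro sum_mono) (auto simp: exceptional_def mangoldt_nonneg simp del: mangoldt_prime)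
  also have "?S (\<lambda>d m. m = 1) \<le> 10 * x"
  proof -
    have "?S (\<lambda>d m. m = 1) = (\<Sum>m\<in>{1}. \<Sum>d\<in>?U m. mangoldt d)"
      using x by (intro sum.mono_neutral_cong_right) (auto simp: nats_upto_iff)
    also have "\<dots> = chebyshev_psi x" by (simp add: chebyshev_psi_def)
    finally show ?thesis using chebyshev_psi_le[of x] x by simp
  qed
  also have "?S (\<lambda>d m. \<not> prime d) \<le> x * (4 * ?c)"
  proof -
    have "?S (\<lambda>d m. \<not> prime d) \<le> (\<Sum>d\<in>?X. if \<not> prime d then x * (mangoldt d / real d) else 0)"
      unfolding swap
    proof (rule sum_mono)
      fix d assume "d \<in> ?X"
      have "real (card (?U d)) \<le> x / real d" using x by (subst card_nats_upto) auto
      from mult_left_mono[OF this mangoldt_nonneg[of d]]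
      show "mangoldt d * real (card {m \<in> ?U d. \<not> prime d}) \<le> (if \<not> prime d then x * (mangoldt d / real d) else 0)"
        by (auto simp: mult_ac)
    qed
    also have "\<dots> = x * (\<Sum>d | d \<in> ?X \<and> \<not> prime d. mangoldt d / real d)"
      unfolding sum_distrib_left by (rule sum.mono_neutral_cong_right) auto
    also have "\<dots> \<le> x * (4 * ?c)"
      using x by (intro mult_left_mono sum_mangoldt_nonprime_le) auto
    finally show ?thesis .
  qed
  also have "?S (\<lambda>d m. prime d \<and> d dvd m) \<le> x * (2 * ?c)"
  proof -
    have "?S (\<lambda>d m. prime d \<and> d dvd m) \<le> (\<Sum>d\<in>?X. x * (2 * real d powr (-3/2)))"
      unfolding swap
    proof (rule sum_mono)
      fix d assume d: "d \<in> ?X"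
      show "mangoldt d * real (card {m \<in> ?U d. prime d \<and> d dvd m}) \<le> x * (2 * real d powr (-3/2))"
      proof (cases "prime d")
        case True
        have "mangoldt d * real (card {m \<in> ?U d. d dvd m}) \<le> mangoldt d * (x / real d / real d)"
          using d x by (intro mult_left_mono card_multiples_nats_upto_le mangoldt_nonneg) (auto simp: nats_upto_iff)
        also have "\<dots> = x * (ln (real d) / (real d)^2)" using True by (simp add: power2_eq_square)
        also have "\<dots> \<le> x * (2 * real d powr (-3/2))" using d x by (intro mult_left_mono ln_over_square_le) (auto simp: nats_upto_iff)
        finally show ?thesis using True by simp
      qed (use x in auto)
    qed
    also have "\<dots> = x * (2 * (\<Sum>d\<in>?X. real d powr (-3/2)))" by (simp add: sum_distrib_left)
    also have "\<dots> \<le> x * (2 * ?c)" using x powr_three_halves_sum_bound[of "nats_upto x"] by simp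
    finally show ?thesis .
  qed
  also have "?S (\<lambda>d m. prime d \<and> m \<noteq> 1 \<and> m \<in> rough d) \<le> 44 * x * (56 * ln (ln x))"
  proof -
    have "?S (\<lambda>d m. prime d \<and> m \<noteq> 1 \<and> m \<in> rough d) \<le> (\<Sum>d\<in>?X. if prime d then 44 * x * (1 / real d) else 0)"
      unfolding swap
    proof (rule sum_mono)
      fix d assume d: "d \<in> ?X"
      let ?M = "{m \<in> ?U d. prime d \<and> m \<noteq> 1 \<and> m \<in> rough d}"
      show "mangoldt d * real (card ?M) \<le> (if prime d then 44 * x * (1 / real d) else 0)"
      proof (cases "prime d \<and> ?M \<noteq> {}")
        case True
        then obtain m where m: "m \<in> ?U d" "m \<noteq> 1" "m \<in> rough d" "prime d" by auto
        obtain p where p: "prime p" "p dvd m" using m prime_factor_nat by blast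
        have "d < p" "p \<le> m" using m p by (auto simp: rough_def intro: dvd_imp_le)
        \<comment> \<open>The sieve bound requires d not to exceed its range x/d. One admissible m
          ensures this: m has a prime factor above d, so d < m \<le> x/d.\<close>
        hence dx: "real d \<le> x / real d" using m by (auto simp: nats_upto_iff)
        have d2: "d \<ge> 2" using m prime_ge_2_nat by blast
        have "card ?M \<le> card (?U d \<inter> rough d)" by (intro card_mono) auto
        hence "real (card ?M) \<le> real (card (?U d \<inter> rough d))" by simp
        also have "\<dots> \<le> 44 * (x / real d) / ln (real d)" by (rule card_rough_le[OF d2 dx])
        finally have "mangoldt d * real (card ?M) \<le> mangoldt d * (44 * (x / real d) / ln (real d))"
          by (intro mult_left_mono mangoldt_nonneg)
        also have "\<dots> = 44 * x * (1 / real d)" using m d2 by simp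
        finally show ?thesis using True by simp
      next
        case False
        hence "?M = {}" by auto
        hence M0: "mangoldt d * real (card ?M) = 0" by simp
        show ?thesis unfolding M0 using x by simp
      qed
    qed
    also have "\<dots> = 44 * x * prime_reciprocal_sum x"
      unfolding prime_reciprocal_sum_def sum_distrib_left by (rule sum.mono_neutral_cong_right) auto
    also have "\<dots> \<le> 44 * x * (56 * ln (ln x))"
      using x by (intro mult_left_mono prime_reciprocal_sum_le) auto
    finally show ?thesis .
  qed
  finally have "(\<Sum>m\<in>?X. exceptional_mass x m) \<le> (10 + 6 * ?c) * (x * 1) + 2464 * (x * ln (ln x))"
    by (simp add: algebra_simps)
  also have "\<dots> \<le> (10 + 6 * ?c) * (x * ln (ln x)) + 2464 * (x * ln (ln x))"
    using x powr_three_halves_sum_nonneg by (intro add_right_mono mult_left_mono) auto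
  finally show ?thesis by (simp add: algebra_simps)
qed

section \<open>Squarefree integers as finite sets of primes\<close>

lemma prod_primes_properties:
  fixes B :: "nat set"
  assumes "finite B" "\<And>p. p \<in> B \<Longrightarrow> prime p"
  shows "prime_factors (\<Prod>B) = B" "squarefree (\<Prod>B)" "\<Prod>B > 0"
proof -
  have 0: "0 \<notin> (\<lambda>x. x) ` B" using assms(2)[of 0] by auto
  show "prime_factors (\<Prod>B) = B" using prime_factors_prod[OF assms(1) 0] assms(2)
    by (auto simp: prime_prime_factors)
  show "squarefree (\<Prod>B)"
    by (rule squarefree_prod_coprime) (use assms(2) in \<open>auto intro: primes_coprime squarefree_prime\<close>)
  show "\<Prod>B > 0" using assms(2) by (intro prod_pos) (auto simp: prime_gt_0_nat)
qed

lemma prod_prime_factors_squarefree: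
  assumes "squarefree (m::nat)"
  shows "\<Prod>(prime_factors m) = m"
proof -
  have m0: "m > 0" using assms by (auto intro: Nat.gr0I)
  have "m = (\<Prod>p\<in>prime_factors m. p ^ multiplicity p m)" using m0 by (rule prime_factorization_nat)
  also have "\<dots> = (\<Prod>p\<in>prime_factors m. p)"
  proof (rule prod.cong[OF refl])
    fix p assume p: "p \<in> prime_factors m"
    hence "multiplicity p m \<le> 1" using assms m0 by (auto simp: squarefree_factorial_semiring'')
    moreover have "multiplicity p m > 0" using p by (simp add: prime_factors_multiplicity)
    ultimately have "multiplicity p m = 1" by simp
    thus "p ^ multiplicity p m = p" by simp
  qed
  finally show ?thesis by simp
qed

lemma prod_prime_subset_dvd:
  assumes "B \<subseteq> prime_factors (m::nat)" "m > 0"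
  shows "\<Prod>B dvd m"
proof -
  have "\<Prod>B dvd \<Prod>(prime_factors m)" using assms by (intro prod_dvd_prod_subset) auto
  also have "\<dots> dvd (\<Prod>p\<in>prime_factors m. p ^ multiplicity p m)"
    by (intro prod_dvd_prod) (auto simp: prime_factors_multiplicity dvd_power)
  also have "\<dots> = m" using prime_factorization_nat[OF assms(2)] by simp
  finally show ?thesis .
qed

section \<open>Moments of the number of prime factors\<close>

lemma power_le_fact_exp: "t \<ge> 0 \<Longrightarrow> t ^ j \<le> fact j * exp (t::real)"
proof -
  assume t: "t \<ge> 0"
  have "(\<Sum>n\<in>{j}. t ^ n /\<^sub>R fact n) \<le> (\<Sum>n. t ^ n /\<^sub>R fact n)"
    using t by (intro sum_le_suminf summable_exp_generic) auto
  thus ?thesis by (simp add: exp_def field_simps)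
qed

text \<open>\<open>(1 + u) ^ omega m\<close> is the sum of \<open>u ^ card B\<close> over the sets B
  of primes dividing m. After exchanging the sums, the m divisible by all of B contribute a harmonic
  sum divided by the product of B, and summing over B gives an Euler product with factors 1 + u/p
  \<le> exp(u/p).\<close>

lemma sum_power_omega_le:
  assumes x: "x \<ge> 1" and u: "u \<ge> (0::real)"
  shows "(\<Sum>m\<in>nats_upto x. (1 + u) ^ omega m / real m)
       \<le> (1 + ln x) * exp (u * prime_reciprocal_sum x)"
proof -
  define P where "P = {p. p \<in> nats_upto x \<and> prime p}"
  have [simp]: "finite P" by (simp add: P_def)
  have expand: "(1 + u) ^ card A = (\<Sum>B\<in>Pow A. u ^ card B)" if "finite A" for A :: "nat set"
  proof -
    have "(1 + u) ^ card A = (\<Prod>a\<in>A. u + 1)" by (simp add: add.commute)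
    also have "\<dots> = (\<Sum>B\<in>Pow A. u ^ card B)" by (subst prod_add[OF that]) simp
    finally show ?thesis .
  qed
  have sub: "prime_factors m \<subseteq> P" if "m \<in> nats_upto x" for m
  proof
    fix p assume p: "p \<in> prime_factors m"
    hence "p \<le> m" "p > 0" using that by (auto simp: nats_upto_iff intro: dvd_imp_le prime_gt_0_nat)
    thus "p \<in> P" using p that by (auto simp: P_def nats_upto_iff)
  qed
  have "(\<Sum>m\<in>nats_upto x. (1 + u) ^ omega m / real m)
      = (\<Sum>m\<in>nats_upto x. \<Sum>B\<in>Pow P. if B \<subseteq> prime_factors m then u ^ card B / real m else 0)"
  proof (rule sum.cong[OF refl])
    fix m assume m: "m \<in> nats_upto x"
    have "(1 + u) ^ omega m / real m = (\<Sum>B\<in>Pow (prime_factors m). u ^ card B / real m)"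
      by (simp add: omega_def expand sum_divide_distrib)
    also have "\<dots> = (\<Sum>B\<in>Pow P. if B \<subseteq> prime_factors m then u ^ card B / real m else 0)"
      using sub[OF m] by (intro sum.mono_neutral_cong_left) auto
    finally show "(1 + u) ^ omega m / real m = (\<Sum>B\<in>Pow P. if B \<subseteq> prime_factors m then u ^ card B / real m else 0)" .
  qed
  also have "\<dots> = (\<Sum>B\<in>Pow P. \<Sum>m\<in>nats_upto x. if B \<subseteq> prime_factors m then u ^ card B / real m else 0)"
    by (rule sum.swap)
  also have "\<dots> \<le> (\<Sum>B\<in>Pow P. (1 + ln x) * (u ^ card B * (\<Prod>p\<in>B. 1 / real p)))"
  proof (rule sum_mono)
    fix B assume "B \<in> Pow P"
    hence B: "finite B" "\<And>p. p \<in> B \<Longrightarrow> prime p"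
      using finite_subset[of B P] by (auto simp: P_def)
    define q where "q = \<Prod>B"
    have q: "q > 0" using prod_primes_properties[OF B] by (simp add: q_def)
    have "(\<Sum>m\<in>nats_upto x. if B \<subseteq> prime_factors m then u ^ card B / real m else 0)
        = (\<Sum>m | m \<in> nats_upto x \<and> B \<subseteq> prime_factors m. u ^ card B / real m)"
      by (rule sum.mono_neutral_cong_right) auto
    also have "\<dots> \<le> (\<Sum>m\<in>(\<lambda>m. q * m) ` nats_upto x. u ^ card B / real m)"
    proof (rule sum_mono2)
      show "{m. m \<in> nats_upto x \<and> B \<subseteq> prime_factors m} \<subseteq> (\<lambda>m. q * m) ` nats_upto x"
      proof safe
        fix m assume m: "m \<in> nats_upto x" "B \<subseteq> prime_factors m"
        hence "q dvd m" unfolding q_def by (intro prod_prime_subset_dvd) (auto simp: nats_upto_iff)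
        then obtain m' where m': "m = q * m'" by auto
        have "m' > 0" using m m' by (auto simp: nats_upto_iff intro: Nat.gr0I)
        moreover have "m' \<le> m" using m' q by simp
        hence "real m' \<le> x" using m by (auto simp: nats_upto_iff)
        ultimately show "m \<in> (\<lambda>m. q * m) ` nats_upto x" using m' by (auto simp: nats_upto_iff)
      qed
    qed (use u in auto)
    also have "\<dots> = (\<Sum>m\<in>nats_upto x. u ^ card B / real (q * m))"
      using q by (subst sum.reindex) (auto simp: inj_on_def)
    also have "\<dots> = (u ^ card B / real q) * (\<Sum>m\<in>nats_upto x. 1 / real m)"
      by (simp add: sum_distrib_left)
    also have "\<dots> \<le> (u ^ card B / real q) * (1 + ln x)"
      using u x by (intro mult_left_mono harmonic_nats_upto_bounds) auto
    also have "1 / real q = (\<Prod>p\<in>B. 1 / real p)" by (simp add: q_def prod_dividef)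
    hence "(u ^ card B / real q) * (1 + ln x) = (1 + ln x) * (u ^ card B * (\<Prod>p\<in>B. 1 / real p))"
      by (metis mult.commute times_divide_eq_right mult.right_neutral)
    finally show "(\<Sum>m\<in>nats_upto x. if B \<subseteq> prime_factors m then u ^ card B / real m else 0) \<le> (1 + ln x) * (u ^ card B * (\<Prod>p\<in>B. 1 / real p))" .
  qed
  also have "\<dots> = (1 + ln x) * (\<Sum>B\<in>Pow P. \<Prod>p\<in>B. u * (1 / real p))"
    unfolding sum_distrib_left[symmetric] by (simp only: prod.distrib prod_constant)
  also have "(\<Sum>B\<in>Pow P. \<Prod>p\<in>B. u * (1 / real p)) = (\<Prod>p\<in>P. u * (1 / real p) + 1)"
    by (subst prod_add) simp_all
  also have "\<dots> \<le> (\<Prod>p\<in>P. exp (u * (1 / real p)))"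
    using u exp_ge_add_one_self by (intro prod_mono) (auto simp: add.commute)
  also have "\<dots> = exp (u * (\<Sum>p\<in>P. 1 / real p))" by (simp only: exp_sum[symmetric, OF \<open>finite P\<close>] sum_distrib_left)
  finally show ?thesis using x by (simp add: P_def prime_reciprocal_sum_def mult_left_mono)
qed

text \<open>A power of \<open>omega m + 1\<close> is dominated by an exponential, whose mean the
  previous lemma controls. Scaling by a = ln ln x, the typical size of \<open>omega\<close>, loses
  only a constant.\<close>

lemma sum_omega_moment_le:
  assumes x: "x > 1" "ln (ln x) \<ge> 1"
  shows "(\<Sum>m\<in>nats_upto x. real (omega m + 1) ^ j / real m) \<le> fact j * exp 114 * (ln x * ln (ln x) ^ j)"
proof -
  define a where "a = ln (ln x)"
  have a: "a \<ge> 1" using x by (simp add: a_def)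
  have lnx: "ln x \<ge> 1"
  proof -
    have "ln x > 0" using x by simp
    hence "ln x = exp a" by (simp add: a_def)
    also have "\<dots> \<ge> 1 + a" by (rule exp_ge_add_one_self)
    finally show ?thesis using a by simp
  qed
  \<comment> \<open>Then \<open>(1 + u) ^ omega m\<close> is exp(\<open>omega m\<close> / a), while
    u is about 1/a, so that u times the sum of the 1/p, which is O(a), stays bounded by 112.\<close>
  define u where "u = exp (1 / a) - 1"
  have u: "u \<ge> 0" "u \<le> 2 / a"
  proof -
    have "exp (1 / a) \<le> 1 + 1 / a + (1 / a)^2" using a by (intro exp_bound) auto
    also have "(1 / a)^2 \<le> 1 / a" using a by (simp add: power2_eq_square field_simps)
    finally show "u \<le> 2 / a" by (simp add: u_def)
    show "u \<ge> 0" using a by (simp add: u_def)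
  qed
  have "(\<Sum>m\<in>nats_upto x. real (omega m + 1) ^ j / real m) \<le> (\<Sum>m\<in>nats_upto x. fact j * a ^ j * exp 1 * ((1 + u) ^ omega m / real m))"
  proof (rule sum_mono)
    fix m
    have "(real (omega m + 1) / a) ^ j \<le> fact j * exp (real (omega m + 1) / a)"
      using a by (intro power_le_fact_exp) auto
    also have "exp (real (omega m + 1) / a) = exp (1 / a) * exp (1 / a) ^ omega m"
      by (simp add: exp_of_nat_mult[symmetric] exp_add[symmetric] add_divide_distrib)
    also have "\<dots> \<le> exp 1 * exp (1 / a) ^ omega m" using a by (intro mult_right_mono) auto
    finally have "(real (omega m + 1) / a) ^ j \<le> fact j * (exp 1 * (1 + u) ^ omega m)" by (simp add: u_def)
    hence "real (omega m + 1) ^ j \<le> fact j * a ^ j * exp 1 * (1 + u) ^ omega m"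
      using a by (simp add: power_divide field_simps)
    from divide_right_mono[OF this, of "real m"]
    show "real (omega m + 1) ^ j / real m \<le> fact j * a ^ j * exp 1 * ((1 + u) ^ omega m / real m)" by simp
  qed
  also have "\<dots> = fact j * a ^ j * exp 1 * (\<Sum>m\<in>nats_upto x. (1 + u) ^ omega m / real m)"
    by (simp add: sum_distrib_left)
  also have "\<dots> \<le> fact j * a ^ j * exp 1 * ((1 + ln x) * exp (u * prime_reciprocal_sum x))"
    using a x u by (intro mult_left_mono sum_power_omega_le) auto
  also have "\<dots> \<le> fact j * a ^ j * exp 1 * ((2 * ln x) * exp 112)"
  proof (intro mult_left_mono mult_mono)
    have "u * prime_reciprocal_sum x \<le> 2 / a * (56 * ln (ln x))"
      using u x a by (intro mult_mono prime_reciprocal_sum_le) (auto simp: prime_reciprocal_sum_def intro!: sum_nonneg)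
    also have "\<dots> = 112" using a by (simp add: a_def[symmetric])
    finally show "exp (u * prime_reciprocal_sum x) \<le> exp 112" by simp
  qed (use a lnx in auto)
  \<comment> \<open>Replacing 2 by e lets the constants combine: 114 = 1 + 1 + 112, the first 1
    coming from exp(1/a) \<le> e.\<close>
  also have "\<dots> \<le> fact j * a ^ j * exp 1 * ((exp 1 * ln x) * exp 112)"
    using a lnx exp_ge_add_one_self[of "1::real"] by (intro mult_left_mono mult_right_mono) auto
  also have "\<dots> = fact j * (exp 1 * exp 1 * exp 112) * (ln x * a ^ j)" by simp
  also have "exp 1 * exp 1 * exp 112 = exp (114::real)" by (simp flip: exp_add)
  finally show ?thesis by (simp add: a_def)
qed

section \<open>Divisor sums of Moebius weights\<close>

text \<open>The parameter c covers both functions of the overview: c = 0 is \<open>f\<close> and c =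
  1 is \<open>g\<close>. The condition \<open>2 \<le> n\<close> excludes n = 1, where the minimum
  would be taken over the empty set.\<close>

definition moebius_weight :: "nat \<Rightarrow> nat \<Rightarrow> nat \<Rightarrow> nat \<Rightarrow> nat \<Rightarrow> real" where
  "moebius_weight i c j l n = (if 2 \<le> n \<and> [least_prime_factor n = j] (mod l)
     then real_of_int (moebius_mu n) * real (omega n + c) ^ i else 0)"

lemma abs_moebius_weight_le: "\<bar>moebius_weight i c j l n\<bar> \<le> real (omega n + c) ^ i"
  by (auto simp: moebius_weight_def moebius_mu_def abs_mult power_abs)

text \<open>Each element of Y acts as a difference operator. Pairing B with
  \<open>insert y B\<close> replaces t^i by t^i - (t + 1)^i, a combination of powers k < i, to which
  the induction hypothesis applies with one element fewer. The shift c stays fixed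
  throughout.\<close>

lemma alternating_sum_Pow_eq_0:
  assumes "finite Y" "i < card Y"
  shows "(\<Sum>B\<in>Pow Y. (-1) ^ card B * (real (card B) + c) ^ i) = 0"
  using assms
proof (induction Y arbitrary: i c rule: finite_induct)
  case (insert y Y)
  have fin: "finite B" if "B \<in> Pow Y" for B using that insert(1) finite_subset by auto
  have "(\<Sum>B\<in>Pow (insert y Y). (-1) ^ card B * (real (card B) + c) ^ i)
      = (\<Sum>B\<in>Pow Y. (-1) ^ card B * (real (card B) + c) ^ i) + (\<Sum>B\<in>insert y ` Pow Y. (-1) ^ card B * (real (card B) + c) ^ i)"
    unfolding Pow_insert using insert by (intro sum.union_disjoint) auto
  also have "(\<Sum>B\<in>insert y ` Pow Y. (-1) ^ card B * (real (card B) + c) ^ i) = (\<Sum>B\<in>Pow Y. (-1) ^ card (insert y B) * (real (card (insert y B)) + c) ^ i)"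
    using insert(2) by (subst sum.reindex) (auto simp: inj_on_def)
  also have "\<dots> = (\<Sum>B\<in>Pow Y. - ((-1) ^ card B * ((real (card B) + c) + 1) ^ i))"
  proof (rule sum.cong[OF refl])
    fix B assume B: "B \<in> Pow Y"
    hence "card (insert y B) = Suc (card B)" using insert(2) fin[OF B] B by (subst card_insert_disjoint) auto
    thus "(-1) ^ card (insert y B) * (real (card (insert y B)) + c) ^ i = - ((-1) ^ card B * ((real (card B) + c) + 1) ^ i)"
      by (simp add: add_ac)
  qed
  also have "(\<Sum>B\<in>Pow Y. (-1) ^ card B * (real (card B) + c) ^ i) + \<dots>
    = (\<Sum>B\<in>Pow Y. - (\<Sum>k<i. real (i choose k) * ((-1) ^ card B * (real (card B) + c) ^ k)))"
    unfolding sum.distrib[symmetric]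
  proof (rule sum.cong[OF refl])
    fix B
    let ?t = "real (card B) + c"
    have "(?t + 1) ^ i = (\<Sum>k\<le>i. real (i choose k) * ?t ^ k)" by (simp add: binomial_ring)
    also have "\<dots> = (\<Sum>k<i. real (i choose k) * ?t ^ k) + ?t ^ i" by (simp add: lessThan_Suc_atMost[symmetric])
    finally show "(-1) ^ card B * ?t ^ i + - ((-1) ^ card B * (?t + 1) ^ i) = - (\<Sum>k<i. real (i choose k) * ((-1) ^ card B * ?t ^ k))"
      by (simp add: sum_distrib_left algebra_simps)
  qed
  also have "\<dots> = - (\<Sum>k<i. real (i choose k) * (\<Sum>B\<in>Pow Y. (-1) ^ card B * (real (card B) + c) ^ k))"
    by (simp add: sum_negf sum_distrib_left sum.swap[of _ "{..<i}"])
  also have "\<dots> = 0" using insert by simp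
  finally show ?case .
qed simp

text \<open>The sum vanishes unless \<open>card Y \<le> i\<close>, and then at most 2^i subsets
  remain, each of size at most i. The bound is independent of Y.\<close>

lemma abs_alternating_sum_Pow_le:
  assumes "finite Y" "c \<ge> 0"
  shows "\<bar>\<Sum>B\<in>Pow Y. (-1) ^ card B * (real (card B) + c) ^ i\<bar> \<le> 2 ^ i * (real i + c) ^ i"
proof (cases "i < card Y")
  case True
  thus ?thesis using alternating_sum_Pow_eq_0[OF assms(1) True] assms by simp
next
  case False
  have "\<bar>\<Sum>B\<in>Pow Y. (-1) ^ card B * (real (card B) + c) ^ i\<bar> \<le> (\<Sum>B\<in>Pow Y. (real i + c) ^ i)"
  proof (rule order.trans[OF sum_abs], rule sum_mono)
    fix B assume "B \<in> Pow Y"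
    hence "card B \<le> i" using False card_mono[OF assms(1), of B] by auto
    thus "\<bar>(-1) ^ card B * (real (card B) + c) ^ i\<bar> \<le> (real i + c) ^ i"
      using assms(2) by (simp add: abs_mult power_abs power_mono)
  qed
  also have "\<dots> = 2 ^ card Y * (real i + c) ^ i" using assms(1) by (simp add: card_Pow)
  also have "\<dots> \<le> 2 ^ i * (real i + c) ^ i" using False assms(2) by (intro mult_right_mono) auto
  finally show ?thesis .
qed

lemma sum_squarefree_divisors:
  fixes f :: "nat \<Rightarrow> real"
  assumes "n > 0" "\<And>m. \<not> squarefree m \<Longrightarrow> f m = 0"
  shows "(\<Sum>m | m dvd n. f m) = (\<Sum>B\<in>Pow (prime_factors n). f (\<Prod>B))"
proof -
  have B: "finite B" "\<And>p. p \<in> B \<Longrightarrow> prime p" if "B \<in> Pow (prime_factors n)" for B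
    using that finite_subset[of B "prime_factors n"] by auto
  have "(\<Sum>m | m dvd n. f m) = (\<Sum>m | m dvd n \<and> squarefree m. f m)"
    using assms by (intro sum.mono_neutral_right) auto
  also have "\<dots> = (\<Sum>B\<in>Pow (prime_factors n). f (\<Prod>B))"
  proof (rule sum.reindex_bij_witness[where i = "\<lambda>B. \<Prod>B" and j = prime_factors])
    fix m assume m: "m \<in> {m. m dvd n \<and> squarefree m}"
    show "\<Prod>(prime_factors m) = m" using m by (intro prod_prime_factors_squarefree) auto
    show "prime_factors m \<in> Pow (prime_factors n)" using dvd_prime_factors[of n m] m assms by auto
    show "f (\<Prod>(prime_factors m)) = f m" using m by (subst prod_prime_factors_squarefree) auto
  next
    fix C assume C: "C \<in> Pow (prime_factors n)"
    show "prime_factors (\<Prod>C) = C" by (rule prod_primes_properties(1)) (use B[OF C] in auto)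
    have "squarefree (\<Prod>C)" by (rule prod_primes_properties(2)) (use B[OF C] in auto)
    moreover have "\<Prod>C dvd n" using C assms(1) by (intro prod_prime_subset_dvd) auto
    ultimately show "\<Prod>C \<in> {m. m dvd n \<and> squarefree m}" by simp
  qed
  finally show ?thesis .
qed

text \<open>The squarefree divisors are grouped by their smallest prime p. The residue condition
  concerns p alone, and the other primes range freely over the subsets of the larger prime factors
  of n; so each of the at most \<open>omega n\<close> groups is an unrestricted alternating sum and
  is O(1).\<close>

lemma abs_sum_divisors_moebius_weight_le:
  assumes n: "n > 0"
  shows "\<bar>\<Sum>m | m dvd n. moebius_weight i c j l m\<bar> \<le> 2 ^ i * (real i + 1 + real c) ^ i * real (omega n)"
proof -
  let ?X = "prime_factors n"
  let ?P = "\<lambda>p. [p = j] (mod l)"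
  let ?Y = "\<lambda>p. {q \<in> ?X. p < q}"
  have B: "finite B" "\<And>p. p \<in> B \<Longrightarrow> prime p" if "B \<in> Pow ?X" for B
    using that finite_subset[of B ?X] by auto
  have "(\<Sum>m | m dvd n. moebius_weight i c j l m) = (\<Sum>B\<in>Pow ?X. moebius_weight i c j l (\<Prod>B))"
    using n by (intro sum_squarefree_divisors) (auto simp: moebius_weight_def moebius_mu_def)
  also have "\<dots> = (\<Sum>B | B \<in> Pow ?X \<and> B \<noteq> {} \<and> ?P (Min B). (-1) ^ card B * (real (card B) + real c) ^ i)"
  proof (rule sum.mono_neutral_cong_right)
    fix C assume C: "C \<in> {B. B \<in> Pow ?X \<and> B \<noteq> {} \<and> ?P (Min B)}"
    hence fc: "finite C" "\<And>p. p \<in> C \<Longrightarrow> prime p" using B[of C] by auto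
    note pr = prod_primes_properties[OF fc]
    obtain p where p: "p \<in> C" using C by auto
    have "p dvd \<Prod>C" using p fc by (intro dvd_prodI) auto
    hence "\<Prod>C \<ge> p" using pr by (intro dvd_imp_le) auto
    moreover have "p \<ge> 2" using fc p prime_ge_2_nat by auto
    ultimately have "2 \<le> \<Prod>C" by simp
    thus "moebius_weight i c j l (\<Prod>C) = (-1) ^ card C * (real (card C) + real c) ^ i"
      using C pr by (simp add: moebius_weight_def moebius_mu_def omega_def least_prime_factor_def)
  next
    show "\<forall>C\<in>Pow ?X - {B. B \<in> Pow ?X \<and> B \<noteq> {} \<and> ?P (Min B)}. moebius_weight i c j l (\<Prod>C) = 0"
    proof
      fix C assume C: "C \<in> Pow ?X - {B. B \<in> Pow ?X \<and> B \<noteq> {} \<and> ?P (Min B)}"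
      hence fc: "finite C" "\<And>p. p \<in> C \<Longrightarrow> prime p" using B[of C] by auto
      show "moebius_weight i c j l (\<Prod>C) = 0"
        using C prod_primes_properties[OF fc] by (auto simp: moebius_weight_def least_prime_factor_def)
    qed
  qed auto
  \<comment> \<open>Removing the minimum lowers the cardinality by one: the sign flips and the shift
    c becomes 1 + c.\<close>
  also have "\<dots> = (\<Sum>(p,B)\<in>Sigma {p\<in>?X. ?P p} (\<lambda>p. Pow (?Y p)). - ((-1) ^ card B * (real (card B) + (1 + real c)) ^ i))"
  proof (rule sum.reindex_bij_witness[where i = "\<lambda>(p,B). insert p B" and j = "\<lambda>B. (Min B, B - {Min B})"])
    fix C assume C: "C \<in> {B. B \<in> Pow ?X \<and> B \<noteq> {} \<and> ?P (Min B)}"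
    hence fc: "finite C" using B[of C] by auto
    have M: "Min C \<in> C" using C fc by auto
    show "(case (Min C, C - {Min C}) of (p, B) \<Rightarrow> insert p B) = C" using M by auto
    have "Min C < q" if "q \<in> C" "q \<noteq> Min C" for q using that Min_le[OF fc, of q] by auto
    thus "(Min C, C - {Min C}) \<in> Sigma {p\<in>?X. ?P p} (\<lambda>p. Pow (?Y p))" using C M by auto
    have "card C = Suc (card (C - {Min C}))" using M fc by (metis card_Suc_Diff1)
    thus "(case (Min C, C - {Min C}) of (p, B) \<Rightarrow> - ((-1) ^ card B * (real (card B) + (1 + real c)) ^ i)) = (-1) ^ card C * (real (card C) + real c) ^ i"
      by (simp add: add_ac)
  next
    fix z assume "z \<in> Sigma {p\<in>?X. ?P p} (\<lambda>p. Pow (?Y p))"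
    then obtain p C where z: "z = (p, C)" "p \<in> ?X" "?P p" "C \<subseteq> ?Y p" by auto
    have fc: "finite C" using z(4) finite_subset[of C ?X] by auto
    have M: "Min (insert p C) = p" using z fc by (intro Min_eqI) auto
    show "(Min (case z of (p, B) \<Rightarrow> insert p B), (case z of (p, B) \<Rightarrow> insert p B) - {Min (case z of (p, B) \<Rightarrow> insert p B)}) = z"
      using z M by auto
    show "(case z of (p, B) \<Rightarrow> insert p B) \<in> {B. B \<in> Pow ?X \<and> B \<noteq> {} \<and> ?P (Min B)}"
      using z M by auto
  qed
  also have "\<dots> = (\<Sum>p | p \<in> ?X \<and> ?P p. \<Sum>B\<in>Pow (?Y p). - ((-1) ^ card B * (real (card B) + (1 + real c)) ^ i))"
    by (subst sum.Sigma) auto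
  finally have eq: "(\<Sum>m | m dvd n. moebius_weight i c j l m) = \<dots>" .
  have "\<bar>\<Sum>m | m dvd n. moebius_weight i c j l m\<bar> \<le> (\<Sum>p | p \<in> ?X \<and> ?P p. 2 ^ i * (real i + (1 + real c)) ^ i)"
    unfolding eq sum_negf abs_minus_cancel
    by (rule order.trans[OF sum_abs], rule sum_mono, rule abs_alternating_sum_Pow_le) auto
  also have "\<dots> = real (card {p. p \<in> ?X \<and> ?P p}) * (2 ^ i * (real i + (1 + real c)) ^ i)"
    by (rule sum_constant)
  also have "\<dots> \<le> real (omega n) * (2 ^ i * (real i + (1 + real c)) ^ i)"
  proof (rule mult_right_mono)
    show "real (card {p. p \<in> ?X \<and> ?P p}) \<le> real (omega n)"
      unfolding omega_def of_nat_le_iff by (rule card_mono) auto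
  qed simp
  finally show ?thesis by (simp only: mult.commute add.assoc)
qed

section \<open>The zeta function to the right of the line Re s = 39/40\<close>

text \<open>The term is \<open>s - 1\<close> times the integral of \<open>N\<^sup>-\<^sup>s - u\<^sup>-\<^sup>s\<close> over \<open>u \<in> [N, N + 1]\<close>, where \<open>N = n + 1\<close>. Summing these gives \<open>(s - 1) \<zeta>(s) - 1\<close>.\<close>

definition zeta_term :: "nat \<Rightarrow> complex \<Rightarrow> complex" where
  "zeta_term n s = (s - 1) * of_nat (Suc n) powr (-s) - of_nat (Suc n) powr (1 - s) + of_nat (Suc (Suc n)) powr (1 - s)"

definition reg_zeta :: "complex \<Rightarrow> complex" where
  "reg_zeta s = 1 + (\<Sum>n. zeta_term n s)"

lemma norm_nat_powr: "n > 0 \<Longrightarrow> norm (of_nat n powr s :: complex) = real n powr Re s"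
  using norm_powr_real_powr[of "of_nat n" s] by simp

text \<open>Interpolation between the trivial bound 2 N^(-Re s) and the mean value bound |s| N^(-Re
  s - 1), with exponents 19/20 and 1/20. A small power of |s| buys a small gain in N, which is
  enough for convergence left of Re s = 1.\<close>

lemma norm_powr_diff_le:
  assumes "N \<ge> (1::real)" "N \<le> u" "u \<le> N + 1" "Re s \<ge> 0"
  shows "norm (of_real N powr (-s) - of_real u powr (-s) :: complex) \<le> 2 * norm s powr (1/20) * N powr (- Re s - 1/20)"
proof -
  define X where "X = norm (of_real N powr (-s) - of_real u powr (-s) :: complex)"
  have nrm: "norm (of_real r powr z :: complex) = r powr Re z" if "r \<ge> 1" for r z
    using that by (subst norm_powr_real_powr) auto
  have A: "X \<le> 2 * N powr (- Re s)"
  proof -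
    have "X \<le> norm (of_real N powr (-s) :: complex) + norm (of_real u powr (-s) :: complex)"
      unfolding X_def by (rule norm_triangle_ineq4)
    also have "\<dots> = N powr (- Re s) + u powr (- Re s)" using assms by (simp add: nrm)
    also have "u powr (- Re s) \<le> N powr (- Re s)" using assms by (intro powr_mono2') auto
    finally show ?thesis by simp
  qed
  have B: "X \<le> norm s * N powr (- Re s - 1)"
  proof -
    let ?S = "closed_segment (complex_of_real N) (complex_of_real u)"
    have seg: "\<exists>r. z = of_real r \<and> N \<le> r" if "z \<in> ?S" for z
      using that assms by (auto simp: closed_segment_of_real closed_segment_eq_real_ivl)
    have "X \<le> norm s * N powr (- Re s - 1) * norm (of_real N - of_real u :: complex)"
      unfolding X_def
    proof (rule field_differentiable_bound[of ?S "\<lambda>w. w powr (-s)" "\<lambda>w. (-s) * w powr (-s - 1)"])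
      fix z assume "z \<in> ?S"
      then obtain r where r: "z = of_real r" "N \<le> r" using seg by blast
      have "z \<notin> \<real>\<^sub>\<le>\<^sub>0" using r assms by simp
      thus "((\<lambda>w. w powr (-s)) has_field_derivative (-s) * z powr (-s - 1)) (at z within ?S)"
        by (rule has_field_derivative_at_within[OF has_field_derivative_powr])
      have "norm ((-s) * z powr (-s - 1)) = norm s * r powr (- Re s - 1)"
        using r assms by (simp add: norm_mult nrm)
      also have "\<dots> \<le> norm s * N powr (- Re s - 1)"
        using r assms by (intro mult_left_mono powr_mono2') auto
      finally show "norm ((-s) * z powr (-s - 1)) \<le> norm s * N powr (- Re s - 1)" .
    qed auto
    also have "norm (of_real N - of_real u :: complex) = u - N"
      using assms by (metis abs_of_nonneg diff_ge_0_iff_ge norm_minus_commute norm_of_real of_real_diff)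
    also have "norm s * N powr (- Re s - 1) * (u - N) \<le> norm s * N powr (- Re s - 1) * 1"
      using assms by (intro mult_left_mono) auto
    finally show ?thesis by simp
  qed
  have X0: "X \<ge> 0" by (simp add: X_def)
  have "X = X powr (19/20) * X powr (1/20)"
    using X0 by (cases "X = 0") (auto simp flip: powr_add)
  also have "\<dots> \<le> (2 * N powr (- Re s)) powr (19/20) * (norm s * N powr (- Re s - 1)) powr (1/20)"
    using A B X0 by (intro mult_mono powr_mono2) auto
  also have "\<dots> = 2 powr (19/20) * norm s powr (1/20) * (N powr (- Re s * (19/20)) * N powr ((- Re s - 1) * (1/20)))"
    using assms by (simp add: powr_mult powr_powr mult_ac)
  also have "N powr (- Re s * (19/20)) * N powr ((- Re s - 1) * (1/20)) = N powr (- Re s - 1/20)"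
    by (subst powr_add [symmetric], rule arg_cong[where f = "\<lambda>e. N powr e"]) argo
  also have "2 powr (19/20) * norm s powr (1/20) * N powr (- Re s - 1/20) \<le> 2 powr 1 * norm s powr (1/20) * N powr (- Re s - 1/20)"
    by (intro mult_right_mono powr_mono) auto
  finally show ?thesis by (simp add: X_def)
qed

lemma norm_zeta_term_le:
  assumes "Re s \<ge> 39/40"
  shows "norm (zeta_term n s) \<le> 2 * norm (s - 1) * norm s powr (1/20) * real (Suc n) powr (-41/40)"
proof -
  define N where "N = real (Suc n)"
  have N: "N \<ge> 1" by (simp add: N_def)
  \<comment> \<open>Its increment from N to N + 1 is the term in question, and its derivative is s -
    1 times the difference estimated above.\<close>
  define \<phi> where "\<phi> = (\<lambda>w::complex. (s - 1) * of_real N powr (-s) * w + w powr (1 - s))"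
  let ?S = "closed_segment (complex_of_real N) (complex_of_real (N + 1))"
  have seg: "\<exists>r. z = of_real r \<and> N \<le> r \<and> r \<le> N + 1" if "z \<in> ?S" for z
  proof -
    have "z \<in> of_real ` closed_segment N (N + 1)" using that by (simp only: closed_segment_of_real)
    thus ?thesis by (auto simp: closed_segment_eq_real_ivl)
  qed
  have "norm (\<phi> (of_real (N + 1)) - \<phi> (of_real N)) \<le> (norm (s - 1) * (2 * norm s powr (1/20) * N powr (- Re s - 1/20))) * norm (of_real (N + 1) - of_real N :: complex)"
  proof (rule field_differentiable_bound[of ?S \<phi> "\<lambda>w. (s - 1) * of_real N powr (-s) + (1 - s) * w powr (1 - s - 1)"])
    fix z assume "z \<in> ?S"
    then obtain r where r: "z = of_real r" "N \<le> r" "r \<le> N + 1" using seg by blast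
    have nz: "z \<notin> \<real>\<^sub>\<le>\<^sub>0" using r N by simp
    show "(\<phi> has_field_derivative (s - 1) * of_real N powr (-s) + (1 - s) * z powr (1 - s - 1)) (at z within ?S)"
      unfolding \<phi>_def
      by (rule has_field_derivative_at_within) (use nz in \<open>auto intro!: derivative_eq_intros has_field_derivative_powr\<close>)
    have "(s - 1) * of_real N powr (-s) + (1 - s) * z powr (1 - s - 1) = (s - 1) * (of_real N powr (-s) - of_real r powr (-s))"
      by (simp add: r algebra_simps)
    also have "norm \<dots> \<le> norm (s - 1) * (2 * norm s powr (1/20) * N powr (- Re s - 1/20))"
      unfolding norm_mult using r N assms by (intro mult_left_mono norm_powr_diff_le) auto
    finally show "norm ((s - 1) * of_real N powr (-s) + (1 - s) * z powr (1 - s - 1)) \<le> norm (s - 1) * (2 * norm s powr (1/20) * N powr (- Re s - 1/20))" .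
  qed auto
  also have "\<phi> (of_real (N + 1)) - \<phi> (of_real N) = zeta_term n s"
    by (simp add: \<phi>_def zeta_term_def N_def algebra_simps)
  also have "norm (of_real (N + 1) - of_real N :: complex) = 1" by simp
  also have "norm (s - 1) * (2 * norm s powr (1/20) * N powr (- Re s - 1/20)) * 1 \<le> norm (s - 1) * (2 * norm s powr (1/20) * N powr (-41/40))"
    unfolding mult_1_right using N assms by (intro mult_left_mono powr_mono) auto
  finally show ?thesis by (simp add: N_def mult_ac)
qed

lemma summable_Suc_powr: "a < -1 \<Longrightarrow> summable (\<lambda>n. real (Suc n) powr a)"
  by (subst summable_Suc_iff) (simp add: summable_real_powr_iff)

definition zeta_bound_const :: real where
  "zeta_bound_const = 2 * (\<Sum>n. real (Suc n) powr (-41/40))"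

lemma summable_norm_zeta_term:
  assumes "Re s \<ge> 39/40"
  shows "summable (\<lambda>n. norm (zeta_term n s))"
  by (rule summable_comparison_test'[of "\<lambda>n. 2 * norm (s - 1) * norm s powr (1/20) * real (Suc n) powr (-41/40)" 0])
     (use norm_zeta_term_le[OF assms] in \<open>auto intro!: summable_mult summable_Suc_powr simp del: of_nat_Suc\<close>)

lemma norm_reg_zeta_le:
  assumes "Re s \<ge> 39/40"
  shows "norm (reg_zeta s - 1) \<le> zeta_bound_const * norm (s - 1) * norm s powr (1/20)"
proof -
  have "norm (reg_zeta s - 1) \<le> (\<Sum>n. norm (zeta_term n s))"
    unfolding reg_zeta_def using summable_norm[OF summable_norm_zeta_term[OF assms]] by simp
  also have "\<dots> \<le> (\<Sum>n. 2 * norm (s - 1) * norm s powr (1/20) * real (Suc n) powr (-41/40))"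
    by (intro suminf_le norm_zeta_term_le[OF assms] summable_norm_zeta_term[OF assms] summable_mult summable_Suc_powr) auto
  also have "\<dots> = 2 * norm (s - 1) * norm s powr (1/20) * (\<Sum>n. real (Suc n) powr (-41/40))"
    by (intro suminf_mult summable_Suc_powr) simp
  finally show ?thesis by (simp add: zeta_bound_const_def mult_ac)
qed

lemma zeta_bound_const_nonneg: "zeta_bound_const \<ge> 0"
  unfolding zeta_bound_const_def by (intro mult_nonneg_nonneg suminf_nonneg summable_Suc_powr) auto

lemma has_field_derivative_powr_right_chain:
  assumes "w \<noteq> (0::complex)" "(f has_field_derivative D) (at s)"
  shows "((\<lambda>z. w powr f z) has_field_derivative (Ln w * w powr f s * D)) (at s)"
  using DERIV_chain2[OF has_field_derivative_powr_right[OF assms(1)] assms(2)] .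

lemma zeta_term_has_field_derivative:
  "\<exists>D. (zeta_term n has_field_derivative D) (at s)"
  unfolding zeta_term_def [abs_def]
  by (rule exI, (rule DERIV_add DERIV_diff DERIV_mult DERIV_ident DERIV_const DERIV_minus
        has_field_derivative_powr_right_chain | simp del: of_nat_Suc)+)

text \<open>The majorant of the terms grows with |s|, so differentiation of the series term by term
  is done on the intersection with a ball, where it is uniform.\<close>

lemma reg_zeta_holomorphic: "reg_zeta holomorphic_on {s. Re s > 39/40}"
proof -
  have "reg_zeta field_differentiable at s" if s: "Re s > 39/40" for s
  proof -
    define R where "R = norm s + 1"
    let ?S = "{s. Re s > 39/40} \<inter> ball 0 R"
    have o: "open ?S" by (intro open_Int open_halfspace_Re_gt open_ball)
    obtain f' where f': "\<And>n s. (zeta_term n has_field_derivative f' n s) (at s)"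
      using zeta_term_has_field_derivative by metis
    obtain g g' where g: "\<forall>x\<in>?S. ((\<lambda>n. zeta_term n x) sums g x) \<and> ((\<lambda>n. f' n x) sums g' x) \<and> (g has_field_derivative g' x) (at x)"
    proof (rule series_and_derivative_comparison[OF o])
      show "summable (\<lambda>n. 2 * (R + 1) * R powr (1/20) * real (Suc n) powr (-41/40))"
        by (intro summable_mult summable_Suc_powr) auto
      show "\<forall>\<^sub>F n in sequentially. \<forall>x\<in>?S. norm (zeta_term n x) \<le> 2 * (R + 1) * R powr (1/20) * real (Suc n) powr (-41/40)"
      proof (intro always_eventually allI ballI)
        fix n x assume x: "x \<in> ?S"
        have "norm (zeta_term n x) \<le> 2 * norm (x - 1) * norm x powr (1/20) * real (Suc n) powr (-41/40)"
          by (rule norm_zeta_term_le) (use x in auto)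
        also have "\<dots> \<le> 2 * (R + 1) * R powr (1/20) * real (Suc n) powr (-41/40)"
          using x norm_triangle_ineq4[of x 1] by (intro mult_right_mono mult_mono powr_mono2) (auto simp: R_def)
        finally show "norm (zeta_term n x) \<le> 2 * (R + 1) * R powr (1/20) * real (Suc n) powr (-41/40)" .
      qed
    qed (rule f', blast)
    have sS: "s \<in> ?S" using s by (simp add: R_def)
    have "((\<lambda>x. 1 + g x) has_field_derivative g' s) (at s)" using g sS by (auto intro!: derivative_eq_intros)
    hence "(reg_zeta has_field_derivative g' s) (at s)"
    proof (rule has_field_derivative_transform_within_open[OF _ o sS])
      fix x assume "x \<in> ?S"
      thus "1 + g x = reg_zeta x" using g by (auto simp: reg_zeta_def sums_iff)
    qed
    thus ?thesis by (auto simp: field_differentiable_def)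
  qed
  thus ?thesis by (auto simp: holomorphic_on_def intro: field_differentiable_at_within)
qed

text \<open>The summand for \<open>n = 0\<close> vanishes because \<open>0 powr z = 0\<close>.\<close>

definition zeta :: "complex \<Rightarrow> complex" where
  "zeta s = (\<Sum>n. of_nat n powr (-s))"

lemma norm_nat_powr': "Re s > 0 \<Longrightarrow> norm (of_nat n powr (-s) :: complex) = real n powr (- Re s)"
  by (cases "n = 0") (auto simp: norm_nat_powr)

lemma summable_norm_zeta: "Re s > 1 \<Longrightarrow> summable (\<lambda>n. norm (of_nat n powr (-s) :: complex))"
  by (simp add: norm_nat_powr' summable_real_powr_iff)

lemma sums_zeta: "Re s > 1 \<Longrightarrow> (\<lambda>n. of_nat n powr (-s)) sums zeta s"
  unfolding zeta_def using summable_norm_cancel[OF summable_norm_zeta] by (rule summable_sums)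

text \<open>The partial sums telescope; the boundary term \<open>of_nat (Suc M) powr (1 - s)\<close>
  tends to 0 because Re s > 1.\<close>

lemma reg_zeta_eq:
  assumes "Re s > 1"
  shows "reg_zeta s = (s - 1) * zeta s"
proof -
  have part: "(\<Sum>n<M. zeta_term n s) = (s - 1) * (\<Sum>n<M. of_nat (Suc n) powr (-s)) - 1 + of_nat (Suc M) powr (1 - s)" for M
    by (induction M) (simp_all add: zeta_term_def algebra_simps)
  have "(\<lambda>n. of_nat (Suc n) powr (-s)) sums (zeta s - of_nat 0 powr (-s))"
    using sums_zeta[OF assms] by (subst sums_Suc_iff) simp
  hence 1: "(\<lambda>M. \<Sum>n<M. of_nat (Suc n) powr (-s)) \<longlonglongrightarrow> zeta s" by (simp add: sums_def)
  have 2: "(\<lambda>M. of_nat (Suc M) powr (1 - s) :: complex) \<longlonglongrightarrow> 0"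
  proof (rule tendsto_norm_zero_cancel)
    have "(\<lambda>M. norm (of_nat (Suc M) powr (1 - s) :: complex)) = (\<lambda>M. real (Suc M) powr (1 - Re s))"
      by (subst norm_nat_powr) auto
    moreover have "\<dots> \<longlonglongrightarrow> 0" using assms
      by (intro tendsto_neg_powr filterlim_compose[OF filterlim_real_sequentially filterlim_Suc]) auto
    ultimately show "(\<lambda>M. norm (of_nat (Suc M) powr (1 - s) :: complex)) \<longlonglongrightarrow> 0" by simp
  qed
  have "(\<lambda>M. \<Sum>n<M. zeta_term n s) \<longlonglongrightarrow> (s - 1) * zeta s - 1 + 0"
    unfolding part by (intro tendsto_intros 1 2)
  hence "(\<lambda>n. zeta_term n s) sums ((s - 1) * zeta s - 1)" by (simp add: sums_def)
  thus ?thesis by (simp add: reg_zeta_def sums_iff)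
qed

section \<open>Derivative and logarithmic derivative of zeta as Dirichlet series\<close>

definition zeta_log_series :: "complex \<Rightarrow> complex" where
  "zeta_log_series s = (\<Sum>n. of_real (ln (real n)) * of_nat n powr (-s))"

lemma ln_nat_powr_le:
  assumes "a > 0"
  shows "ln (real n) \<le> real n powr a / a"
proof (cases "n = 0")
  case False
  have "a * ln (real n) \<le> exp (a * ln (real n))" using exp_ge_add_one_self[of "a * ln (real n)"] by linarith
  thus ?thesis using False assms by (simp add: powr_def field_simps)
qed simp

lemma summable_norm_ln_powr:
  assumes "Re s > 1"
  shows "summable (\<lambda>n. norm (of_real (ln (real n)) * of_nat n powr (-s) :: complex))"
proof -
  define a where "a = (Re s - 1) / 2"
  have a: "a > 0" "a - Re s < -1" using assms by (auto simp: a_def field_simps)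
  show ?thesis
  proof (rule summable_comparison_test')
    show "summable (\<lambda>n. (1 / a) * real n powr (a - Re s))" using a by (intro summable_mult) (simp add: summable_real_powr_iff)
    fix n :: nat
    have "norm (of_real (ln (real n)) * of_nat n powr (-s) :: complex) = ln (real n) * real n powr (- Re s)"
      using assms by (cases "n = 0") (auto simp: norm_mult norm_nat_powr')
    also have "\<dots> \<le> (real n powr a / a) * real n powr (- Re s)" using a by (intro mult_right_mono ln_nat_powr_le) auto
    also have "\<dots> = (1 / a) * real n powr (a - Re s)" by (simp add: powr_add[symmetric] algebra_simps flip: powr_add)
    finally show "norm (norm (of_real (ln (real n)) * of_nat n powr (-s) :: complex)) \<le> (1 / a) * real n powr (a - Re s)" by simp
  qed
qed

lemma zeta_has_field_derivative:
  assumes s: "Re s > 1"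
  shows "(zeta has_field_derivative (- zeta_log_series s)) (at s)"
proof -
  define a where "a = (1 + Re s) / 2"
  have a: "a > 1" "a < Re s" using s by (auto simp: a_def)
  let ?S = "{s. Re s > a}"
  have o: "open ?S" by (rule open_halfspace_Re_gt)
  obtain g g' where g: "\<forall>x\<in>?S. ((\<lambda>n. of_nat n powr (-x)) sums g x) \<and> ((\<lambda>n. - (of_real (ln (real n)) * of_nat n powr (-x))) sums g' x) \<and> (g has_field_derivative g' x) (at x)"
  proof (rule series_and_derivative_comparison[OF o])
    show "summable (\<lambda>n. real n powr (-a))" using a by (simp add: summable_real_powr_iff)
    show "\<forall>\<^sub>F n in sequentially. \<forall>x\<in>?S. norm (of_nat n powr (-x) :: complex) \<le> real n powr (-a)"
    proof (intro always_eventually allI ballI)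
      fix n x assume x: "x \<in> ?S"
      show "norm (of_nat n powr (-x) :: complex) \<le> real n powr (-a)"
        using x a by (cases "n = 0") (auto simp: norm_nat_powr' intro!: powr_mono)
    qed
    fix n :: nat and x :: complex assume "x \<in> ?S"
    show "((\<lambda>x. of_nat n powr (-x)) has_field_derivative - (of_real (ln (real n)) * of_nat n powr (-x))) (at x)"
    proof (cases "n = 0")
      case False
      hence "Ln (of_nat n) = of_real (ln (real n))" by (metis Ln_of_nat neq0_conv)
      moreover have "((\<lambda>x. of_nat n powr (-x)) has_field_derivative (Ln (of_nat n) * of_nat n powr (-x) * (-1))) (at x)"
        using False by (intro has_field_derivative_powr_right_chain DERIV_minus DERIV_ident) auto
      ultimately show ?thesis by simp
    qed simp
  qed blast
  have sS: "s \<in> ?S" using a by simp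
  have "(g has_field_derivative g' s) (at s)" using g sS by auto
  hence "(zeta has_field_derivative g' s) (at s)"
    by (rule has_field_derivative_transform_within_open[OF _ o sS]) (use g a in \<open>auto simp: zeta_def sums_iff\<close>)
  moreover have "g' s = - zeta_log_series s"
    using g sS sums_minus[of "\<lambda>n. - (of_real (ln (real n)) * of_nat n powr (-s))" "g' s"]
    by (auto simp: zeta_log_series_def sums_iff)
  ultimately show ?thesis by simp
qed

text \<open>This is -zeta'/zeta. Introducing it as a series allows it to be used before zeta is
  known to be nonzero.\<close>

definition mangoldt_series :: "complex \<Rightarrow> complex" where
  "mangoldt_series s = (\<Sum>n. mangoldt n * of_nat n powr (-s))"

lemma summable_norm_mangoldt:
  assumes "Re s > 1"
  shows "summable (\<lambda>n. norm (mangoldt n * of_nat n powr (-s) :: complex))"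
proof (rule summable_comparison_test'[OF summable_norm_ln_powr[OF assms]])
  fix n :: nat
  show "norm (norm (mangoldt n * of_nat n powr (-s) :: complex)) \<le> norm (of_real (ln (real n)) * of_nat n powr (-s) :: complex)"
    by (cases "n = 0") (auto simp: norm_mult abs_mult intro!: mult_right_mono mangoldt_le)
qed

lemma sums_mangoldt_series: "Re s > 1 \<Longrightarrow> (\<lambda>n. mangoldt n * of_nat n powr (-s)) sums mangoldt_series s"
  unfolding mangoldt_series_def using summable_norm_cancel[OF summable_norm_mangoldt] by (rule summable_sums)

text \<open>Both series converge absolutely, so their product may be rearranged along n = a b into a
  sum over pairs (n, d) with d dividing n; the divisor sum of \<open>mangoldt\<close> is
  \<open>ln n\<close>.\<close>

lemma zeta_times_mangoldt_series:
  assumes "Re s > 1"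
  shows "zeta s * mangoldt_series s = zeta_log_series s"
proof -
  let ?A = "{0::nat<..}"
  let ?z = "\<lambda>n::nat. of_nat n powr (-s) :: complex" and ?m = "\<lambda>n::nat. mangoldt n * of_nat n powr (-s) :: complex"
  \<comment> \<open>The index 0 is removed because every number divides it, which would spoil the
    finite divisor sums.\<close>
  have restrict: "(f has_sum S) ?A" if "(f has_sum S) UNIV" "f 0 = 0" for f :: "nat \<Rightarrow> complex" and S
    using that by (subst has_sum_cong_neutral[of UNIV ?A f f]) (auto simp: not_less)
  have z: "(?z has_sum zeta s) ?A"
    by (intro restrict norm_summable_imp_has_sum summable_norm_zeta sums_zeta assms) auto
  have m: "(?m has_sum mangoldt_series s) ?A"
    by (intro restrict norm_summable_imp_has_sum summable_norm_mangoldt sums_mangoldt_series assms) auto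
  have zs: "(\<lambda>n. norm (?z n)) summable_on ?A"
    by (rule summable_on_subset_banach[OF norm_summable_imp_summable_on]) (use summable_norm_zeta[OF assms] in auto)
  have ms: "(\<lambda>n. norm (?m n)) summable_on ?A"
    by (rule summable_on_subset_banach[OF norm_summable_imp_summable_on]) (use summable_norm_mangoldt[OF assms] in auto)
  have prod: "((\<lambda>(a,b). ?z a * ?m b) has_sum (zeta s * mangoldt_series s)) (?A \<times> ?A)"
  proof -
    obtain Mz where Mz: "((\<lambda>n. norm (?z n)) has_sum Mz) ?A" using zs by (auto simp: summable_on_def)
    obtain Mm where Mm: "((\<lambda>n. norm (?m n)) has_sum Mm) ?A" using ms by (auto simp: summable_on_def)
    have "(\<lambda>(a,b). norm (?z a) * norm (?m b)) summable_on (?A \<times> ?A)"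
    proof (rule summable_on_SigmaI)
      show "((\<lambda>b. case (a, b) of (a, b) \<Rightarrow> norm (?z a) * norm (?m b)) has_sum norm (?z a) * Mm) ?A" for a
        using has_sum_cmult_right[OF Mm, of "norm (?z a)"] by simp
      show "(\<lambda>a. norm (?z a) * Mm) summable_on ?A" by (intro summable_on_cmult_left zs)
    qed auto
    hence "(\<lambda>x. norm (case x of (a,b) \<Rightarrow> ?z a * ?m b)) summable_on (?A \<times> ?A)"
      by (rule summable_on_cong[THEN iffD1, rotated]) (auto simp: norm_mult)
    hence "(\<lambda>(a,b). ?z a * ?m b) summable_on (?A \<times> ?A)" by (rule abs_summable_summable)
    then obtain T where T: "((\<lambda>(a,b). ?z a * ?m b) has_sum T) (?A \<times> ?A)" by (auto simp: summable_on_def)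
    have "((\<lambda>a. ?z a * mangoldt_series s) has_sum T) ?A"
      by (rule has_sum_SigmaD[OF T]) (auto intro!: has_sum_cmult_right m)
    moreover have "((\<lambda>a. ?z a * mangoldt_series s) has_sum (zeta s * mangoldt_series s)) ?A"
      by (intro has_sum_cmult_left z)
    ultimately have "T = zeta s * mangoldt_series s" by (rule has_sum_unique)
    with T show ?thesis by simp
  qed
  have "((\<lambda>(n,d). mangoldt d * ?z n) has_sum (zeta s * mangoldt_series s)) (Sigma ?A (\<lambda>n. {d. d dvd n}))"
  proof (subst has_sum_reindex_bij_witness[where T = "?A \<times> ?A" and h = "\<lambda>(a,b). ?z a * ?m b"
        and i = "\<lambda>(a,b). (a * b, b)" and j = "\<lambda>(n,d). (n div d, d)"])
    fix x assume "x \<in> Sigma ?A (\<lambda>n. {d. d dvd n})"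
    then obtain d k where x: "x = (d * k, d)" "d > 0" "k > 0" by (auto elim!: dvdE)
    show "(case (case x of (n, d) \<Rightarrow> (n div d, d)) of (a, b) \<Rightarrow> (a * b, b)) = x" using x by simp
    show "(case x of (n, d) \<Rightarrow> (n div d, d)) \<in> ?A \<times> ?A" using x by simp
    have "?z (d * k) = ?z d * ?z k"
      using powr_times_real[of "of_nat d" "of_nat k" "-s"] by simp
    thus "(case case x of (n, d) \<Rightarrow> (n div d, d) of (a, b) \<Rightarrow> ?z a * ?m b) = (case x of (n, d) \<Rightarrow> mangoldt d * ?z n)"
      using x by (simp add: mult_ac)
  qed (use prod in auto)
  hence "((\<lambda>n. of_real (ln (real n)) * ?z n) has_sum (zeta s * mangoldt_series s)) ?A"
  proof (rule has_sum_SigmaD)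
    fix n assume n: "n \<in> ?A"
    have "((\<lambda>d. mangoldt d * ?z n) has_sum (\<Sum>d | d dvd n. mangoldt d * ?z n)) {d. d dvd n}"
      using n by (intro has_sum_finite) auto
    also have "(\<Sum>d | d dvd n. mangoldt d * ?z n) = of_real (ln (real n)) * ?z n"
      using n by (subst sum_distrib_right[symmetric], subst mangoldt_sum) auto
    finally show "((\<lambda>d. case (n, d) of (n, d) \<Rightarrow> mangoldt d * ?z n) has_sum of_real (ln (real n)) * ?z n) {d. d dvd n}"
      by simp
  qed
  moreover have "((\<lambda>n. of_real (ln (real n)) * ?z n) has_sum zeta_log_series s) ?A"
    unfolding zeta_log_series_def
    by (intro restrict norm_summable_imp_has_sum summable_norm_ln_powr summable_sums summable_norm_cancel[OF summable_norm_ln_powr] assms) auto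
  ultimately show ?thesis by (rule has_sum_unique)
qed

section \<open>Lower bounds for zeta on the line Re s = 1\<close>

lemma Re_mangoldt_term:
  "Re (mangoldt n * of_nat n powr (-Complex \<sigma> t)) = mangoldt n * real n powr (-\<sigma>) * cos (t * ln (real n))"
proof (cases "n = 0")
  case False
  hence L: "Ln (of_nat n :: complex) = of_real (ln (real n))" by (metis Ln_of_nat neq0_conv)
  have e: "-Complex \<sigma> t * of_real (ln (real n)) = Complex (-\<sigma> * ln (real n)) (- t * ln (real n))"
    by (simp add: complex_eq_iff)
  have "(of_nat n :: complex) powr (-Complex \<sigma> t) = exp (-Complex \<sigma> t * of_real (ln (real n)))"
    using False L by (simp add: powr_def)
  hence "Re (of_nat n powr (-Complex \<sigma> t) :: complex) = real n powr (-\<sigma>) * cos (t * ln (real n))"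
    unfolding e using False by (simp add: Re_exp powr_def)
  thus ?thesis by simp
qed simp

text \<open>Termwise 3 + 4 cos a + cos 2a = 2 (1 + cos a)^2 with a = t ln n, and the coefficients
  are nonnegative.\<close>

lemma three_four_one_mangoldt:
  assumes "\<sigma> > 1"
  shows "3 * Re (mangoldt_series (Complex \<sigma> 0)) + 4 * Re (mangoldt_series (Complex \<sigma> t)) + Re (mangoldt_series (Complex \<sigma> (2 * t))) \<ge> 0"
proof -
  have S: "(\<lambda>n. mangoldt n * real n powr (-\<sigma>) * cos (u * ln (real n))) sums Re (mangoldt_series (Complex \<sigma> u))" for u
  proof -
    have "Re (Complex \<sigma> u) > 1" using assms by simp
    from sums_Re[OF sums_mangoldt_series[OF this]] show ?thesis unfolding Re_mangoldt_term .
  qed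
  have S3: "(\<lambda>n. 3 * (mangoldt n * real n powr (-\<sigma>) * cos (0 * ln (real n))) + 4 * (mangoldt n * real n powr (-\<sigma>) * cos (t * ln (real n)))
     + mangoldt n * real n powr (-\<sigma>) * cos (2 * t * ln (real n))) sums
     (3 * Re (mangoldt_series (Complex \<sigma> 0)) + 4 * Re (mangoldt_series (Complex \<sigma> t)) + Re (mangoldt_series (Complex \<sigma> (2 * t))))"
    by (intro sums_add sums_mult S)
  have nn: "0 \<le> 3 * (mangoldt n * real n powr (-\<sigma>) * cos (0 * ln (real n))) + 4 * (mangoldt n * real n powr (-\<sigma>) * cos (t * ln (real n)))
     + mangoldt n * real n powr (-\<sigma>) * cos (2 * t * ln (real n))" for n
  proof -
    define c where "c = cos (t * ln (real n))"
    have c2: "cos (2 * t * ln (real n)) = 2 * c^2 - 1" using cos_double_cos[of "t * ln (real n)"] by (simp add: c_def mult.assoc)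
    have "3 * (mangoldt n * real n powr (-\<sigma>) * cos (0 * ln (real n))) + 4 * (mangoldt n * real n powr (-\<sigma>) * cos (t * ln (real n)))
     + mangoldt n * real n powr (-\<sigma>) * cos (2 * t * ln (real n)) = mangoldt n * real n powr (-\<sigma>) * (2 * (1 + c)^2)"
      unfolding c2 c_def[symmetric] by (simp add: power2_eq_square algebra_simps)
    also have "\<dots> \<ge> 0" by (intro mult_nonneg_nonneg mangoldt_nonneg) auto
    finally show ?thesis .
  qed
  show ?thesis by (rule sums_le[OF nn sums_zero S3])
qed

text \<open>The squared modulus is differentiable and obeys this linear equation even at a zero, so
  no branch of log zeta and no Euler product is involved; nonvanishing for Re s > 1 can then be a
  consequence.\<close>

lemma norm_zeta_sq_has_derivative:
  assumes "\<sigma> > 1"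
  shows "((\<lambda>x. (norm (zeta (Complex x t)))^2) has_real_derivative
            (- 2 * Re (mangoldt_series (Complex \<sigma> t)) * (norm (zeta (Complex \<sigma> t)))^2)) (at \<sigma>)"
proof -
  let ?z = "zeta (Complex \<sigma> t)" and ?L = "mangoldt_series (Complex \<sigma> t)"
  have "(zeta has_field_derivative (- (?z * ?L))) (at (Complex \<sigma> t))"
    using zeta_has_field_derivative[of "Complex \<sigma> t"] zeta_times_mangoldt_series[of "Complex \<sigma> t"] assms by simp
  moreover have "((\<lambda>x. Complex x t) has_vector_derivative 1) (at \<sigma>)"
    by (auto simp: has_vector_derivative_complex_iff intro!: derivative_eq_intros)
  ultimately have "(zeta \<circ> (\<lambda>x. Complex x t) has_vector_derivative (1 * (- (?z * ?L)))) (at \<sigma>)"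
    by (intro field_vector_diff_chain_at) auto
  hence "((\<lambda>x. zeta (Complex x t)) has_vector_derivative (- (?z * ?L))) (at \<sigma>)" by (simp add: o_def)
  hence R: "((\<lambda>x. Re (zeta (Complex x t))) has_real_derivative Re (- (?z * ?L))) (at \<sigma>)"
    and I: "((\<lambda>x. Im (zeta (Complex x t))) has_real_derivative Im (- (?z * ?L))) (at \<sigma>)"
    by (auto simp: has_vector_derivative_complex_iff)
  show ?thesis unfolding cmod_power2
    by (rule derivative_eq_intros R I refl | simp add: power2_eq_square algebra_simps)+
qed

text \<open>This is the boundary value at infinity from which the monotonicity argument descends.
  For n \<ge> 2 and \<sigma> \<ge> 2 one has n^(-\<sigma>) \<le> 2^(2 - \<sigma>) n^(-2).\<close>

lemma zeta_tendsto_1: "((\<lambda>\<sigma>. norm (zeta (Complex \<sigma> t))) \<longlongrightarrow> 1) at_top"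
proof -
  define C where "C = (\<Sum>n. real (n + 2) powr (-2))"
  have sm: "summable (\<lambda>n. real (n + 2) powr (-2))"
    by (subst summable_iff_shift) (simp add: summable_real_powr_iff)
  have bound: "norm (zeta (Complex \<sigma> t) - 1) \<le> 2 powr (2 - \<sigma>) * C" if "\<sigma> \<ge> 2" for \<sigma>
  proof -
    let ?s = "Complex \<sigma> t"
    have "(\<lambda>n. of_nat (n + 2) powr (-?s)) sums (zeta ?s - (\<Sum>i<2. of_nat i powr (-?s)))"
      using sums_zeta[of ?s] that by (subst sums_iff_shift) auto
    hence S: "(\<lambda>n. of_nat (n + 2) powr (-?s)) sums (zeta ?s - 1)" by (simp add: eval_nat_numeral)
    have le: "norm (of_nat (n + 2) powr (-?s) :: complex) \<le> 2 powr (2 - \<sigma>) * real (n + 2) powr (-2)" for n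
    proof -
      have "norm (of_nat (n + 2) powr (-?s) :: complex) = real (n + 2) powr (-\<sigma>)"
        by (subst norm_nat_powr) auto
      also have "\<dots> = real (n + 2) powr (2 - \<sigma>) * real (n + 2) powr (-2)" by (subst powr_add [symmetric]) simp
      also have "\<dots> \<le> 2 powr (2 - \<sigma>) * real (n + 2) powr (-2)"
        using that by (intro mult_right_mono powr_mono2') auto
      finally show ?thesis .
    qed
    have sn: "summable (\<lambda>n. norm (of_nat (n + 2) powr (-?s) :: complex))"
      by (rule summable_comparison_test'[OF summable_mult[OF sm, of "2 powr (2 - \<sigma>)"]]) (use le in simp)
    have "norm (zeta ?s - 1) \<le> (\<Sum>n. norm (of_nat (n + 2) powr (-?s) :: complex))"
      using S summable_norm[OF sn] by (simp add: sums_iff)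
    also have "\<dots> \<le> (\<Sum>n. 2 powr (2 - \<sigma>) * real (n + 2) powr (-2))"
      by (intro suminf_le le sn summable_mult sm)
    also have "\<dots> = 2 powr (2 - \<sigma>) * C" unfolding C_def by (rule suminf_mult[OF sm])
    finally show ?thesis .
  qed
  have "((\<lambda>\<sigma>. 2 powr (2 - \<sigma>) * C) \<longlongrightarrow> 0 * C) at_top"
  proof (intro tendsto_mult tendsto_const)
    show "((\<lambda>\<sigma>. 2 powr (2 - \<sigma>)) \<longlongrightarrow> (0::real)) at_top" by real_asymp
  qed
  hence "((\<lambda>\<sigma>. zeta (Complex \<sigma> t) - 1) \<longlongrightarrow> 0) at_top"
    by (intro Lim_null_comparison[OF eventually_at_top_linorderI[OF bound]]) simp_all
  hence "((\<lambda>\<sigma>. zeta (Complex \<sigma> t)) \<longlongrightarrow> 1) at_top" by (rule LIM_zero_cancel)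
  from tendsto_norm[OF this] show ?thesis by simp
qed

text \<open>The square of the left-hand side decreases in \<open>\<sigma>\<close> and tends to 1.\<close>

lemma three_four_one:
  assumes "\<sigma> > 1"
  shows "norm (zeta (Complex \<sigma> 0)) ^ 3 * norm (zeta (Complex \<sigma> t)) ^ 4 * norm (zeta (Complex \<sigma> (2 * t))) \<ge> 1"
proof -
  define N where "N = (\<lambda>u x. (norm (zeta (Complex x u)))^2)"
  define L where "L = (\<lambda>u x. Re (mangoldt_series (Complex x u)))"
  define \<Phi> where "\<Phi> = (\<lambda>x. N 0 x ^ 3 * N t x ^ 4 * N (2 * t) x)"
  have dN: "(N u has_real_derivative (- 2 * L u x * N u x)) (at x)" if "x > 1" for u x
    unfolding N_def L_def by (rule norm_zeta_sq_has_derivative[OF that])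
  have d\<Phi>: "(\<Phi> has_real_derivative (- 2 * (3 * L 0 x + 4 * L t x + L (2 * t) x) * \<Phi> x)) (at x)" if "x > 1" for x
    unfolding \<Phi>_def
    by (rule derivative_eq_intros dN[OF that] refl | simp)+ (simp add: algebra_simps eval_nat_numeral)
  have dec: "\<Phi> y \<le> \<Phi> x" if "1 < x" "x \<le> y" for x y
  proof (rule DERIV_nonpos_imp_nonincreasing[OF that(2)])
    fix z assume z: "x \<le> z" "z \<le> y"
    have "3 * L 0 z + 4 * L t z + L (2 * t) z \<ge> 0" unfolding L_def using z that by (intro three_four_one_mangoldt) auto
    moreover have "\<Phi> z \<ge> 0" by (simp add: \<Phi>_def N_def)
    ultimately have "- 2 * (3 * L 0 z + 4 * L t z + L (2 * t) z) * \<Phi> z \<le> 0" by (intro mult_nonpos_nonneg) auto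
    with d\<Phi>[of z] z that show "\<exists>y. DERIV \<Phi> z :> y \<and> y \<le> 0" by auto
  qed
  have lim: "(\<Phi> \<longlongrightarrow> (1^2)^3 * (1^2)^4 * 1^2) at_top" unfolding \<Phi>_def N_def
    by (intro tendsto_intros zeta_tendsto_1)
  have "(1::real) \<le> \<Phi> \<sigma>"
  proof -
    have "eventually (\<lambda>x. \<Phi> x \<le> \<Phi> \<sigma>) at_top"
      using dec[OF assms] by (auto simp: eventually_at_top_linorder)
    from tendsto_upperbound[OF lim this] show ?thesis by simp
  qed
  also have "\<Phi> \<sigma> = (norm (zeta (Complex \<sigma> 0)) ^ 3 * norm (zeta (Complex \<sigma> t)) ^ 4 * norm (zeta (Complex \<sigma> (2 * t))))^2"
    by (simp add: \<Phi>_def N_def power_mult_distrib flip: power_mult)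
  finally have sq: "1\<^sup>2 \<le> (norm (zeta (Complex \<sigma> 0)) ^ 3 * norm (zeta (Complex \<sigma> t)) ^ 4 * norm (zeta (Complex \<sigma> (2 * t))))\<^sup>2" by simp
  show ?thesis by (rule power2_le_imp_le[OF sq]) auto
qed

section \<open>Zeta across the line Re s = 1, away from the pole\<close>

definition zeta_ext :: "complex \<Rightarrow> complex" where
  "zeta_ext s = reg_zeta s / (s - 1)"

lemma zeta_ext_eq: "Re s > 1 \<Longrightarrow> zeta_ext s = zeta s"
  using reg_zeta_eq[of s] by (auto simp: zeta_ext_def)

text \<open>At s = 1 division by zero assigns the value 0 to \<open>zeta_ext\<close>, which is
  unrelated to zeta, so that point is removed.\<close>

lemma zeta_ext_holomorphic: "zeta_ext holomorphic_on ({s. Re s > 39/40} - {1})"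
  unfolding zeta_ext_def
  by (intro holomorphic_intros holomorphic_on_subset[OF reg_zeta_holomorphic]) auto

lemma open_zeta_ext_domain: "open ({s. Re s > 39/40} - {1 :: complex})"
  by (intro open_Diff open_halfspace_Re_gt) auto

text \<open>The parameter t0 measures the distance to the pole. Allowing ordinates down to t0/2
  leaves room for the Cauchy circles around points with ordinate at least t0.\<close>

lemma norm_zeta_ext_le:
  assumes "0 < t0" "39/40 \<le> Re s" "Re s \<le> 3" "t0 / 2 \<le> \<bar>Im s\<bar>"
  shows "norm (zeta_ext s) \<le> (2 / t0 + zeta_bound_const) * (\<bar>Im s\<bar> + 4) powr (1/20)"
proof -
  have d: "norm (s - 1) \<ge> t0 / 2" using abs_Im_le_cmod[of "s - 1"] assms by simp
  hence d0: "norm (s - 1) > 0" using assms by linarith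
  have "norm s \<le> \<bar>Re s\<bar> + \<bar>Im s\<bar>" by (rule cmod_le)
  hence s: "norm s powr (1/20) \<le> (\<bar>Im s\<bar> + 4) powr (1/20)" using assms by (intro powr_mono2) auto
  have one: "1 \<le> (\<bar>Im s\<bar> + 4) powr (1/20)" by (rule ge_one_powr_ge_zero) auto
  have "norm (reg_zeta s) \<le> 1 + zeta_bound_const * norm (s - 1) * norm s powr (1/20)"
    using norm_reg_zeta_le[of s] assms norm_triangle_ineq2[of "reg_zeta s" 1] by simp
  hence "norm (zeta_ext s) \<le> (1 + zeta_bound_const * norm (s - 1) * norm s powr (1/20)) / norm (s - 1)"
    unfolding zeta_ext_def norm_divide by (intro divide_right_mono) auto
  also have "\<dots> = 1 / norm (s - 1) + zeta_bound_const * norm s powr (1/20)" using d0 by (simp add: field_simps)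
  also have "1 / norm (s - 1) \<le> (2 / t0) * 1"
    using d d0 assms by (simp add: field_simps)
  also have "(2 / t0) * 1 \<le> (2 / t0) * (\<bar>Im s\<bar> + 4) powr (1/20)" using assms one by (intro mult_left_mono) auto
  also have "zeta_bound_const * norm s powr (1/20) \<le> zeta_bound_const * (\<bar>Im s\<bar> + 4) powr (1/20)"
    using s zeta_bound_const_nonneg by (intro mult_left_mono)
  finally show ?thesis by (simp add: algebra_simps)
qed

lemma norm_deriv_zeta_ext_le:
  assumes "0 < t0" "t0 \<le> 1" "1 \<le> Re s" "Re s \<le> 2" "t0 \<le> \<bar>Im s\<bar>"
  shows "norm (deriv zeta_ext s) \<le> 50 / t0 * (2 / t0 + zeta_bound_const) * 2 * (\<bar>Im s\<bar> + 4) powr (1/20)"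
proof -
  \<comment> \<open>Since t0 \<le> 1, this radius is at most 1/50 < 1/40, so the circle stays to the
    right of 39/40; being below t0/2, it also keeps away from the pole.\<close>
  define r where "r = t0 / 50"
  have r: "0 < r" "r \<le> 1/50" using assms by (auto simp: r_def)
  have near: "39/40 < Re z \<and> Re z \<le> 3 \<and> t0 / 2 \<le> \<bar>Im z\<bar> \<and> \<bar>Im z\<bar> \<le> \<bar>Im s\<bar> + 1 \<and> z \<noteq> 1" if "norm (s - z) \<le> r" for z
  proof -
    have "\<bar>Re s - Re z\<bar> \<le> r" "\<bar>Im s - Im z\<bar> \<le> r"
      using abs_Re_le_cmod[of "s - z"] abs_Im_le_cmod[of "s - z"] that by auto
    moreover have "r \<le> t0 / 2" "t0 / 2 > 0" using assms by (auto simp: r_def)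
    moreover have "r + t0 / 2 \<le> t0" using assms by (simp add: r_def)
    moreover have "z \<noteq> 1" if "Im z \<noteq> 0" using that by auto
    ultimately show ?thesis using assms r by (auto simp: abs_le_iff abs_if split: if_splits)
  qed
  have sub: "cball s r \<subseteq> {s. Re s > 39/40} - {1}" 
  proof
    fix z assume "z \<in> cball s r"
    hence "norm (s - z) \<le> r" by (simp add: dist_norm)
    from near[OF this] show "z \<in> {s. Re s > 39/40} - {1}" by simp
  qed
  have "norm ((deriv ^^ 1) zeta_ext s) \<le> fact 1 * ((2 / t0 + zeta_bound_const) * (2 * (\<bar>Im s\<bar> + 4) powr (1/20))) / r ^ 1"
  proof (rule Cauchy_inequality)
    show "zeta_ext holomorphic_on ball s r"
      by (rule holomorphic_on_subset[OF zeta_ext_holomorphic]) (use sub ball_subset_cball in blast)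
    show "continuous_on (cball s r) zeta_ext"
      by (rule continuous_on_subset[OF holomorphic_on_imp_continuous_on[OF zeta_ext_holomorphic] sub])
    fix z assume z: "norm (s - z) = r"
    have nz: "39/40 < Re z" "Re z \<le> 3" "t0 / 2 \<le> \<bar>Im z\<bar>" "\<bar>Im z\<bar> \<le> \<bar>Im s\<bar> + 1" using near[of z] z by auto
    have "norm (zeta_ext z) \<le> (2 / t0 + zeta_bound_const) * (\<bar>Im z\<bar> + 4) powr (1/20)"
      using nz assms by (intro norm_zeta_ext_le) auto
    also have "(\<bar>Im z\<bar> + 4) powr (1/20) \<le> (2 * (\<bar>Im s\<bar> + 4)) powr (1/20)"
      using nz by (intro powr_mono2) auto
    also have "\<dots> = 2 powr (1/20) * (\<bar>Im s\<bar> + 4) powr (1/20)" by (subst powr_mult) auto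
    also have "\<dots> \<le> 2 powr 1 * (\<bar>Im s\<bar> + 4) powr (1/20)" by (intro mult_right_mono powr_mono) auto
    finally show "norm (zeta_ext z) \<le> (2 / t0 + zeta_bound_const) * (2 * (\<bar>Im s\<bar> + 4) powr (1/20))"
      using assms zeta_bound_const_nonneg by (simp add: mult_left_mono)
  qed (use r in auto)
  thus ?thesis using assms by (simp add: r_def field_simps)
qed

lemma norm_zeta_real_le:
  assumes "1 < \<sigma>" "\<sigma> \<le> 2"
  shows "norm (zeta (Complex \<sigma> 0)) \<le> (1 + 2 * zeta_bound_const) / (\<sigma> - 1)"
proof -
  let ?s = "Complex \<sigma> 0"
  have s: "?s = of_real \<sigma>" by (simp add: complex_eq_iff)
  have n1: "norm (?s - 1) = \<sigma> - 1"
    unfolding s using assms by (metis abs_of_pos diff_gt_0_iff_gt norm_of_real of_real_1 of_real_diff)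
  have "norm ?s powr (1/20) \<le> 2 powr (1/20)" unfolding s using assms by (intro powr_mono2) auto
  also have "\<dots> \<le> 2 powr 1" by (intro powr_mono) auto
  finally have "norm ?s powr (1/20) \<le> 2" by simp
  hence "zeta_bound_const * norm (?s - 1) * norm ?s powr (1/20) \<le> zeta_bound_const * 1 * 2"
    using zeta_bound_const_nonneg assms unfolding n1 by (intro mult_mono) auto
  hence "norm (reg_zeta ?s) \<le> 1 + 2 * zeta_bound_const"
    using norm_reg_zeta_le[of ?s] assms norm_triangle_ineq2[of "reg_zeta ?s" 1] by simp
  moreover have "norm (zeta ?s) = norm (reg_zeta ?s) / (\<sigma> - 1)"
    using reg_zeta_eq[of ?s] n1 assms by (simp add: norm_mult)
  ultimately show ?thesis using assms by (simp add: divide_right_mono)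
qed

text \<open>For \<sigma> \<ge> 1 + \<eta> the 3-4-1 inequality, with the pole bound D/\<eta> and the
  growth bound at 2t, gives a lower bound 2 \<eta> A1 T. Moving left from 1 + \<eta> to \<sigma>
  changes zeta by at most \<eta> A1 T because its derivative is at most A1 T. Half of the bound
  survives.\<close>

lemma zeta_ext_lower_bound:
  assumes "0 < t0" "t0 \<le> 1"
  obtains c where "c > 0"
    "\<And>\<sigma> t. 1 \<le> \<sigma> \<Longrightarrow> \<sigma> \<le> 2 \<Longrightarrow> t0 \<le> \<bar>t\<bar> \<Longrightarrow> norm (zeta_ext (Complex \<sigma> t)) \<ge> c * (\<bar>t\<bar> + 4) powr (-1/5)"
proof -
  define A where "A = 2 / t0 + zeta_bound_const"
  define D where "D = 1 + 2 * zeta_bound_const"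
  define A1 where "A1 = 50 / t0 * A * 2"
  have "2 / t0 \<ge> 2" using assms by (simp add: field_simps)
  hence A: "A \<ge> 2" using zeta_bound_const_nonneg by (simp add: A_def)
  have D: "D \<ge> 1" using zeta_bound_const_nonneg by (simp add: D_def)
  have A1: "A1 \<ge> 1"
  proof -
    have "50 / t0 \<ge> 1" using assms by (simp add: field_simps)
    hence "1 * 2 \<le> 50 / t0 * A" using A assms by (intro mult_mono) auto
    hence "(1 * 2) * 2 \<le> A1" unfolding A1_def by (rule mult_right_mono) simp
    thus ?thesis by simp
  qed
  \<comment> \<open>Chosen such that (2 \<eta> A1 T)^4 * 2 A D^3 T equals \<eta>^3 for \<eta> = c0 /
    T^5: the factor 32 is 2^4 * 2.\<close>
  define c0 where "c0 = 1 / (32 * A * D ^ 3 * A1 ^ 4)"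
  have den: "32 * A * D ^ 3 * A1 ^ 4 \<ge> 1"
  proof -
    have "32 * A \<ge> 1" "D ^ 3 \<ge> 1" "A1 ^ 4 \<ge> 1" using A D A1 by (auto intro: one_le_power)
    from mult_mono[OF mult_mono[OF this(1,2)] this(3)] A D show ?thesis by simp
  qed
  have c0: "0 < c0" "c0 \<le> 1" using den unfolding c0_def by (auto simp: divide_simps)
  show thesis
  proof (rule that[of "c0 * A1"])
    show "c0 * A1 > 0" using c0 A1 by simp
    fix \<sigma> t :: real assume st: "1 \<le> \<sigma>" "\<sigma> \<le> 2" "t0 \<le> \<bar>t\<bar>"
    let ?Z = "\<lambda>x. zeta_ext (Complex x t)"
    define T where "T = (\<bar>t\<bar> + 4) powr (1/20)"
    have T: "T \<ge> 1" unfolding T_def by (rule ge_one_powr_ge_zero) auto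
    have T5: "(\<bar>t\<bar> + 4) powr (1/4) = T ^ 5" "(\<bar>t\<bar> + 4) powr (-1/5) = 1 / T ^ 4"
      by (auto simp: T_def powr_power powr_minus_divide)
    \<comment> \<open>The balance point: the 3-4-1 bound is of order \<eta>^(3/4) T^(-1/4), the loss
      from the derivative of order \<eta> T, and both are of order T^(-4) when \<eta> is of order
      T^(-5).\<close>
    define \<eta> where "\<eta> = c0 / T ^ 5"
    have \<eta>: "0 < \<eta>" "\<eta> \<le> 1"
    proof -
      show "0 < \<eta>" using c0 T by (simp add: \<eta>_def)
      have "T ^ 5 \<ge> 1" using T by (rule one_le_power)
      hence "c0 / T ^ 5 \<le> 1 / 1" using c0 by (intro frac_le) auto
      thus "\<eta> \<le> 1" by (simp add: \<eta>_def)
    qed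
    have far: "norm (?Z x) \<ge> 2 * \<eta> * A1 * T" if x: "1 + \<eta> \<le> x" "x \<le> 2" for x
    proof -
      have x1: "x > 1" using x \<eta> by simp
      let ?a = "norm (zeta (Complex x 0))" and ?b = "norm (zeta (Complex x t))" and ?c = "norm (zeta (Complex x (2 * t)))"
      have a: "?a \<le> D / \<eta>"
      proof -
        have "?a \<le> D / (x - 1)" using norm_zeta_real_le[of x] x1 x by (simp add: D_def)
        also have "\<dots> \<le> D / \<eta>" using x \<eta> D by (intro divide_left_mono) auto
        finally show ?thesis .
      qed
      have c: "?c \<le> A * (2 * T)"
      proof -
        have "?c = norm (zeta_ext (Complex x (2 * t)))" using x1 by (simp add: zeta_ext_eq)
        also have "\<dots> \<le> A * (\<bar>2 * t\<bar> + 4) powr (1/20)"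
          using norm_zeta_ext_le[of t0 "Complex x (2 * t)"] assms x x1 st by (simp add: A_def)
        also have "(\<bar>2 * t\<bar> + 4) powr (1/20) \<le> (2 * (\<bar>t\<bar> + 4)) powr (1/20)" by (intro powr_mono2) auto
        also have "\<dots> = 2 powr (1/20) * T" unfolding T_def by (subst powr_mult) auto
        also have "\<dots> \<le> 2 powr 1 * T" using T by (intro mult_right_mono powr_mono) auto
        finally show ?thesis using A by (simp add: mult_left_mono)
      qed
      have "1 \<le> ?a ^ 3 * ?b ^ 4 * ?c" by (rule three_four_one[OF x1])
      also have "\<dots> \<le> (D / \<eta>) ^ 3 * ?b ^ 4 * (A * (2 * T))"
        using a c D \<eta> by (intro mult_mono power_mono) auto
      finally have "\<eta> ^ 3 \<le> 2 * A * D ^ 3 * T * ?b ^ 4" using \<eta> by (simp add: power_divide field_simps)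
      moreover have "(2 * \<eta> * A1 * T) ^ 4 * (2 * A * D ^ 3 * T) = \<eta> ^ 3"
      proof -
        have "(2 * \<eta> * A1 * T) ^ 4 * (2 * A * D ^ 3 * T) = \<eta> ^ 3 * (\<eta> * T ^ 5) * (32 * A * D ^ 3 * A1 ^ 4)"
          by (simp add: power_mult_distrib eval_nat_numeral)
        also have "\<eta> * T ^ 5 = c0" using T by (simp add: \<eta>_def)
        also have "\<eta> ^ 3 * c0 * (32 * A * D ^ 3 * A1 ^ 4) = \<eta> ^ 3" using A D A1 by (simp add: c0_def)
        finally show ?thesis .
      qed
      ultimately have "(2 * \<eta> * A1 * T) ^ 4 * (2 * A * D ^ 3 * T) \<le> ?b ^ 4 * (2 * A * D ^ 3 * T)" by (simp add: mult_ac)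
      moreover have "2 * A * D ^ 3 * T > 0" using A D T by simp
      ultimately have "(2 * \<eta> * A1 * T) ^ 4 \<le> ?b ^ 4" by (simp only: mult_le_cancel_right_pos)
      hence "2 * \<eta> * A1 * T \<le> ?b" by (rule power_le_imp_le_base[of _ 3, simplified]) (auto simp: eval_nat_numeral)
      thus ?thesis using x1 by (simp add: zeta_ext_eq)
    qed
    have "norm (?Z \<sigma>) \<ge> \<eta> * A1 * T"
    proof (cases "1 + \<eta> \<le> \<sigma>")
      case True
      have "\<eta> * A1 * T \<ge> 0" using \<eta> A1 T by simp
      thus ?thesis using far[OF True st(2)] by linarith
    next
      case False
      let ?S = "closed_segment (Complex \<sigma> t) (Complex (1 + \<eta>) t)"
      have seg: "1 \<le> Re z \<and> Re z \<le> 2 \<and> Im z = t" if "z \<in> ?S" for z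
      proof -
        obtain u where u: "0 \<le> u" "u \<le> 1" "z = (1 - u) *\<^sub>R Complex \<sigma> t + u *\<^sub>R Complex (1 + \<eta>) t"
          using \<open>z \<in> ?S\<close> by (auto simp: in_segment)
        have R: "Re z = \<sigma> + u * (1 + \<eta> - \<sigma>)" unfolding u(3) by (simp add: algebra_simps)
        have "0 \<le> u * (1 + \<eta> - \<sigma>)" "u * (1 + \<eta> - \<sigma>) \<le> 1 * (1 + \<eta> - \<sigma>)"
          using u False by (auto intro!: mult_nonneg_nonneg mult_right_mono)
        moreover have "Im z = t" unfolding u(3) by (simp add: algebra_simps)
        ultimately show ?thesis using R st \<eta> by auto
      qed
      have "norm (?Z \<sigma> - ?Z (1 + \<eta>)) \<le> (A1 * T) * norm (Complex \<sigma> t - Complex (1 + \<eta>) t)"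
      proof (rule field_differentiable_bound[of ?S zeta_ext "deriv zeta_ext"])
        fix z assume z: "z \<in> ?S"
        have "z \<in> {s. Re s > 39/40} - {1}" using seg[OF z] st assms by auto
        thus "(zeta_ext has_field_derivative deriv zeta_ext z) (at z within ?S)"
          using zeta_ext_holomorphic open_zeta_ext_domain holomorphic_derivI has_field_derivative_at_within by blast
        show "norm (deriv zeta_ext z) \<le> A1 * T"
          using norm_deriv_zeta_ext_le[of t0 z] seg[OF z] st assms by (simp add: A1_def A_def T_def)
      qed auto
      also have "Complex \<sigma> t - Complex (1 + \<eta>) t = of_real (\<sigma> - 1 - \<eta>)" by (simp add: complex_eq_iff)
      also have "norm \<dots> = 1 + \<eta> - \<sigma>" unfolding norm_of_real using False by simp
      also have "(A1 * T) * (1 + \<eta> - \<sigma>) \<le> (A1 * T) * \<eta>" using A1 T st by (intro mult_left_mono) auto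
      finally have "norm (?Z \<sigma> - ?Z (1 + \<eta>)) \<le> \<eta> * A1 * T" by (simp add: mult_ac)
      moreover have "norm (?Z (1 + \<eta>)) \<ge> 2 * \<eta> * A1 * T" using far[of "1 + \<eta>"] \<eta> by simp
      ultimately show ?thesis
        using norm_triangle_ineq2[of "?Z (1 + \<eta>)" "?Z \<sigma>"]
        by (simp add: norm_minus_commute)
    qed
    also have "\<eta> * A1 * T = c0 * A1 * (\<bar>t\<bar> + 4) powr (-1/5)"
      unfolding T5 \<eta>_def using T by (simp add: field_simps eval_nat_numeral)
    finally show "c0 * A1 * (\<bar>t\<bar> + 4) powr (-1/5) \<le> norm (?Z \<sigma>)" .
  qed
qed

text \<open>Off the real axis the lower bound applies with t0 adapted to Im s. At s = 1 all terms
  vanish and the value is 1. For real s > 1 the 3-4-1 inequality with t = 0 suffices.\<close>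

lemma reg_zeta_nonzero:
  assumes "1 \<le> Re s" "Re s \<le> 2"
  shows "reg_zeta s \<noteq> 0"
proof (cases "Im s = 0")
  case False
  obtain c where c: "c > 0" "\<And>\<sigma> t. 1 \<le> \<sigma> \<Longrightarrow> \<sigma> \<le> 2 \<Longrightarrow> min 1 \<bar>Im s\<bar> \<le> \<bar>t\<bar> \<Longrightarrow> norm (zeta_ext (Complex \<sigma> t)) \<ge> c * (\<bar>t\<bar> + 4) powr (-1/5)"
    by (rule zeta_ext_lower_bound[of "min 1 \<bar>Im s\<bar>"]) (use False in auto)
  have "norm (zeta_ext (Complex (Re s) (Im s))) \<ge> c * (\<bar>Im s\<bar> + 4) powr (-1/5)" using c(2)[of "Re s" "Im s"] assms by simp
  moreover have "c * (\<bar>Im s\<bar> + 4) powr (-1/5) > 0" using c by simp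
  ultimately have "zeta_ext s \<noteq> 0" by auto
  thus ?thesis by (auto simp: zeta_ext_def)
next
  case True
  show ?thesis
  proof (cases "Re s = 1")
    case True
    with \<open>Im s = 0\<close> have "s = 1" by (simp add: complex_eq_iff)
    thus ?thesis by (simp add: reg_zeta_def zeta_term_def del: of_nat_Suc)
  next
    case False
    hence s1: "Re s > 1" using assms by simp
    have "s = Complex (Re s) 0" using True by (simp add: complex_eq_iff)
    with three_four_one[OF s1, of 0] have "zeta s \<noteq> 0" by auto
    moreover have "s \<noteq> 1" using s1 by auto
    ultimately show ?thesis using reg_zeta_eq[OF s1] by simp
  qed
qed

section \<open>The transform of the error term in the theorem of Mertens\<close>

text \<open>This equals zeta'/zeta + 1/(s - 1), the logarithmic derivative with its pole at 1
  removed.\<close>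

definition reg_zeta_logderiv :: "complex \<Rightarrow> complex" where
  "reg_zeta_logderiv s = deriv reg_zeta s / reg_zeta s"

lemma open_half: "open {s. Re s > 39/40}" by (rule open_halfspace_Re_gt)

lemma deriv_zeta_eq: "Re s > 1 \<Longrightarrow> deriv zeta s = - (zeta s * mangoldt_series s)"
  using DERIV_imp_deriv[OF zeta_has_field_derivative[of s]] zeta_times_mangoldt_series[of s] by simp

lemma zeta_nonzero:
  assumes "Re s > 1"
  shows "zeta s \<noteq> 0"
  using three_four_one[OF assms, of "Im s"] by auto

lemma mangoldt_series_eq_logderiv:
  assumes "Re s > 1"
  shows "mangoldt_series s = 1 / (s - 1) - reg_zeta_logderiv s"
proof -
  have s1: "s \<noteq> 1" using assms by auto
  have "((\<lambda>s. (s - 1) * zeta s) has_field_derivative (zeta s - (s - 1) * (zeta s * mangoldt_series s))) (at s)"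
    using zeta_has_field_derivative[OF assms] zeta_times_mangoldt_series[OF assms]
    by (auto intro!: derivative_eq_intros)
  hence "(reg_zeta has_field_derivative (zeta s - (s - 1) * (zeta s * mangoldt_series s))) (at s)"
    by (rule has_field_derivative_transform_within_open[OF _ open_halfspace_Re_gt[of 1]])
       (use assms reg_zeta_eq in auto)
  hence "deriv reg_zeta s = zeta s - (s - 1) * (zeta s * mangoldt_series s)" by (rule DERIV_imp_deriv)
  hence "reg_zeta_logderiv s = (zeta s - (s - 1) * (zeta s * mangoldt_series s)) / ((s - 1) * zeta s)"
    using reg_zeta_eq[OF assms] by (simp add: reg_zeta_logderiv_def)
  also have "\<dots> = 1 / (s - 1) - mangoldt_series s" using s1 zeta_nonzero[OF assms] by (simp add: field_simps)
  finally show ?thesis by simp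
qed

text \<open>An open set containing the closed strip 1 \<le> Re s \<le> 2, so that the logarithmic
  derivative is holomorphic around every point of the boundary line, including s = 1.\<close>

definition logderiv_domain :: "complex set" where
  "logderiv_domain = {s. Re s > 39/40} \<inter> reg_zeta -` (- {0})"

lemma open_logderiv_domain: "open logderiv_domain"
  unfolding logderiv_domain_def
  by (intro continuous_open_preimage holomorphic_on_imp_continuous_on reg_zeta_holomorphic open_half) auto

lemma reg_zeta_logderiv_holomorphic: "reg_zeta_logderiv holomorphic_on logderiv_domain"
  unfolding reg_zeta_logderiv_def [abs_def]
proof (intro holomorphic_on_divide)
  show "deriv reg_zeta holomorphic_on logderiv_domain"
    by (rule holomorphic_on_subset[OF holomorphic_deriv[OF reg_zeta_holomorphic open_half]])
       (auto simp: logderiv_domain_def)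
  show "reg_zeta holomorphic_on logderiv_domain"
    by (rule holomorphic_on_subset[OF reg_zeta_holomorphic]) (auto simp: logderiv_domain_def)
qed (auto simp: logderiv_domain_def)

lemma in_logderiv_domain: "1 \<le> Re s \<Longrightarrow> Re s \<le> 2 \<Longrightarrow> s \<in> logderiv_domain"
  using reg_zeta_nonzero by (auto simp: logderiv_domain_def)

text \<open>The value at 1 is the limit along real arguments from the right, where the Dirichlet
  series has real terms.\<close>

lemma reg_zeta_logderiv_1_real: "Im (reg_zeta_logderiv 1) = 0"
proof -
  have one: "1 \<in> logderiv_domain" by (rule in_logderiv_domain) auto
  have "isCont reg_zeta_logderiv 1"
    using holomorphic_on_imp_continuous_on[OF reg_zeta_logderiv_holomorphic] open_logderiv_domain one
    by (simp add: continuous_on_eq_continuous_at)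
  hence "((\<lambda>\<sigma>. reg_zeta_logderiv (of_real \<sigma>)) \<longlongrightarrow> reg_zeta_logderiv 1) (at_right 1)"
    by (rule isCont_tendsto_compose) (auto intro!: tendsto_eq_intros)
  hence "((\<lambda>\<sigma>. Im (reg_zeta_logderiv (of_real \<sigma>))) \<longlongrightarrow> Im (reg_zeta_logderiv 1)) (at_right 1)"
    by (rule tendsto_Im)
  moreover have "((\<lambda>\<sigma>. Im (reg_zeta_logderiv (of_real \<sigma>))) \<longlongrightarrow> 0) (at_right 1)"
  proof (rule tendsto_eventually, rule eventually_at_right_less[THEN eventually_mono])
    fix \<sigma> :: real assume \<sigma>: "1 < \<sigma>"
    have im0: "Im (mangoldt n * of_nat n powr (-of_real \<sigma>)) = 0" for n
    proof -
      have "(of_nat n :: complex) powr (-of_real \<sigma>) = of_real (real n powr (-\<sigma>))"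
        using powr_of_real[of "real n" "-\<sigma>"] by simp
      thus ?thesis by simp
    qed
    have "Re (of_real \<sigma>) > 1" using \<sigma> by simp
    from sums_Im[OF sums_mangoldt_series[OF this]]
    have "(\<lambda>n. 0) sums Im (mangoldt_series (of_real \<sigma>))" unfolding im0 .
    hence "Im (mangoldt_series (of_real \<sigma>)) = 0" using sums_unique2 sums_zero by blast
    moreover have "Im (1 / (of_real \<sigma> - 1)) = 0"
      by (metis Im_complex_of_real of_real_1 of_real_diff of_real_divide)
    ultimately show "Im (reg_zeta_logderiv (of_real \<sigma>)) = 0"
      using mangoldt_series_eq_logderiv[of "of_real \<sigma>"] \<sigma> by (simp add: complex_eq_iff)
  qed
  ultimately show ?thesis by (rule tendsto_unique[rotated 1]) simp
qed

text \<open>This is \<open>b\<close> of the overview. Its value is Euler's constant, the coefficient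
  of s - 1 in the expansion of (s - 1) zeta(s) at 1.\<close>

definition mertens_const :: real where
  "mertens_const = Re (reg_zeta_logderiv 1)"

lemma reg_zeta_logderiv_1: "reg_zeta_logderiv 1 = of_real mertens_const"
  using reg_zeta_logderiv_1_real by (simp add: mertens_const_def complex_eq_iff)

text \<open>The Laplace transform of \<open>mertens_error (exp v)\<close> over v \<ge> 0, as shown
  later: the three terms come from the Mertens sum, from v and from the constant.\<close>

definition mertens_transform :: "complex \<Rightarrow> complex" where
  "mertens_transform s = (mangoldt_series (1 + s) - 1 / s + of_real mertens_const) / s"

text \<open>The constant \<open>mertens_const\<close> is chosen such that the numerator of the transform vanishes at \<open>s = 0\<close>.\<close>

lemma mertens_transform_bound_near:
  obtains M where "M \<ge> 0" "\<And>\<sigma> t. 0 < \<sigma> \<Longrightarrow> \<sigma> \<le> 1 \<Longrightarrow> \<bar>t\<bar> \<le> 1 \<Longrightarrow> norm (mertens_transform (Complex \<sigma> t)) \<le> M"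
proof -
  let ?R = "cbox (Complex 1 (-1)) (Complex 2 1)"
  have R: "z \<in> ?R \<longleftrightarrow> 1 \<le> Re z \<and> Re z \<le> 2 \<and> -1 \<le> Im z \<and> Im z \<le> 1" for z
    by (auto simp: in_cbox_complex_iff)
  have sub: "?R \<subseteq> logderiv_domain" using R in_logderiv_domain by blast
  have "continuous_on ?R (deriv reg_zeta_logderiv)"
    by (rule continuous_on_subset[OF holomorphic_on_imp_continuous_on[OF holomorphic_deriv[OF reg_zeta_logderiv_holomorphic open_logderiv_domain]] sub])
  hence "bounded (deriv reg_zeta_logderiv ` ?R)"
    by (intro compact_imp_bounded compact_continuous_image compact_cbox)
  then obtain M where M: "\<And>z. z \<in> ?R \<Longrightarrow> norm (deriv reg_zeta_logderiv z) \<le> M" by (auto simp: bounded_iff)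
  have M0: "M \<ge> 0" using M[of 1] R[of 1] order.trans[OF norm_ge_zero] by force
  show thesis
  proof (rule that[OF M0])
    fix \<sigma> t :: real assume st: "0 < \<sigma>" "\<sigma> \<le> 1" "\<bar>t\<bar> \<le> 1"
    let ?s = "Complex \<sigma> t"
    have s0: "?s \<noteq> 0" using st by (auto simp: complex_eq_iff)
    have "norm (reg_zeta_logderiv (1 + ?s) - reg_zeta_logderiv 1) \<le> M * norm ((1 + ?s) - 1)"
    proof (rule field_differentiable_bound[of ?R reg_zeta_logderiv "deriv reg_zeta_logderiv"])
      fix z assume z: "z \<in> ?R"
      thus "(reg_zeta_logderiv has_field_derivative deriv reg_zeta_logderiv z) (at z within ?R)"
        using sub holomorphic_derivI[OF reg_zeta_logderiv_holomorphic open_logderiv_domain]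
          has_field_derivative_at_within by blast
      show "norm (deriv reg_zeta_logderiv z) \<le> M" by (rule M[OF z])
    qed (use st in \<open>auto simp: R convex_box\<close>)
    moreover have "mertens_transform ?s = - (reg_zeta_logderiv (1 + ?s) - reg_zeta_logderiv 1) / ?s"
      using mangoldt_series_eq_logderiv[of "1 + ?s"] st by (simp add: mertens_transform_def reg_zeta_logderiv_1)
    ultimately show "norm (mertens_transform ?s) \<le> M"
      using s0 by (simp add: norm_divide norm_minus_commute divide_le_eq)
  qed
qed

text \<open>With T = |t| + 4, the derivative is O(T^(1/20)) and zeta is at least of order T^(-1/5),
  so the logarithmic derivative is O(T^(1/4)). This dominates the other terms of the numerator, and
  division by s leaves the exponent -3/4.\<close>

lemma mertens_transform_bound_far:
  obtains M where "M \<ge> 0" "\<And>\<sigma> t. 0 < \<sigma> \<Longrightarrow> \<sigma> \<le> 1 \<Longrightarrow> 1 \<le> \<bar>t\<bar> \<Longrightarrow> norm (mertens_transform (Complex \<sigma> t)) \<le> M * (1 + \<bar>t\<bar>) powr (-3/4)"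
proof -
  obtain c where c: "c > 0" "\<And>\<sigma> t. 1 \<le> \<sigma> \<Longrightarrow> \<sigma> \<le> 2 \<Longrightarrow> 1 \<le> \<bar>t\<bar> \<Longrightarrow> norm (zeta_ext (Complex \<sigma> t)) \<ge> c * (\<bar>t\<bar> + 4) powr (-1/5)"
    by (rule zeta_ext_lower_bound[of 1]) auto
  define A where "A = 50 * (2 + zeta_bound_const) * 2"
  have A: "A > 0" using zeta_bound_const_nonneg by (simp add: A_def)
  define M where "M = 2 * (A / c * 4 + 1 + \<bar>mertens_const\<bar>)"
  have M0: "M \<ge> 0" using A c by (simp add: M_def)
  show thesis
  proof (rule that[OF M0])
    fix \<sigma> t :: real assume st: "0 < \<sigma>" "\<sigma> \<le> 1" "1 \<le> \<bar>t\<bar>"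
    let ?s = "Complex \<sigma> t" and ?z = "Complex (1 + \<sigma>) t"
    have z: "1 + ?s = ?z" by (simp add: complex_eq_iff)
    define T where "T = \<bar>t\<bar> + 4"
    have T: "T \<ge> 4" by (simp add: T_def)
    define U where "U = 1 + \<bar>t\<bar>"
    have U: "U \<ge> 2" "T \<le> 4 * U" using st by (auto simp: U_def T_def)
    have U1: "1 \<le> U powr (1/4)" using U by (intro ge_one_powr_ge_zero) auto
    have "deriv zeta_ext ?z = deriv zeta ?z"
    proof (rule deriv_cong_ev)
      have "eventually (\<lambda>x. x \<in> {s. Re s > 1}) (nhds ?z)"
        using st by (intro eventually_nhds_in_open open_halfspace_Re_gt) auto
      thus "eventually (\<lambda>x. zeta_ext x = zeta x) (nhds ?z)" by eventually_elim (simp add: zeta_ext_eq)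
    qed simp
    hence "deriv zeta_ext ?z = - (zeta ?z * mangoldt_series ?z)" using deriv_zeta_eq[of ?z] st by simp
    moreover have ze: "zeta_ext ?z = zeta ?z" using zeta_ext_eq[of ?z] st by simp
    ultimately have prod: "norm (deriv zeta_ext ?z) = norm (zeta_ext ?z) * norm (mangoldt_series ?z)" by (simp add: norm_mult)
    have "c * T powr (-1/5) * norm (mangoldt_series ?z) \<le> norm (zeta_ext ?z) * norm (mangoldt_series ?z)"
      using c(2)[of "1 + \<sigma>" t] st by (intro mult_right_mono) (auto simp: T_def)
    also have "\<dots> \<le> A * T powr (1/20)"
      using norm_deriv_zeta_ext_le[of 1 ?z] st prod by (simp add: A_def T_def)
    finally have "norm (mangoldt_series ?z) * (c * T powr (-1/5)) \<le> A * T powr (1/20)" by (simp add: mult_ac)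
    hence "norm (mangoldt_series ?z) \<le> A * T powr (1/20) / (c * T powr (-1/5))"
      using c T by (subst pos_le_divide_eq) auto
    also have "\<dots> = A / c * (T powr (1/20) / T powr (-1/5))" by simp
    also have "\<dots> \<le> A / c * (4 * U powr (1/4))"
    proof (rule mult_left_mono)
      have "T powr (1/20) / T powr (-1/5) = T powr (1/4)" by (subst powr_diff [symmetric]) simp
      also have "\<dots> \<le> (4 * U) powr (1/4)" using T U by (intro powr_mono2) auto
      also have "\<dots> = 4 powr (1/4) * U powr (1/4)" by (subst powr_mult) (use U in auto)
      also have "\<dots> \<le> 4 powr 1 * U powr (1/4)" by (intro mult_right_mono powr_mono) auto
      finally show "T powr (1/20) / T powr (-1/5) \<le> 4 * U powr (1/4)" by simp
    qed (use A c in simp)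
    finally have m: "norm (mangoldt_series ?z) \<le> A / c * 4 * U powr (1/4)" by simp
    have ns: "norm ?s \<ge> \<bar>t\<bar>" using abs_Im_le_cmod[of ?s] by simp
    hence ns1: "norm ?s \<ge> 1" "norm ?s \<ge> U / 2" using st by (auto simp: U_def)
    have "norm (mangoldt_series ?z - 1 / ?s + of_real mertens_const) \<le> norm (mangoldt_series ?z) + norm (1 / ?s) + \<bar>mertens_const\<bar>"
      using norm_triangle_ineq4[of "mangoldt_series ?z" "1 / ?s"] norm_triangle_ineq[of "mangoldt_series ?z - 1 / ?s" "of_real mertens_const"] by simp
    also have "norm (1 / ?s) \<le> 1" using ns1 by (simp add: norm_divide divide_le_eq)
    also have "norm (mangoldt_series ?z) \<le> A / c * 4 * U powr (1/4)" by (rule m)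
    also have "A / c * 4 * U powr (1/4) + 1 + \<bar>mertens_const\<bar> \<le> A / c * 4 * U powr (1/4) + 1 * U powr (1/4) + \<bar>mertens_const\<bar> * U powr (1/4)"
      using U1 mult_left_mono[OF U1, of "\<bar>mertens_const\<bar>"] by (intro add_mono) simp_all
    also have "\<dots> = M / 2 * U powr (1/4)" by (simp add: M_def algebra_simps)
    finally have num: "norm (mangoldt_series ?z - 1 / ?s + of_real mertens_const) \<le> M / 2 * U powr (1/4)" by simp
    have "norm (mertens_transform ?s) \<le> (M / 2 * U powr (1/4)) / (U / 2)"
      unfolding mertens_transform_def norm_divide z using num ns1 U M0 by (intro frac_le) auto
    also have "\<dots> = M * (U powr (1/4) / U powr 1)" using U by simp
    also have "U powr (1/4) / U powr 1 = U powr (-3/4)" by (subst powr_diff [symmetric]) simp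
    finally show "norm (mertens_transform ?s) \<le> M * (1 + \<bar>t\<bar>) powr (-3/4)" by (simp add: U_def)
  qed
qed

text \<open>The point is uniformity in \<sigma>: the same integrable majorant serves all \<sigma>
  down to 0.\<close>

theorem mertens_transform_bound:
  obtains C where "C \<ge> 0" "\<And>\<sigma> t. 0 < \<sigma> \<Longrightarrow> \<sigma> \<le> 1 \<Longrightarrow> (norm (mertens_transform (Complex \<sigma> t)))\<^sup>2 \<le> C * (1 + \<bar>t\<bar>) powr (-3/2)"
proof -
  obtain M1 where M1: "M1 \<ge> 0" "\<And>\<sigma> t. 0 < \<sigma> \<Longrightarrow> \<sigma> \<le> 1 \<Longrightarrow> \<bar>t\<bar> \<le> 1 \<Longrightarrow> norm (mertens_transform (Complex \<sigma> t)) \<le> M1"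
    using mertens_transform_bound_near by blast
  obtain M2 where M2: "M2 \<ge> 0" "\<And>\<sigma> t. 0 < \<sigma> \<Longrightarrow> \<sigma> \<le> 1 \<Longrightarrow> 1 \<le> \<bar>t\<bar> \<Longrightarrow> norm (mertens_transform (Complex \<sigma> t)) \<le> M2 * (1 + \<bar>t\<bar>) powr (-3/4)"
    using mertens_transform_bound_far by blast
  define M where "M = M1 * 2 + M2"
  have bound: "norm (mertens_transform (Complex \<sigma> t)) \<le> M * (1 + \<bar>t\<bar>) powr (-3/4)" if st: "0 < \<sigma>" "\<sigma> \<le> 1" for \<sigma> t
  proof (cases "\<bar>t\<bar> \<le> 1")
    case True
    have "1/2 = 2 powr (-1 :: real)" by (simp add: powr_minus_divide)
    also have "\<dots> \<le> 2 powr (-3/4 :: real)" by (intro powr_mono) auto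
    also have "\<dots> \<le> (1 + \<bar>t\<bar>) powr (-3/4)" using True by (intro powr_mono2') auto
    finally have "(1 + \<bar>t\<bar>) powr (-3/4) \<ge> 1/2" .
    hence "M1 * 2 * (1/2) \<le> M * (1 + \<bar>t\<bar>) powr (-3/4)" using M1(1) M2(1) by (intro mult_mono) (auto simp: M_def)
    thus ?thesis using M1(2)[OF st True] by simp
  next
    case False
    have "M2 * (1 + \<bar>t\<bar>) powr (-3/4) \<le> M * (1 + \<bar>t\<bar>) powr (-3/4)" using M1(1) by (intro mult_right_mono) (auto simp: M_def)
    thus ?thesis using M2(2)[of \<sigma> t] st False by linarith
  qed
  show thesis
  proof (rule that[of "M\<^sup>2"])
    fix \<sigma> t :: real assume st: "0 < \<sigma>" "\<sigma> \<le> 1"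
    have "(norm (mertens_transform (Complex \<sigma> t)))\<^sup>2 \<le> (M * (1 + \<bar>t\<bar>) powr (-3/4))\<^sup>2"
      using bound[OF st] by (intro power_mono) auto
    also have "\<dots> = M\<^sup>2 * (1 + \<bar>t\<bar>) powr (-3/2)" by (simp add: power_mult_distrib powr_power)
    finally show "(norm (mertens_transform (Complex \<sigma> t)))\<^sup>2 \<le> M\<^sup>2 * (1 + \<bar>t\<bar>) powr (-3/2)" .
  qed simp
qed

section \<open>A Plancherel inequality\<close>

text \<open>Integrating the square of the transform against a Gaussian of width \<open>n\<close> gives a smoothed correlation of \<open>a\<close> with itself, which tends to its square integral as \<open>n\<close> grows.\<close>

lemma plancherel_inequality:
  fixes a q :: "real \<Rightarrow> real"
  assumes int: "integrable lborel a" and bound: "\<And>v. \<bar>a v\<bar> \<le> B"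
    and cont: "AE u in lborel. isCont a u"
    and q: "integrable lborel q"
    and le: "\<And>t. (norm (LINT v|lborel. iexp (- (t * v)) * a v))\<^sup>2 \<le> q t"
  shows "(LINT v|lborel. (a v)\<^sup>2) \<le> (LINT t|lborel. q t) / (2 * pi)"
proof -
  define \<phi> where "\<phi> = std_normal_density"
  define M where "M = density lborel (\<lambda>x. ennreal (\<phi> x))"
  have M: "M = std_normal_distribution" by (simp add: M_def \<phi>_def)
  interpret real_distribution M unfolding M by (rule real_dist_normal_dist)
  interpret L: sigma_finite_measure "lborel :: real measure" by (rule sigma_finite_lborel)
  interpret P: pair_sigma_finite M "lborel :: real measure" ..
  have \<phi>_int: "integrable lborel \<phi>" by (simp add: \<phi>_def)
  have \<phi>_1: "(LINT w|lborel. \<phi> w) = 1" by (simp add: \<phi>_def)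
  have \<phi>_nn: "\<phi> w \<ge> 0" for w by (simp add: \<phi>_def)
  have [measurable]: "a \<in> borel_measurable borel" using int by (auto dest: borel_measurable_integrable)
  have [measurable]: "\<phi> \<in> borel_measurable borel" by (simp add: \<phi>_def)
  have B0: "B \<ge> 0" using bound[of 0] by linarith
  define ah where "ah = (\<lambda>t. LINT v|lborel. iexp (- (t * v)) * complex_of_real (a v))"
  have [measurable]: "ah \<in> borel_measurable borel" unfolding ah_def by measurable
  have [measurable]: "cnj \<in> borel_measurable borel"
    by (intro borel_measurable_continuous_onI continuous_intros)
  define A where "A = (LINT v|lborel. \<bar>a v\<bar>)"
  have int_iexp: "integrable lborel (\<lambda>v. iexp (f v) * complex_of_real (a v))" if [measurable]: "f \<in> borel_measurable borel" for f
    by (rule Bochner_Integration.integrable_bound[OF integrable_abs[OF int]]) (auto simp: norm_mult)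
  have ah_bound: "norm (ah t) \<le> A" for t
  proof -
    have "norm (ah t) \<le> (LINT v|lborel. norm (iexp (- (t * v)) * complex_of_real (a v)))"
      unfolding ah_def by (rule integral_norm_bound)
    thus ?thesis by (simp add: A_def norm_mult)
  qed
  have cnj_ah: "cnj (ah t) = (LINT v|lborel. iexp (t * v) * complex_of_real (a v))" for t
    unfolding ah_def by (subst Bochner_Integration.integral_cnj [symmetric]) (simp add: exp_cnj)
  \<comment> \<open>\<open>G n\<close> is a averaged against a Gaussian of width 1/n;
    \<open>J n\<close> is the mean of the squared transform against a Gaussian of width n.\<close>
  define G where "G = (\<lambda>n u. LINT w|lborel. a (u + w / n) * \<phi> w)"
  define J where "J = (\<lambda>n::real. LINT t|M. (norm (ah (n * t)))\<^sup>2)"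
  \<comment> \<open>The square is opened as the transform times its conjugate. After exchanging
    integrals, integration over t produces the characteristic function of the normal law, again a
    Gaussian, and v = u + w/n turns the integral over v into \<open>G n u\<close>.\<close>
  have J_eq: "n * J n = sqrt (2 * pi) * (LINT u|lborel. a u * G n u)" if n: "n > 0" for n :: real
  proof -
    let ?F = "\<lambda>t u. iexp (- (n * t * u)) * complex_of_real (a u) * cnj (ah (n * t))"
    have inner: "(LINT t|M. ?F t u)
        = complex_of_real (sqrt (2 * pi) / n * (a u * G n u))" for u
    proof -
      let ?f = "\<lambda>t v. complex_of_real (a u) * (iexp (t * (n * (v - u))) * complex_of_real (a v))"
      let ?w = "\<lambda>v. a v * exp (- (n * (v - u))\<^sup>2 / 2)"
      have "(LINT t|M. ?F t u)
          = (LINT t|M. LINT v|lborel. ?f t v)"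
        unfolding cnj_ah integral_mult_right_zero[symmetric]
        by (intro Bochner_Integration.integral_cong refl) (simp add: algebra_simps flip: exp_add)
      also have "\<dots> = (LINT v|lborel. LINT t|M. ?f t v)"
      proof (rule P.Fubini_integral[symmetric])
        show "integrable (M \<Otimes>\<^sub>M lborel) (\<lambda>(t,v). ?f t v)"
        proof (rule P.Fubini_integrable)
          have "(\<lambda>t. LINT v|lborel. norm (case (t, v) of (t, v) \<Rightarrow> ?f t v)) = (\<lambda>t. \<bar>a u\<bar> * A)"
            by (simp add: norm_mult A_def)
          thus "integrable M (\<lambda>t. LINT v|lborel. norm (case (t, v) of (t, v) \<Rightarrow> ?f t v))"
            by simp
          have "integrable lborel (\<lambda>v. ?f t v)" for t
            by (intro integrable_mult_right int_iexp) measurable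
          thus "AE t in M. integrable lborel (\<lambda>v. case (t, v) of (t, v) \<Rightarrow> ?f t v)"
            by simp
        qed measurable
      qed
      also have "\<dots> = (LINT v|lborel. complex_of_real (a u * (?w v)))"
      proof (intro Bochner_Integration.integral_cong refl)
        fix v
        have "(LINT t|M. iexp (t * (n * (v - u)))) = char M (n * (v - u))" by (simp add: char_def mult.commute)
        also have "\<dots> = complex_of_real (exp (- (n * (v - u))\<^sup>2 / 2))" unfolding M char_std_normal_distribution ..
        finally show "(LINT t|M. ?f t v)
            = complex_of_real (a u * (?w v))"
          by (simp add: mult_ac)
      qed
      also have "\<dots> = complex_of_real (LINT v|lborel. a u * (?w v))"
        by (rule integral_complex_of_real)
      also have "(LINT v|lborel. a u * (?w v)) = a u * (LINT v|lborel. ?w v)"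
        by simp
      also have "(LINT v|lborel. ?w v) = \<bar>1 / n\<bar> *\<^sub>R (LINT w|lborel. a (u + 1 / n * w) * exp (- (n * ((u + 1 / n * w) - u))\<^sup>2 / 2))"
        using n by (intro lborel_integral_real_affine) auto
      also have "\<dots> = 1 / n * (LINT w|lborel. sqrt (2 * pi) * (a (u + w / n) * \<phi> w))"
        using n by (simp add: \<phi>_def std_normal_density_def)
      also have "\<dots> = sqrt (2 * pi) / n * G n u" by (simp add: G_def)
      finally show ?thesis by (simp add: mult_ac)
    qed
    have "complex_of_real (J n) = (LINT t|M. complex_of_real ((norm (ah (n * t)))\<^sup>2))"
      unfolding J_def by (rule integral_complex_of_real[symmetric])
    also have "\<dots> = (LINT t|M. LINT u|lborel. ?F t u)"
    proof (intro Bochner_Integration.integral_cong refl)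
      fix t
      have "complex_of_real ((norm (ah (n * t)))\<^sup>2) = ah (n * t) * cnj (ah (n * t))" by (rule complex_norm_square)
      also have "\<dots> = (LINT u|lborel. ?F t u)"
        unfolding integral_mult_left_zero ah_def ..
      finally show "complex_of_real ((norm (ah (n * t)))\<^sup>2) = (LINT u|lborel. ?F t u)" .
    qed
    also have "\<dots> = (LINT u|lborel. LINT t|M. ?F t u)"
    proof (rule P.Fubini_integral[symmetric])
      show "integrable (M \<Otimes>\<^sub>M lborel) (\<lambda>(t,u). ?F t u)"
      proof (rule P.Fubini_integrable)
        show "(\<lambda>(t,u). ?F t u) \<in> borel_measurable (M \<Otimes>\<^sub>M lborel)"
          by measurable
        have eq: "(\<lambda>t. LINT u|lborel. norm (case (t, u) of (t, u) \<Rightarrow> ?F t u)) = (\<lambda>t. A * norm (ah (n * t)))"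
          by (simp add: norm_mult A_def)
        show "integrable M (\<lambda>t. LINT u|lborel. norm (case (t, u) of (t, u) \<Rightarrow> ?F t u))"
          unfolding eq by (intro integrable_mult_right integrable_const_bound[of _ A]) (auto simp: ah_bound)
        have "integrable lborel (\<lambda>u. ?F t u)" for t
          by (intro integrable_mult_left int_iexp) measurable
        thus "AE t in M. integrable lborel (\<lambda>u. case (t, u) of (t, u) \<Rightarrow> ?F t u)"
          by simp
      qed
    qed
    also have "\<dots> = complex_of_real (LINT u|lborel. sqrt (2 * pi) / n * (a u * G n u))"
      unfolding inner by (rule integral_complex_of_real)
    finally have "J n = (LINT u|lborel. sqrt (2 * pi) / n * (a u * G n u))" by (simp only: of_real_eq_iff)
    also have "\<dots> = sqrt (2 * pi) / n * (LINT u|lborel. a u * G n u)" by simp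
    finally show ?thesis using n by simp
  qed
  \<comment> \<open>The normal density is at most 1/sqrt(2 pi), and rescaling t absorbs the factor
    n.\<close>
  have J_le: "n * J n \<le> (LINT t|lborel. q t) / sqrt (2 * pi)" if n: "n > 0" for n :: real
  proof -
    have qn: "integrable lborel (\<lambda>t. q (0 + n * t))" using n by (intro lborel_integrable_real_affine q) auto
    have "J n = (LINT t|lborel. \<phi> t *\<^sub>R (norm (ah (n * t)))\<^sup>2)"
      unfolding J_def M_def by (subst integral_density) (auto simp: \<phi>_nn)
    also have "\<dots> \<le> (LINT t|lborel. (1 / sqrt (2 * pi)) * q (0 + n * t))"
    proof (rule integral_mono')
      show "integrable lborel (\<lambda>t. (1 / sqrt (2 * pi)) * q (0 + n * t))" using qn by (rule integrable_mult_right)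
      fix t
      have "\<phi> t \<le> 1 / sqrt (2 * pi)" by (simp add: \<phi>_def std_normal_density_def divide_right_mono)
      moreover have "(norm (ah (n * t)))\<^sup>2 \<le> q (0 + n * t)" using le[of "n * t"] by (simp add: ah_def)
      ultimately show "\<phi> t *\<^sub>R (norm (ah (n * t)))\<^sup>2 \<le> (1 / sqrt (2 * pi)) * q (0 + n * t)"
        unfolding real_scaleR_def by (intro mult_mono) auto
      show "0 \<le> (1 / sqrt (2 * pi)) * q (0 + n * t)"
        using order.trans[OF zero_le_power2 le[of "n * t"]] by simp
    qed
    also have "\<dots> = (1 / sqrt (2 * pi)) * (LINT t|lborel. q (0 + n * t))" by simp
    finally have "n * J n \<le> n * ((1 / sqrt (2 * pi)) * (LINT t|lborel. q (0 + n * t)))" using n by (intro mult_left_mono) auto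
    also have "\<dots> = (1 / sqrt (2 * pi)) * (\<bar>n\<bar> *\<^sub>R (LINT t|lborel. q (0 + n * t)))" using n by simp
    also have "\<bar>n\<bar> *\<^sub>R (LINT t|lborel. q (0 + n * t)) = (LINT t|lborel. q t)"
      using n by (intro lborel_integral_real_affine[symmetric]) auto
    finally show ?thesis by simp
  qed
  have G_le: "\<bar>G n u\<bar> \<le> B" for n u
  proof -
    have "\<bar>G n u\<bar> \<le> (LINT w|lborel. \<bar>a (u + w / n) * \<phi> w\<bar>)"
      unfolding G_def using integral_norm_bound[of lborel "\<lambda>w. a (u + w / n) * \<phi> w"] by simp
    also have "\<dots> \<le> (LINT w|lborel. B * \<phi> w)"
      by (rule integral_mono') (use \<phi>_int \<phi>_nn bound B0 in \<open>auto simp: abs_mult intro!: mult_right_mono mult_nonneg_nonneg\<close>)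
    also have "\<dots> = B" by (simp add: \<phi>_1)
    finally show ?thesis .
  qed
  \<comment> \<open>Continuity at u is all that is required here, so almost everywhere continuity of
    a suffices for the limit under the outer integral.\<close>
  have G_lim: "(\<lambda>n. G (real (Suc n)) u) \<longlonglongrightarrow> a u" if c: "isCont a u" for u
  proof -
    have "(\<lambda>n. LINT w|lborel. a (u + w / real (Suc n)) * \<phi> w) \<longlonglongrightarrow> (LINT w|lborel. a u * \<phi> w)"
    proof (rule integral_dominated_convergence[where w = "\<lambda>w. B * \<phi> w"])
      show "AE w in lborel. (\<lambda>n. a (u + w / real (Suc n)) * \<phi> w) \<longlonglongrightarrow> a u * \<phi> w"
      proof (intro AE_I2 tendsto_mult tendsto_const)
        fix w :: real
        have "(\<lambda>n. u + w / real (Suc n)) \<longlonglongrightarrow> u + 0"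
          by (intro tendsto_add tendsto_const real_tendsto_divide_at_top[OF tendsto_const[of w]] filterlim_compose[OF filterlim_real_sequentially filterlim_Suc])
        hence "(\<lambda>n. u + w / real (Suc n)) \<longlonglongrightarrow> u" by simp
        from isCont_tendsto_compose[OF c this] show "(\<lambda>n. a (u + w / real (Suc n))) \<longlonglongrightarrow> a u" .
      qed
      show "AE w in lborel. norm (a (u + w / real (Suc n)) * \<phi> w) \<le> B * \<phi> w" for n
        using bound \<phi>_nn by (intro AE_I2) (auto simp: abs_mult intro!: mult_right_mono)
    qed (use \<phi>_int in auto)
    thus ?thesis unfolding G_def by (simp add: \<phi>_1)
  qed
  have Gm: "G (real (Suc n)) \<in> borel_measurable borel" for n unfolding G_def by measurable
  have "(\<lambda>n. LINT u|lborel. a u * G (real (Suc n)) u) \<longlonglongrightarrow> (LINT u|lborel. a u * a u)"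
  proof (rule integral_dominated_convergence[where w = "\<lambda>u. B * \<bar>a u\<bar>"])
    show "AE u in lborel. (\<lambda>n. a u * G (real (Suc n)) u) \<longlonglongrightarrow> a u * a u"
      using cont by eventually_elim (intro tendsto_intros G_lim)
    show "AE u in lborel. norm (a u * G (real (Suc n)) u) \<le> B * \<bar>a u\<bar>" for n
      using G_le by (intro AE_I2) (auto simp: abs_mult mult.commute[of B] intro!: mult_left_mono)
  qed (use int Gm in auto)
  hence "(\<lambda>n. real (Suc n) * J (real (Suc n))) \<longlonglongrightarrow> sqrt (2 * pi) * (LINT u|lborel. a u * a u)"
    by (subst J_eq) (auto intro!: tendsto_mult)
  hence "sqrt (2 * pi) * (LINT u|lborel. a u * a u) \<le> (LINT t|lborel. q t) / sqrt (2 * pi)"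
    by (rule LIMSEQ_le_const2) (use J_le in auto)
  hence "sqrt (2 * pi) * (LINT u|lborel. a u * a u) * sqrt (2 * pi) \<le> (LINT t|lborel. q t)"
    by (subst (asm) pos_le_divide_eq) simp_all
  moreover have "sqrt (2 * pi) * (LINT u|lborel. a u * a u) * sqrt (2 * pi) = (sqrt (2 * pi))\<^sup>2 * (LINT u|lborel. a u * a u)"
    by (simp only: power2_eq_square mult_ac)
  moreover have "(sqrt (2 * pi))\<^sup>2 = 2 * pi" by (rule real_sqrt_pow2) simp
  ultimately have "2 * pi * (LINT u|lborel. a u * a u) \<le> (LINT t|lborel. q t)" by (simp only:)
  thus ?thesis by (simp add: field_simps power2_eq_square)
qed

section \<open>The error term in the theorem of Mertens in mean square\<close>

text \<open>The exponential majorant yields integrability on the half-line. The fundamental theorem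
  is applied on the open half-line, which differs from the closed one by a null set.\<close>

lemma integral_Ici_FTC:
  fixes f F :: "real \<Rightarrow> complex"
  assumes F: "\<And>x. (F has_vector_derivative f x) (at x)" and cont: "\<And>x. isCont f x"
    and dom: "\<And>x. x \<ge> a \<Longrightarrow> norm (f x) \<le> K * exp (- c * x)" and c: "c > 0"
    and lim: "(F \<longlongrightarrow> 0) at_top"
  shows "integrable lborel (\<lambda>x. indicator {a..} x *\<^sub>R f x)"
    and "(LINT x|lborel. indicator {a..} x *\<^sub>R f x) = - F a"
proof -
  have ei: "einterval (ereal a) \<infinity> = {a<..}" by auto
  have AE: "AE x in lborel. indicator {a<..} x *\<^sub>R f x = indicator {a..} x *\<^sub>R f x"
    using AE_lborel_singleton[of a] by eventually_elim (auto simp: indicator_def)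
  have [measurable]: "f \<in> borel_measurable borel"
    using cont by (intro borel_measurable_continuous_onI continuous_at_imp_continuous_on) auto
  have ie: "set_integrable lborel (einterval (ereal a) \<infinity>) (\<lambda>x. exp (- c * x))"
  proof (rule interval_integral_FTC_nonneg(1)[where F = "\<lambda>x. - exp (- c * x) / c" and A = "- exp (- c * a) / c" and B = 0])
    show "DERIV (\<lambda>x. - exp (- c * x) / c) x :> exp (- c * x)" for x
      using c by (auto intro!: derivative_eq_intros)
    show "(((\<lambda>x. - exp (- c * x) / c) \<circ> real_of_ereal) \<longlongrightarrow> - exp (- c * a) / c) (at_right (ereal a))"
      unfolding ereal_tendsto_simps by (intro tendsto_intros) (use c in auto)
    show "(((\<lambda>x. - exp (- c * x) / c) \<circ> real_of_ereal) \<longlongrightarrow> 0) (at_left \<infinity>)"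
      unfolding ereal_tendsto_simps using c by real_asymp
  qed auto
  have int0: "set_integrable lborel (einterval (ereal a) \<infinity>) f"
    unfolding set_integrable_def
  proof (rule Bochner_Integration.integrable_bound)
    show "integrable lborel (\<lambda>x. K * (indicator (einterval (ereal a) \<infinity>) x *\<^sub>R exp (- c * x)))"
      using ie unfolding set_integrable_def by (rule integrable_mult_right)
    show "AE x in lborel. norm (indicator (einterval (ereal a) \<infinity>) x *\<^sub>R f x) \<le> norm (K * (indicator (einterval (ereal a) \<infinity>) x *\<^sub>R exp (- c * x)))"
    proof (rule AE_I2)
      fix x
      show "norm (indicator (einterval (ereal a) \<infinity>) x *\<^sub>R f x) \<le> norm (K * (indicator (einterval (ereal a) \<infinity>) x *\<^sub>R exp (- c * x)))"
      proof (cases "a < x")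
        case True
        hence "norm (f x) \<le> K * exp (- c * x)" by (intro dom) auto
        also have "\<dots> \<le> \<bar>K * exp (- c * x)\<bar>" by (rule abs_ge_self)
        finally show ?thesis using True by (simp add: ei)
      qed (simp add: ei)
    qed
  qed simp
  have "(LBINT x=ereal a..\<infinity>. f x) = 0 - F a"
  proof (rule interval_integral_FTC_integrable[OF _ F cont int0])
    have "isCont F a" using F[of a] by (rule has_vector_derivative_continuous)
    thus "((F \<circ> real_of_ereal) \<longlongrightarrow> F a) (at_right (ereal a))"
      unfolding ereal_tendsto_simps by (simp add: isCont_def filterlim_at_split)
    show "((F \<circ> real_of_ereal) \<longlongrightarrow> 0) (at_left \<infinity>)" unfolding ereal_tendsto_simps by (rule lim)
  qed simp
  moreover have "(LBINT x=ereal a..\<infinity>. f x) = (LINT x|lborel. indicator {a<..} x *\<^sub>R f x)"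
    by (simp add: interval_lebesgue_integral_def set_lebesgue_integral_def ei)
  moreover have "(LINT x|lborel. indicator {a<..} x *\<^sub>R f x) = (LINT x|lborel. indicator {a..} x *\<^sub>R f x)"
    using AE by (rule integral_cong_AE[rotated 2]) measurable
  ultimately show "(LINT x|lborel. indicator {a..} x *\<^sub>R f x) = - F a" by simp
  show "integrable lborel (\<lambda>x. indicator {a..} x *\<^sub>R f x)"
    using int0 integrable_cong_AE[OF _ _ AE] unfolding set_integrable_def ei by simp
qed

lemma norm_exp_neg: "norm (exp (- (s * of_real v)) :: complex) = exp (- Re s * v)"
  by simp

lemma laplace_tail:
  assumes s: "Re s > 0"
  shows "integrable lborel (\<lambda>v. indicator {a..} v *\<^sub>R exp (- (s * complex_of_real v)))"
    and "(LINT v|lborel. indicator {a..} v *\<^sub>R exp (- (s * complex_of_real v))) = exp (- (s * of_real a)) / s"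
proof -
  let ?E = "\<lambda>v. exp (- (s * complex_of_real v))"
  have s0: "s \<noteq> 0" using s by auto
  let ?F = "\<lambda>v. - ?E v / s"
  have F: "(?F has_vector_derivative ?E v) (at v)" for v
    using s0 by (auto intro!: derivative_eq_intros has_vector_derivative_real_field)
  have lim: "(?F \<longlongrightarrow> 0) at_top"
  proof (rule tendsto_norm_zero_cancel)
    have "((\<lambda>v. exp (- Re s * v) / norm s) \<longlongrightarrow> 0) at_top" using s s0 by real_asymp
    thus "((\<lambda>v. norm (?F v)) \<longlongrightarrow> 0) at_top" by (simp add: norm_divide)
  qed
  note * = integral_Ici_FTC[of ?F "?E" a 1 "Re s", OF F _ _ s lim]
  show "integrable lborel (\<lambda>v. indicator {a..} v *\<^sub>R ?E v)"
    by (rule *) (auto intro!: continuous_intros)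
  show "(LINT v|lborel. indicator {a..} v *\<^sub>R ?E v) = exp (- (s * of_real a)) / s"
    by (subst *(2)) (auto intro!: continuous_intros)
qed

lemma laplace_ident:
  assumes s: "Re s > 0"
  shows "integrable lborel (\<lambda>v. indicator {0..} v *\<^sub>R (of_real v * exp (- (s * complex_of_real v))))"
    and "(LINT v|lborel. indicator {0..} v *\<^sub>R (of_real v * exp (- (s * complex_of_real v)))) = 1 / s\<^sup>2"
proof -
  let ?E = "\<lambda>v. of_real v * exp (- (s * complex_of_real v))"
  have s0: "s \<noteq> 0" using s by auto
  let ?F = "\<lambda>v. - (of_real v / s + 1 / s\<^sup>2) * exp (- (s * complex_of_real v))"
  have F: "(?F has_vector_derivative ?E v) (at v)" for v
  proof -
    have "((\<lambda>z. - (z / s + 1 / s\<^sup>2) * exp (- (s * z))) has_field_derivative (of_real v * exp (- (s * of_real v)))) (at (of_real v))"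
      using s0 by (auto intro!: derivative_eq_intros simp: field_simps power2_eq_square)
    thus ?thesis by (rule has_vector_derivative_real_field)
  qed
  have lim: "(?F \<longlongrightarrow> 0) at_top"
  proof (rule tendsto_norm_zero_cancel, rule Lim_null_comparison)
    have "((\<lambda>v. (v / norm s + 1 / (norm s)\<^sup>2) * exp (- Re s * v)) \<longlongrightarrow> 0) at_top" using s s0 by real_asymp
    thus "((\<lambda>v. (v / norm s + 1 / (norm s)\<^sup>2) * exp (- Re s * v)) \<longlongrightarrow> 0) at_top" .
    show "\<forall>\<^sub>F v in at_top. norm (norm (?F v)) \<le> (v / norm s + 1 / (norm s)\<^sup>2) * exp (- Re s * v)"
      using eventually_ge_at_top[of 0]
    proof eventually_elim
      case (elim v)
      have "norm (of_real v / s + 1 / s\<^sup>2) \<le> v / norm s + 1 / (norm s)\<^sup>2"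
        using elim by (intro order.trans[OF norm_triangle_ineq]) (auto simp: norm_divide norm_power)
      thus ?case unfolding norm_mult norm_minus_cancel norm_exp_neg by (simp add: mult_right_mono)
    qed
  qed
  \<comment> \<open>Half of the exponential decay is spent on absorbing the factor v.\<close>
  have dom: "norm (?E v) \<le> (2 / Re s) * exp (- (Re s / 2) * v)" if "v \<ge> 0" for v
  proof -
    have "Re s / 2 * v \<le> exp (Re s / 2 * v)" by (rule order.trans[OF _ exp_ge_add_one_self]) simp
    hence "2 / Re s * (Re s / 2 * v) \<le> 2 / Re s * exp (Re s / 2 * v)" using s by (intro mult_left_mono) auto
    moreover have "2 / Re s * (Re s / 2 * v) = v" using s by simp
    ultimately have "v \<le> 2 / Re s * exp (Re s / 2 * v)" by (simp only:)
    hence "v * exp (- Re s * v) \<le> 2 / Re s * exp (Re s / 2 * v) * exp (- Re s * v)" by (intro mult_right_mono) auto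
    also have "\<dots> = 2 / Re s * exp (- (Re s / 2) * v)" by (simp flip: exp_add add: algebra_simps)
    finally show ?thesis using that by (simp add: norm_mult)
  qed
  have c2: "Re s / 2 > 0" using s by simp
  note * = integral_Ici_FTC[of ?F "?E" 0 "2 / Re s" "Re s / 2", OF F _ _ c2 lim]
  show "integrable lborel (\<lambda>v. indicator {0..} v *\<^sub>R ?E v)"
    by (rule *) (use dom in \<open>auto intro!: continuous_intros\<close>)
  show "(LINT v|lborel. indicator {0..} v *\<^sub>R ?E v) = 1 / s\<^sup>2"
    by (subst *(2)) (use dom in \<open>auto intro!: continuous_intros\<close>)
qed

text \<open>As a function of v the Mertens sum is a superposition of steps of height
  \<open>mangoldt n / n\<close> at ln n. A step at ln n has transform n^(-s)/s, so term by term
  integration produces the Dirichlet series at 1 + s.\<close>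

lemma laplace_mertens_sum:
  assumes s: "Re s > 0"
  shows "integrable lborel (\<lambda>v. of_real (mertens_sum (exp v)) * exp (- (s * complex_of_real v)))"
    and "(LINT v|lborel. of_real (mertens_sum (exp v)) * exp (- (s * complex_of_real v))) = mangoldt_series (1 + s) / s"
proof -
  let ?E = "\<lambda>v. exp (- (s * complex_of_real v))"
  let ?M = "\<lambda>v. of_real (mertens_sum (exp v)) * exp (- (s * complex_of_real v))"
  define f :: "nat \<Rightarrow> real \<Rightarrow> complex" where
    "f = (\<lambda>n v. of_real (mangoldt n / real n) * (indicator {ln (real n)..} v *\<^sub>R ?E v))"
  have supp: "f n v = 0" if "n \<notin> nats_upto (exp v)" for n v
  proof (cases "n = 0")
    case False
    hence "exp v < real n" using that by (auto simp: nats_upto_iff)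
    hence "ln (exp v) < ln (real n)" using False by (subst ln_less_cancel_iff) auto
    hence "v < ln (real n)" by simp
    thus ?thesis by (simp add: f_def)
  qed (simp add: f_def)
  have fval: "f n v = of_real (mangoldt n / real n) * ?E v" if "n \<in> nats_upto (exp v)" for n v
  proof -
    have "ln (real n) \<le> ln (exp v)" using that by (subst ln_le_cancel_iff) (auto simp: nats_upto_iff)
    hence "ln (real n) \<le> v" by simp
    thus ?thesis by (simp add: f_def)
  qed
  have sum: "(\<lambda>n. f n v) sums ?M v" for v
  proof -
    have "(\<lambda>n. f n v) sums (\<Sum>n\<in>nats_upto (exp v). f n v)"
      by (rule sums_finite) (use supp in auto)
    also have "(\<Sum>n\<in>nats_upto (exp v). f n v) = ?M v"
      by (simp add: fval mertens_sum_def sum_distrib_right)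
    finally show ?thesis .
  qed
  have int: "integrable lborel (f n)" for n
    unfolding f_def by (intro integrable_mult_right laplace_tail s)
  have npow: "exp (- (s * of_real (ln (real n)))) = of_nat n powr (- s)" if "n > 0" for n
    using that by (simp add: powr_def)
  have intf: "(LINT v|lborel. f n v) = mangoldt n * of_nat n powr (-(1 + s)) / s" for n
  proof (cases "n = 0")
    case False
    have "(LINT v|lborel. f n v) = of_real (mangoldt n / real n) * (exp (- (s * of_real (ln (real n)))) / s)"
      unfolding f_def integral_mult_right_zero laplace_tail(2)[OF s] ..
    also have "of_nat n powr (-(1 + s)) = (of_nat n powr (-s) / of_nat n :: complex)"
    proof -
      have "-(1 + s) = -s - 1" by simp
      thus ?thesis using False powr_diff[of "of_nat n :: complex" "-s" 1] by (simp only: powr_one) simp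
    qed
    ultimately show ?thesis using False by (simp add: npow)
  qed (simp add: f_def)
  \<comment> \<open>The absolute value of a step transform's integrand is the integrand at the real
    point Re s, so exchanging sum and integral reduces to absolute convergence of the Dirichlet
    series.\<close>
  have norm_int: "(LINT v|lborel. norm (f n v)) = norm (mangoldt n * of_nat n powr (-(1 + s)) :: complex) / Re s" for n
  proof (cases "n = 0")
    case False
    let ?r = "complex_of_real (Re s)"
    have r: "Re ?r > 0" using s by simp
    have "complex_of_real (LINT v|lborel. norm (f n v)) = (LINT v|lborel. complex_of_real (norm (f n v)))"
      by (rule integral_complex_of_real[symmetric])
    also have "\<dots> = (LINT v|lborel. of_real (mangoldt n / real n) * (indicator {ln (real n)..} v *\<^sub>R exp (- (?r * complex_of_real v))))"
      by (intro Bochner_Integration.integral_cong refl)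
         (simp add: f_def norm_mult norm_divide exp_of_real[symmetric] indicator_def)
    also have "\<dots> = of_real (mangoldt n / real n) * (exp (- (?r * of_real (ln (real n)))) / ?r)"
      unfolding integral_mult_right_zero laplace_tail(2)[OF r] ..
    also have "\<dots> = complex_of_real (mangoldt n / real n * (exp (- (Re s * ln (real n))) / Re s))"
      by (simp add: exp_of_real[symmetric])
    finally have "(LINT v|lborel. norm (f n v)) = mangoldt n / real n * (exp (- (Re s * ln (real n))) / Re s)"
      by (simp only: of_real_eq_iff)
    moreover have "norm (of_nat n powr (-(1 + s)) :: complex) = exp (- (Re s * ln (real n))) / real n"
    proof -
      have "norm (of_nat n powr (-(1 + s)) :: complex) = real n powr (- Re s - 1)"
        using False by (subst norm_nat_powr) (auto intro!: arg_cong2[where f = "(powr)"])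
      also have "\<dots> = real n powr (- Re s) / real n" using False by (simp add: powr_diff)
      also have "real n powr (- Re s) = exp (- (Re s * ln (real n)))" using False by (simp add: powr_def)
      finally show ?thesis .
    qed
    ultimately show ?thesis by (simp add: norm_mult)
  qed (simp add: f_def)
  have s1: "Re (1 + s) > 1" using s by simp
  have A: "AE v in lborel. summable (\<lambda>n. norm (f n v))"
  proof (rule AE_I2)
    fix v show "summable (\<lambda>n. norm (f n v))"
      by (rule summable_finite[of "nats_upto (exp v)"]) (use supp in auto)
  qed
  have B: "summable (\<lambda>n. (LINT v|lborel. norm (f n v)))"
    unfolding norm_int by (intro summable_divide summable_norm_mangoldt s1)
  have eq: "(\<lambda>v. \<Sum>n. f n v) = (\<lambda>v. ?M v)"
    using sum by (auto simp: sums_iff)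
  show "integrable lborel (\<lambda>v. ?M v)"
    using integrable_suminf[OF int A B] unfolding eq .
  have "(LINT v|lborel. ?M v) = (\<Sum>n. LINT v|lborel. f n v)"
    using integral_suminf[OF int A B] unfolding eq .
  also have "\<dots> = (\<Sum>n. mangoldt n * of_nat n powr (-(1 + s)) / s)" by (simp add: intf)
  also have "\<dots> = mangoldt_series (1 + s) / s"
    using sums_divide[OF sums_mangoldt_series[OF s1], of s] by (simp add: sums_iff)
  finally show "(LINT v|lborel. ?M v) = mangoldt_series (1 + s) / s" .
qed

text \<open>This is \<open>h\<close> of the overview.\<close>

definition mertens_error :: "real \<Rightarrow> real" where
  "mertens_error y = mertens_sum y - ln y + mertens_const"

lemma mono_mertens_sum_exp: "mono (\<lambda>v. mertens_sum (exp v))"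
  by (intro monoI mertens_sum_mono) simp

lemma borel_measurable_mertens_error_exp [measurable]:
  "(\<lambda>v. mertens_error (exp v)) \<in> borel_measurable borel"
  unfolding mertens_error_def using borel_measurable_mono[OF mono_mertens_sum_exp] by simp

lemma mertens_error_bounded: "y \<ge> 1 \<Longrightarrow> \<bar>mertens_error y\<bar> \<le> 12 + \<bar>mertens_const\<bar>"
  using mertens_sum_bounds[of y] by (simp add: mertens_error_def)

text \<open>The damping makes the bounded error integrable, and it places the Fourier transform at t
  on the vertical line through \<sigma>.\<close>

definition damped_mertens_error :: "real \<Rightarrow> real \<Rightarrow> real" where
  "damped_mertens_error \<sigma> v = indicator {0..} v * (exp (- \<sigma> * v) * mertens_error (exp v))"

lemma damped_mertens_error_bounded:
  assumes "\<sigma> > 0"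
  shows "\<bar>damped_mertens_error \<sigma> v\<bar> \<le> 12 + \<bar>mertens_const\<bar>"
proof (cases "v \<ge> 0")
  case True
  have "exp (- \<sigma> * v) * \<bar>mertens_error (exp v)\<bar> \<le> 1 * (12 + \<bar>mertens_const\<bar>)"
    using True assms by (intro mult_mono mertens_error_bounded) auto
  thus ?thesis using True by (simp add: damped_mertens_error_def abs_mult)
qed (simp add: damped_mertens_error_def)

lemma damped_mertens_error_laplace:
  assumes "\<sigma> > 0"
  shows "integrable lborel (\<lambda>v. iexp (- (t * v)) * complex_of_real (damped_mertens_error \<sigma> v))"
    and "(LINT v|lborel. iexp (- (t * v)) * complex_of_real (damped_mertens_error \<sigma> v)) = mertens_transform (Complex \<sigma> t)"
proof -
  let ?D = "\<lambda>v. iexp (- (t * v)) * complex_of_real (damped_mertens_error \<sigma> v)"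
  let ?s = "Complex \<sigma> t"
  have s: "Re ?s > 0" using assms by simp
  have s0: "?s \<noteq> 0" using assms by (auto simp: complex_eq_iff)
  let ?E = "\<lambda>v. exp (- (?s * complex_of_real v))"
  have e: "?E v = iexp (- (t * v)) * complex_of_real (exp (- \<sigma> * v))" for v
  proof -
    have "- (?s * complex_of_real v) = \<i> * complex_of_real (- (t * v)) + complex_of_real (- \<sigma> * v)"
      by (simp add: complex_eq_iff)
    thus ?thesis by (simp only: exp_add exp_of_real)
  qed
  \<comment> \<open>So the cutoff at v = 0 affects only the terms v and
    \<open>mertens_const\<close>.\<close>
  have neg: "mertens_sum (exp v) = 0" if "v < 0" for v
    using that by (simp add: mertens_sum_def nats_upto_empty)
  have eq: "(?D) =
     (\<lambda>v. of_real (mertens_sum (exp v)) * ?E v - indicator {0..} v *\<^sub>R (of_real v * ?E v)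
        + of_real mertens_const * (indicator {0..} v *\<^sub>R ?E v))"
  proof
    fix v
    show "?D v = of_real (mertens_sum (exp v)) * ?E v
       - indicator {0..} v *\<^sub>R (of_real v * ?E v) + of_real mertens_const * (indicator {0..} v *\<^sub>R ?E v)"
    proof (cases "v < 0")
      case True
      thus ?thesis by (simp add: neg damped_mertens_error_def)
    next
      case False
      thus ?thesis unfolding e by (simp add: damped_mertens_error_def mertens_error_def algebra_simps)
    qed
  qed
  note I = laplace_mertens_sum[OF s] laplace_ident[OF s] laplace_tail[OF s, of 0]
  show "integrable lborel (?D)"
    unfolding eq using I by (intro Bochner_Integration.integrable_add Bochner_Integration.integrable_diff integrable_mult_right)
  have "(LINT v|lborel. ?D v)
      = mangoldt_series (1 + ?s) / ?s - 1 / ?s\<^sup>2 + of_real mertens_const * (exp (- (?s * of_real 0)) / ?s)"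
    unfolding eq using I
    by (simp only: Bochner_Integration.integral_add Bochner_Integration.integral_diff integral_mult_right_zero
          Bochner_Integration.integrable_add Bochner_Integration.integrable_diff integrable_mult_right)
  also have "\<dots> = mertens_transform ?s"
    using s0 by (simp add: mertens_transform_def field_simps power2_eq_square)
  finally show "(LINT v|lborel. ?D v) = mertens_transform ?s" .
qed

lemma damped_mertens_error_integrable:
  assumes "\<sigma> > 0"
  shows "integrable lborel (damped_mertens_error \<sigma>)"
proof -
  have "integrable lborel (\<lambda>v. Re (iexp (- (0 * v)) * complex_of_real (damped_mertens_error \<sigma> v)))"
    by (intro integrable_Re damped_mertens_error_laplace(1)[OF assms])
  thus ?thesis by simp
qed

text \<open>A monotone function has only countably many discontinuities; the cutoff adds the point
  0.\<close>

lemma damped_mertens_error_AE_isCont: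
  assumes "\<sigma> > 0"
  shows "AE v in lborel. isCont (damped_mertens_error \<sigma>) v"
proof -
  let ?D = "{v. \<not> isCont (\<lambda>v. mertens_sum (exp v)) v} \<union> {0}"
  have "countable ?D" using mono_ctble_discont[OF mono_mertens_sum_exp] by simp
  hence "?D \<in> null_sets lborel" by (rule countable_imp_null_set_lborel)
  hence "AE v in lborel. v \<notin> ?D" by (rule AE_not_in)
  thus ?thesis
  proof eventually_elim
    case (elim v)
    hence c: "isCont (\<lambda>v. mertens_sum (exp v)) v" "v \<noteq> 0" by auto
    show ?case
    proof (cases "v > 0")
      case True
      have "isCont (\<lambda>v. exp (- \<sigma> * v) * (mertens_sum (exp v) - v + mertens_const)) v"
        using c by (intro continuous_intros)
      moreover have "eventually (\<lambda>u. u \<in> {0<..}) (nhds v)" using True by (intro eventually_nhds_in_open) auto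
      hence "eventually (\<lambda>u. damped_mertens_error \<sigma> u = exp (- \<sigma> * u) * (mertens_sum (exp u) - u + mertens_const)) (nhds v)"
        by eventually_elim (simp add: damped_mertens_error_def mertens_error_def)
      ultimately show ?thesis by (simp add: isCont_cong)
    next
      case False
      hence "eventually (\<lambda>u. u \<in> {..<0}) (nhds v)" using c by (intro eventually_nhds_in_open) auto
      hence "eventually (\<lambda>u. damped_mertens_error \<sigma> u = 0) (nhds v)"
        by eventually_elim (simp add: damped_mertens_error_def)
      thus ?thesis by (simp add: isCont_cong)
    qed
  qed
qed

lemma integrable_decay: "integrable lborel (\<lambda>t::real. (1 + \<bar>t\<bar>) powr (-3/2))"
proof -
  let ?F = "\<lambda>t::real. - 2 * (1 + t) powr (-1/2)"
  have "set_integrable lborel (einterval 0 \<infinity>) (\<lambda>t::real. (1 + t) powr (-3/2))"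
  proof (rule interval_integral_FTC_nonneg(1)[where F = ?F and A = "-2" and B = 0])
    fix t :: real assume "0 < ereal t"
    hence t: "t > 0" by simp
    show "DERIV ?F t :> (1 + t) powr (-3/2)"
      using t by (auto intro!: derivative_eq_intros)
    show "isCont (\<lambda>t. (1 + t) powr (-3/2)) t" using t by (intro continuous_intros) auto
  next
    have "(?F \<longlongrightarrow> -2 * (1 + 0) powr (-1/2)) (at_right 0)" by (intro tendsto_intros) auto
    thus "((?F \<circ> real_of_ereal) \<longlongrightarrow> -2) (at_right 0)"
      unfolding zero_ereal_def ereal_tendsto_simps by simp
    show "((?F \<circ> real_of_ereal) \<longlongrightarrow> 0) (at_left \<infinity>)"
      unfolding ereal_tendsto_simps by real_asymp
  qed auto
  hence I: "integrable lborel (\<lambda>t::real. indicator {0<..} t *\<^sub>R (1 + t) powr (-3/2))"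
    by (simp add: set_integrable_def zero_ereal_def)
  have I': "integrable lborel (\<lambda>t::real. indicator {0<..} (0 + (-1) * t) *\<^sub>R (1 + (0 + (-1) * t)) powr (-3/2))"
    using lborel_integrable_real_affine[OF I, of "-1" 0] by simp
  have "integrable lborel (\<lambda>t::real. indicator {0<..} t *\<^sub>R (1 + t) powr (-3/2) + indicator {0<..} (0 + (-1) * t) *\<^sub>R (1 + (0 + (-1) * t)) powr (-3/2))"
    by (rule Bochner_Integration.integrable_add[OF I I'])
  moreover have "AE t::real in lborel. indicator {0<..} t *\<^sub>R (1 + t) powr (-3/2) + indicator {0<..} (0 + (-1) * t) *\<^sub>R (1 + (0 + (-1) * t)) powr (-3/2) = (1 + \<bar>t\<bar>) powr (-3/2)"
    using AE_lborel_singleton[of "0::real"] by eventually_elim (auto simp: indicator_def abs_if)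
  ultimately show ?thesis by (subst (asm) integrable_cong_AE) auto
qed

text \<open>With \<sigma> = 1/V the squared damping is at least exp(-2) on [0, V], so removing it
  costs a factor exp 2. The Plancherel bound is uniform in \<sigma>, hence the constant is
  independent of V.\<close>

theorem mertens_error_L2:
  obtains C where "C \<ge> 0" "\<And>V. V \<ge> 1 \<Longrightarrow>
    integrable lborel (\<lambda>v. indicator {0..V} v * (mertens_error (exp v))\<^sup>2) \<and>
    (LINT v|lborel. indicator {0..V} v * (mertens_error (exp v))\<^sup>2) \<le> C"
proof -
  let ?g = "\<lambda>V v. indicator {0..V} v * (mertens_error (exp v))\<^sup>2"
  let ?q = "\<lambda>C t. C * (1 + \<bar>t\<bar>) powr (-3/2)"
  let ?d = "\<lambda>\<sigma> v. (damped_mertens_error \<sigma> v)\<^sup>2"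
  obtain C where C: "C \<ge> 0" "\<And>\<sigma> t. 0 < \<sigma> \<Longrightarrow> \<sigma> \<le> 1 \<Longrightarrow> (norm (mertens_transform (Complex \<sigma> t)))\<^sup>2 \<le> ?q C t"
    using mertens_transform_bound by blast
  define D where "D = exp 2 * ((LINT t|lborel. ?q C t) / (2 * pi))"
  show thesis
  proof (rule that[of D])
    show "D \<ge> 0" unfolding D_def using C(1)
      by (intro mult_nonneg_nonneg divide_nonneg_nonneg integral_nonneg_AE) auto
    fix V :: real assume V: "V \<ge> 1"
    define \<sigma> where "\<sigma> = 1 / V"
    have \<sigma>: "0 < \<sigma>" "\<sigma> \<le> 1" using V by (auto simp: \<sigma>_def)
    let ?B = "12 + \<bar>mertens_const\<bar>"
    have int2: "integrable lborel (\<lambda>v. ?d \<sigma> v)"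
    proof (rule Bochner_Integration.integrable_bound)
      show "integrable lborel (\<lambda>v. ?B * \<bar>damped_mertens_error \<sigma> v\<bar>)"
        by (intro integrable_mult_right integrable_abs damped_mertens_error_integrable \<sigma>)
      show "AE v in lborel. norm (?d \<sigma> v) \<le> norm (?B * \<bar>damped_mertens_error \<sigma> v\<bar>)"
      proof (rule AE_I2)
        fix v
        have "\<bar>damped_mertens_error \<sigma> v\<bar> * \<bar>damped_mertens_error \<sigma> v\<bar> \<le> ?B * \<bar>damped_mertens_error \<sigma> v\<bar>"
          by (intro mult_right_mono damped_mertens_error_bounded \<sigma>) simp
        thus "norm (?d \<sigma> v) \<le> norm (?B * \<bar>damped_mertens_error \<sigma> v\<bar>)"
          by (simp add: power2_eq_square abs_mult)
      qed
      show "(\<lambda>v. ?d \<sigma> v) \<in> borel_measurable lborel"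
        using borel_measurable_integrable[OF damped_mertens_error_integrable[OF \<sigma>(1)]] by measurable
    qed
    have main: "(LINT v|lborel. ?d \<sigma> v) \<le> (LINT t|lborel. ?q C t) / (2 * pi)"
    proof (rule plancherel_inequality[where B = ?B])
      show "(norm (LINT v|lborel. iexp (- (t * v)) * complex_of_real (damped_mertens_error \<sigma> v)))\<^sup>2 \<le> ?q C t" for t
        unfolding damped_mertens_error_laplace(2)[OF \<sigma>(1)] by (rule C(2)[OF \<sigma>])
    qed (intro damped_mertens_error_integrable damped_mertens_error_bounded damped_mertens_error_AE_isCont integrable_mult_right integrable_decay \<sigma>)+
    have pw: "?g V v \<le> exp 2 * ?d \<sigma> v" for v
    proof (cases "v \<in> {0..V}")
      case True
      have "v / V \<le> 1" using True V by simp
      hence "1 \<le> exp 2 * (exp (- \<sigma> * v))\<^sup>2"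
        by (simp add: \<sigma>_def power2_eq_square flip: exp_add)
      hence "1 * (mertens_error (exp v))\<^sup>2 \<le> exp 2 * (exp (- \<sigma> * v))\<^sup>2 * (mertens_error (exp v))\<^sup>2"
        by (rule mult_right_mono) simp
      thus ?thesis using True by (simp add: damped_mertens_error_def power_mult_distrib mult.assoc)
    qed simp
    have nn: "0 \<le> ?g V v" for v by simp
    have "integrable lborel (?g V)"
      by (rule Bochner_Integration.integrable_bound[OF integrable_mult_right[OF int2, of "exp 2"]])
         (use pw nn in \<open>auto intro!: AE_I2 simp: abs_mult\<close>)
    moreover have "(LINT v|lborel. ?g V v) \<le> (LINT v|lborel. exp 2 * ?d \<sigma> v)"
      by (rule integral_mono'[OF integrable_mult_right[OF int2] pw]) simp
    moreover have "(LINT v|lborel. exp 2 * ?d \<sigma> v) \<le> D"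
      unfolding D_def integral_mult_right_zero[of lborel "exp 2"] by (intro mult_left_mono main) simp
    ultimately show "integrable lborel (?g V) \<and>
      (LINT v|lborel. ?g V v) \<le> D" by linarith
  qed
qed

section \<open>From the integral over v to the sum over m\<close>

definition log_cell :: "real \<Rightarrow> nat \<Rightarrow> real set" where
  "log_cell x m = {ln (x / real m)..<ln (x / (real m - 1))}"

text \<open>Lengths comparable to 1/m make the sum with weights 1/m behave like an integral over the
  cells.\<close>

lemma log_cell_length:
  assumes "m \<ge> 2" "x > 0"
  shows "ln (x / (real m - 1)) - ln (x / real m) \<le> 2 / real m"
    and "1 / real m \<le> ln (x / (real m - 1)) - ln (x / real m)"
proof -
  have eq: "ln (x / (real m - 1)) - ln (x / real m) = ln (real m) - ln (real m - 1)"
    using assms by (simp add: ln_div)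
  have "ln (real m) - ln (real m - 1) \<le> (real m - (real m - 1)) / (real m - 1)"
    using assms by (intro ln_diff_le) auto
  also have "\<dots> \<le> 2 / real m" using assms by (simp add: field_simps)
  finally show "ln (x / (real m - 1)) - ln (x / real m) \<le> 2 / real m" unfolding eq .
  have "ln (real m - 1) - ln (real m) \<le> ((real m - 1) - real m) / real m"
    using assms by (intro ln_diff_le) auto
  thus "1 / real m \<le> ln (x / (real m - 1)) - ln (x / real m)" unfolding eq by simp
qed

lemma log_cell_subset:
  assumes "m \<ge> 2" "real m \<le> x"
  shows "log_cell x m \<subseteq> {0..ln x}"
proof
  fix v assume v: "v \<in> log_cell x m"
  have "0 \<le> ln (x / real m)" using assms by simp
  moreover have "ln (x / (real m - 1)) \<le> ln x" using assms by (simp add: field_simps)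
  ultimately show "v \<in> {0..ln x}" using v by (auto simp: log_cell_def)
qed

lemma disjoint_log_cells:
  assumes "\<And>m. m \<in> M \<Longrightarrow> m \<ge> 2" "x > 0"
  shows "disjoint_family_on (log_cell x) M"
proof -
  have *: "log_cell x m \<inter> log_cell x n = {}" if mn: "m \<ge> 2" "m < n" for m n
  proof -
    have "x / (real n - 1) \<le> x / real m" using mn assms(2) by (intro divide_left_mono) auto
    hence "ln (x / (real n - 1)) \<le> ln (x / real m)" using mn assms(2) by (subst ln_le_cancel_iff) auto
    thus ?thesis by (auto simp: log_cell_def)
  qed
  show ?thesis unfolding disjoint_family_on_def
  proof (intro ballI impI)
    fix m n assume "m \<in> M" "n \<in> M" "m \<noteq> n"
    thus "log_cell x m \<inter> log_cell x n = {}"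
      using *[of m n] *[of n m] assms(1) by (cases "m < n") (auto simp: Int_commute)
  qed
qed

lemma mertens_error_increment:
  assumes "0 < y" "y \<le> z"
  shows "mertens_error z \<ge> mertens_error y - (ln z - ln y)"
  using mertens_sum_mono[OF assms(2)] by (simp add: mertens_error_def)

lemma square_le_of_close:
  assumes "0 \<le> (a::real)" "a \<le> b + d" "0 \<le> d" 
  shows "a\<^sup>2 \<le> 2 * b\<^sup>2 + 2 * d\<^sup>2"
proof -
  have "a\<^sup>2 \<le> (\<bar>b\<bar> + d)\<^sup>2" using assms by (intro power_mono) auto
  also have "\<dots> \<le> 2 * \<bar>b\<bar>\<^sup>2 + 2 * d\<^sup>2" using zero_le_power2[of "\<bar>b\<bar> - d"] by (simp add: power2_sum power2_diff)
  finally show ?thesis by simp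
qed

text \<open>The error increases up to a logarithm. If it is nonnegative at a point, it is nearly as large to the right of that point, and if it is negative, nearly as small to the left.\<close>

lemma mertens_error_sq_le_cells:
  assumes m: "m \<ge> 2" "real m + 1 \<le> x"
  obtains n where "n = m \<or> n = m + 1"
    "\<And>v. v \<in> log_cell x n \<Longrightarrow> (mertens_error (x / real m))\<^sup>2 \<le> 2 * (mertens_error (exp v))\<^sup>2 + 2 * (2 / real m)\<^sup>2"
proof (cases "mertens_error (x / real m) \<ge> 0")
  case True
  have x: "x > 0" using m by simp
  show ?thesis
  proof (rule that[of m])
    fix v assume v: "v \<in> log_cell x m"
    hence "ln (x / real m) \<le> v" "v - ln (x / real m) \<le> 2 / real m"
      using log_cell_length(1)[OF m(1) x] by (auto simp: log_cell_def)
    moreover have "exp (ln (x / real m)) \<le> exp v" using calculation by simp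
    hence "x / real m \<le> exp v" using x m by simp
    from mertens_error_increment[OF _ this] have "mertens_error (exp v) \<ge> mertens_error (x / real m) - (v - ln (x / real m))"
      using x m by simp
    ultimately have "mertens_error (x / real m) \<le> mertens_error (exp v) + 2 / real m" by linarith
    thus "(mertens_error (x / real m))\<^sup>2 \<le> 2 * (mertens_error (exp v))\<^sup>2 + 2 * (2 / real m)\<^sup>2"
      using True by (intro square_le_of_close) auto
  qed simp
next
  case False
  have x: "x > 0" using m by simp
  show ?thesis
  proof (rule that[of "m + 1"])
    fix v assume v: "v \<in> log_cell x (m + 1)"
    have "ln (x / (real (m + 1) - 1)) - ln (x / real (m + 1)) \<le> 2 / real (m + 1)"
      using m x by (intro log_cell_length) auto
    also have "\<dots> \<le> 2 / real m" using m by (intro divide_left_mono) auto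
    finally have "v \<le> ln (x / real m)" "ln (x / real m) - v \<le> 2 / real m"
      using v by (auto simp: log_cell_def)
    moreover have "exp v \<le> exp (ln (x / real m))" using calculation by simp
    hence "exp v \<le> x / real m" using x m by simp
    from mertens_error_increment[OF _ this] have "mertens_error (x / real m) \<ge> mertens_error (exp v) - (ln (x / real m) - v)"
      by simp
    ultimately have "- mertens_error (x / real m) \<le> - mertens_error (exp v) + 2 / real m" by linarith
    hence "(- mertens_error (x / real m))\<^sup>2 \<le> 2 * (- mertens_error (exp v))\<^sup>2 + 2 * (2 / real m)\<^sup>2"
      using False by (intro square_le_of_close) auto
    thus "(mertens_error (x / real m))\<^sup>2 \<le> 2 * (mertens_error (exp v))\<^sup>2 + 2 * (2 / real m)\<^sup>2" by simp
  qed simp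
qed

text \<open>A Riemann sum argument: each term is compared with the integral over its own cell or the
  next one, and the disjoint cells fit into [0, ln x].\<close>

theorem sum_mertens_error_sq_bounded:
  obtains C where "C \<ge> 0" "\<And>x. x > 1 \<Longrightarrow> ln x \<ge> 1 \<Longrightarrow> (\<Sum>m\<in>nats_upto x. (mertens_error (x / real m))\<^sup>2 / real m) \<le> C"
proof -
  obtain C where C: "C \<ge> 0" "\<And>V. V \<ge> 1 \<Longrightarrow>
    integrable lborel (\<lambda>v. indicator {0..V} v * (mertens_error (exp v))\<^sup>2) \<and>
    (LINT v|lborel. indicator {0..V} v * (mertens_error (exp v))\<^sup>2) \<le> C"
    using mertens_error_L2 by blast
  define B where "B = (12 + \<bar>mertens_const\<bar>)\<^sup>2"
  define S where "S = (\<Sum>n. 1 / real n ^ 2)"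
  have S: "(\<Sum>m\<in>A. 1 / real m ^ 2) \<le> S" if "finite A" for A
    unfolding S_def using that inverse_power_summable[of 2, where 'a = real] by (intro sum_le_suminf) (auto simp: inverse_eq_divide)
  have S0: "S \<ge> 0" using S[of "{}"] by simp
  show thesis
  proof (rule that[of "4 * B + (8 * C + 32 * S)"])
    show "4 * B + (8 * C + 32 * S) \<ge> 0" using C(1) S0 by (simp add: B_def)
    fix x :: real assume x1: "x > 1" and lnx: "ln x \<ge> 1"
    have x: "x > 2"
    proof (rule ccontr)
      assume "\<not> x > 2"
      hence "ln x \<le> ln 2" using x1 by simp
      thus False using lnx ln_2_less_1 by linarith
    qed
    let ?h = "mertens_error" and ?g = "\<lambda>v. (mertens_error (exp v))\<^sup>2"
    have hB: "(?h (x / real m))\<^sup>2 \<le> B" if "m \<in> nats_upto x" for m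
    proof -
      have "\<bar>?h (x / real m)\<bar> \<le> 12 + \<bar>mertens_const\<bar>"
        using that by (intro mertens_error_bounded) (auto simp: nats_upto_iff)
      hence "\<bar>?h (x / real m)\<bar>\<^sup>2 \<le> B" unfolding B_def by (intro power_mono) auto
      thus ?thesis by simp
    qed
    define \<Phi> where "\<Phi> = (\<lambda>m. LINT v|lborel. indicator (log_cell x m) v * ?g v)"
    have cell_meas [measurable]: "log_cell x m \<in> sets borel" for m by (simp add: log_cell_def)
    have Gi: "integrable lborel (\<lambda>v. indicator {0..ln x} v * ?g v)" using C(2)[OF lnx] by simp
    have \<Phi>_int: "integrable lborel (\<lambda>v. indicator (log_cell x m) v * ?g v)" if "m \<ge> 2" "real m \<le> x" for m
    proof (rule Bochner_Integration.integrable_bound[OF Gi])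
      show "AE v in lborel. norm (indicator (log_cell x m) v * ?g v) \<le> norm (indicator {0..ln x} v * ?g v)"
        using log_cell_subset[OF that] by (intro AE_I2) (auto simp: indicator_def)
    qed measurable
    have \<Phi>_nn: "\<Phi> m \<ge> 0" for m unfolding \<Phi>_def by (intro integral_nonneg_AE) auto
    have \<Phi>_sum: "(\<Sum>m\<in>M. \<Phi> m) \<le> C" if M: "finite M" "\<And>m. m \<in> M \<Longrightarrow> m \<ge> 2 \<and> real m \<le> x" for M
    proof -
      have "(\<Sum>m\<in>M. \<Phi> m) = (LINT v|lborel. (\<Sum>m\<in>M. indicator (log_cell x m) v * ?g v))"
        unfolding \<Phi>_def using M \<Phi>_int by (subst Bochner_Integration.integral_sum) auto
      also have "\<dots> \<le> (LINT v|lborel. indicator {0..ln x} v * ?g v)"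
      proof (rule integral_mono'[OF Gi])
        fix v
        have "(\<Sum>m\<in>M. indicator (log_cell x m) v :: real) = indicator (\<Union>m\<in>M. log_cell x m) v"
          using M x by (intro indicator_UN_disjoint[symmetric] disjoint_log_cells) auto
        also have "\<dots> \<le> indicator {0..ln x} v" 
        proof -
          have "(\<Union>m\<in>M. log_cell x m) \<subseteq> {0..ln x}" using log_cell_subset M(2) by blast
          thus ?thesis by (auto simp: indicator_def)
        qed
        finally show "(\<Sum>m\<in>M. indicator (log_cell x m) v * ?g v) \<le> indicator {0..ln x} v * ?g v"
          unfolding sum_distrib_right[symmetric] by (intro mult_right_mono) auto
      qed simp
      also have "\<dots> \<le> C" using C(2)[OF lnx] by simp
      finally show ?thesis .
    qed
    \<comment> \<open>The cell has length between 1/(2m) and 2/m. Integrating the pointwise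
      comparison and multiplying by 2 gives the factor 4 and an error 32/m^3 \<le> 32/m^2.\<close>
    have single: "(?h (x / real m))\<^sup>2 / real m \<le> 4 * (\<Phi> m + \<Phi> (m + 1)) + 32 * (1 / real m ^ 2)"
      if m: "m \<ge> 2" "real m + 1 \<le> x" for m
    proof -
      obtain n where n: "n = m \<or> n = m + 1" "\<And>v. v \<in> log_cell x n \<Longrightarrow> (?h (x / real m))\<^sup>2 \<le> 2 * ?g v + 2 * (2 / real m)\<^sup>2"
        using mertens_error_sq_le_cells[OF m] by blast
      let ?q = "2 * (2 / real m)\<^sup>2"
      let ?r = "\<lambda>v. 2 * (indicator (log_cell x n) v * ?g v) + indicator (log_cell x n) v * ?q"
      define H where "H = (?h (x / real m))\<^sup>2"
      define len where "len = ln (x / (real n - 1)) - ln (x / real n)"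
      have n2: "n \<ge> 2" "real n \<le> x" using n m by auto
      have len: "len \<le> 2 / real n" "1 / real n \<le> len" "len \<ge> 0"
        using log_cell_length[OF n2(1), of x] x unfolding len_def by (auto intro: order.trans[of _ "1 / real n"])
      have len2: "len \<le> 2 / real m" "1 / (2 * real m) \<le> len"
      proof -
        have "2 / real n \<le> 2 / real m" using n m by (intro divide_left_mono) auto
        with len show "len \<le> 2 / real m" by linarith
        have "1 / (2 * real m) \<le> 1 / real n" using n m by (intro divide_left_mono) auto
        with len show "1 / (2 * real m) \<le> len" by linarith
      qed
      have meas: "measure lborel (log_cell x n) = len"
        using len(3) by (simp add: log_cell_def len_def)
      have ind_int: "integrable lborel (\<lambda>v. indicator (log_cell x n) v * c)" for c :: real
        using len(3)
        by (intro integrable_mult_left integrable_real_indicator) (simp_all add: log_cell_def len_def)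
      have "H * len = (LINT v|lborel. indicator (log_cell x n) v * H)" by (simp add: meas)
      also have "\<dots> \<le> (LINT v|lborel. ?r v)"
      proof (rule integral_mono')
        show "integrable lborel (\<lambda>v. ?r v)"
          by (intro Bochner_Integration.integrable_add integrable_mult_right \<Phi>_int n2 ind_int)
        fix v
        show "indicator (log_cell x n) v * H \<le> ?r v"
          using n(2)[of v] by (auto simp: indicator_def H_def)
      qed (auto simp: indicator_def)
      also have "\<dots> = 2 * \<Phi> n + len * (?q)"
        unfolding \<Phi>_def using \<Phi>_int[OF n2] ind_int by (subst Bochner_Integration.integral_add) (auto simp: meas)
      also have "len * (?q) \<le> (2 / real m) * (?q)"
        using len2 by (intro mult_right_mono) auto
      also have "H * (1 / (2 * real m)) \<le> H * len" using len2 by (intro mult_left_mono) (auto simp: H_def)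
      finally have "H / real m \<le> 4 * \<Phi> n + 32 * (1 / real m ^ 2 * (1 / real m))"
        by (simp add: field_simps eval_nat_numeral)
      also have "1 / real m ^ 2 * (1 / real m) \<le> 1 / real m ^ 2 * 1" using m by (intro mult_left_mono) auto
      also have "\<Phi> n \<le> \<Phi> m + \<Phi> (m + 1)" using n(1) \<Phi>_nn[of m] \<Phi>_nn[of "m + 1"] by auto
      finally show ?thesis by (simp add: H_def)
    qed
    \<comment> \<open>The first m is left out because x / (m - 1) degenerates there, and m > x/2 so
      that m + 1 \<le> x holds for the rest. At most x terms lie above x/2, each at most 2
      B/x.\<close>
    define M where "M = {m \<in> nats_upto x. 2 \<le> m \<and> real m \<le> x / 2}"
    have Mf: "finite M" by (simp add: M_def)
    let ?f = "\<lambda>m. (?h (x / real m))\<^sup>2 / real m"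
    define U where "U = {m \<in> nats_upto x. x / 2 < real m}"
    have "(\<Sum>m\<in>nats_upto x. ?f m) \<le> (\<Sum>m\<in>{1} \<union> (U \<union> M). ?f m)"
      unfolding M_def U_def by (intro sum_mono2) (simp_all, auto simp: nats_upto_iff)
    also have "\<dots> \<le> (\<Sum>m\<in>{1}. ?f m) + ((\<Sum>m\<in>U. ?f m) + (\<Sum>m\<in>M. ?f m))"
    proof -
      have le: "sum ?f (A \<union> A') \<le> sum ?f A + sum ?f A'" if "finite A" "finite A'" for A A'
        using sum.union_inter[OF that, of ?f] sum_nonneg[of "A \<inter> A'" ?f] by simp
      have "sum ?f ({1} \<union> (U \<union> M)) \<le> sum ?f {1} + sum ?f (U \<union> M)" by (rule le) (auto simp: U_def M_def)
      also have "sum ?f (U \<union> M) \<le> sum ?f U + sum ?f M" by (rule le) (auto simp: U_def M_def)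
      finally show ?thesis by simp
    qed
    also have "(\<Sum>m\<in>{1}. ?f m) \<le> B" using hB[of 1] x by (simp add: nats_upto_iff)
    also have "(\<Sum>m\<in>U. ?f m) \<le> 2 * B"
    proof -
      have "(\<Sum>m\<in>U. ?f m) \<le> (\<Sum>m\<in>U. B * (2 / x))"
      proof (rule sum_mono)
        fix m assume m: "m \<in> U"
        have "?f m \<le> B / (x / 2)" using m x by (intro frac_le hB) (auto simp: U_def B_def)
        thus "?f m \<le> B * (2 / x)" by simp
      qed
      also have "\<dots> = real (card U) * (B * (2 / x))" by simp
      also have "\<dots> \<le> x * (B * (2 / x))"
      proof (rule mult_right_mono)
        have "card U \<le> card (nats_upto x)" by (intro card_mono) (auto simp: U_def)
        hence "real (card U) \<le> real (card (nats_upto x))" by simp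
        also have "\<dots> \<le> x" using x by (subst card_nats_upto) auto
        finally show "real (card U) \<le> x" .
      qed (use x in \<open>auto simp: B_def\<close>)
      also have "\<dots> = 2 * B" using x by simp
      finally show ?thesis .
    qed
    also have "(\<Sum>m\<in>M. ?f m) \<le> 8 * C + 32 * S"
    proof -
      have Mx: "m \<ge> 2 \<and> real m + 1 \<le> x" if "m \<in> M" for m using that x by (auto simp: M_def)
      have "(\<Sum>m\<in>M. ?f m) \<le> (\<Sum>m\<in>M. 4 * (\<Phi> m + \<Phi> (m + 1)) + 32 * (1 / real m ^ 2))"
        using single Mx by (intro sum_mono) auto
      also have "\<dots> = 4 * ((\<Sum>m\<in>M. \<Phi> m) + (\<Sum>m\<in>M. \<Phi> (m + 1))) + 32 * (\<Sum>m\<in>M. 1 / real m ^ 2)"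
        by (simp add: sum.distrib sum_distrib_left)
      also have "(\<Sum>m\<in>M. \<Phi> m) \<le> C" using Mf Mx by (intro \<Phi>_sum) fastforce+
      also have "(\<Sum>m\<in>M. \<Phi> (m + 1)) = (\<Sum>m\<in>(\<lambda>m. m + 1) ` M. \<Phi> m)" by (subst sum.reindex) auto
      also have "\<dots> \<le> C" using Mf Mx by (intro \<Phi>_sum) fastforce+
      also have "(\<Sum>m\<in>M. 1 / real m ^ 2) \<le> S" by (rule S[OF Mf])
      finally show ?thesis by simp
    qed
    finally show "(\<Sum>m\<in>nats_upto x. ?f m) \<le> 4 * B + (8 * C + 32 * S)"
      using zero_le_power2[of "12 + \<bar>mertens_const\<bar>"] unfolding B_def by linarith
  qed
qed

section \<open>The fractional part sum\<close>

text \<open>Such a d is a prime not dividing m, and some prime factor of m is at most d. So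
  multiplication by d keeps the smallest prime factor, raises \<open>omega\<close> by one and flips
  the sign of the Moebius function.\<close>

lemma moebius_weight_prime_mult:
  assumes m: "m > 0" and nex: "\<not> exceptional d m"
  shows "moebius_weight i 0 j l (d * m) = - moebius_weight i 1 j l m"
proof -
  have d: "prime d" "\<not> d dvd m" "m \<noteq> 1" and nr: "m \<notin> rough d" using nex by (auto simp: exceptional_def)
  have m2: "m \<ge> 2" "d * m \<ge> 2" using m d prime_ge_2_nat[OF d(1)] by (auto intro: order.trans[of 2 d])
  obtain p where p: "prime p" "p dvd m" "p \<le> d" using nr m by (auto simp: rough_def not_less)
  have pf: "prime_factors (d * m) = insert d (prime_factors m)"
    using m d by (simp add: prime_factors_product prime_prime_factors prime_gt_0_nat)
  have notin: "d \<notin> prime_factors m" using d by auto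
  have pin: "p \<in> prime_factors m" using p m by (simp add: prime_factors_dvd)
  hence ne: "prime_factors m \<noteq> {}" by auto
  have om: "omega (d * m) = omega m + 1" unfolding omega_def pf using notin by simp
  have "Min (prime_factors m) \<le> p" using pin by simp
  hence "Min (prime_factors m) \<le> d" using p by simp
  moreover have "Min (insert d (prime_factors m)) = min d (Min (prime_factors m))"
    using ne by (intro Min_insert) auto
  ultimately have lpf: "least_prime_factor (d * m) = least_prime_factor m"
    unfolding least_prime_factor_def pf by (simp only: min_absorb2)
  have "coprime d m" using d by (simp add: prime_imp_coprime)
  hence "squarefree (d * m) \<longleftrightarrow> squarefree m"
    using d by (auto dest: squarefree_multD intro: squarefree_mult_coprime squarefree_prime)
  hence "moebius_mu (d * m) = - moebius_mu m" by (simp add: moebius_mu_def om)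
  thus ?thesis using m2 by (simp add: moebius_weight_def lpf om)
qed

text \<open>For exceptional pairs size is all that matters: a prime power brings in at most one new
  prime.\<close>

lemma abs_moebius_weight_primepow_mult_le:
  assumes "m > 0" "mangoldt d \<noteq> (0::real)"
  shows "\<bar>moebius_weight i 0 j l (d * m)\<bar> \<le> real (omega m + 1) ^ i"
proof -
  have "primepow d" using assms by (auto simp: mangoldt_def split: if_splits)
  then obtain p a where pa: "prime p" "a > 0" "d = p ^ a" by (auto simp: primepow_def)
  have "prime_factors (d * m) = insert p (prime_factors m)"
    using pa assms by (simp add: prime_factors_product prime_factors_power prime_prime_factors prime_gt_0_nat)
  hence "omega (d * m) \<le> omega m + 1" unfolding omega_def by (simp add: card_insert_if)
  hence "real (omega (d * m) + 0) ^ i \<le> real (omega m + 1) ^ i" by (intro power_mono) auto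
  with abs_moebius_weight_le[of i 0 j l "d * m"] show ?thesis by linarith
qed

lemma inner_sum_approx:
  assumes "m > 0"
  shows "\<bar>(\<Sum>d\<in>nats_upto (x / real m). mangoldt d * (moebius_weight i 0 j l (d * m) * frac (x / real (d * m))))
           + moebius_weight i 1 j l m * frac_mangoldt_sum (x / real m)\<bar>
         \<le> 2 * real (omega m + 1) ^ i * exceptional_mass x m"
proof -
  let ?F = "\<lambda>d. moebius_weight i 0 j l (d * m)" and ?g = "moebius_weight i 1 j l m"
  have "(\<Sum>d\<in>nats_upto (x / real m). mangoldt d * (?F d * frac (x / real (d * m)))) + ?g * frac_mangoldt_sum (x / real m)
     = (\<Sum>d\<in>nats_upto (x / real m). mangoldt d * ((?F d + ?g) * frac (x / real (d * m))))"
    unfolding frac_mangoldt_sum_def sum_distrib_left sum.distrib[symmetric]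
    by (intro sum.cong refl) (simp add: algebra_simps divide_divide_eq_left')
  also have "\<dots> = (\<Sum>d | d \<in> nats_upto (x / real m) \<and> exceptional d m. mangoldt d * ((?F d + ?g) * frac (x / real (d * m))))"
    using moebius_weight_prime_mult[OF assms, of _ i j l] by (intro sum.mono_neutral_right) auto
  finally have eq: "(\<Sum>d\<in>nats_upto (x / real m). mangoldt d * (?F d * frac (x / real (d * m)))) + ?g * frac_mangoldt_sum (x / real m)
     = (\<Sum>d | d \<in> nats_upto (x / real m) \<and> exceptional d m. mangoldt d * ((?F d + ?g) * frac (x / real (d * m))))" .
  show ?thesis unfolding eq exceptional_mass_def sum_distrib_left
  proof (rule order.trans[OF sum_abs], rule sum_mono)
    fix d
    show "\<bar>mangoldt d * ((?F d + ?g) * frac (x / real (d * m)))\<bar> \<le> 2 * real (omega m + 1) ^ i * mangoldt d"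
    proof (cases "mangoldt d = (0::real)")
      case False
      have "\<bar>?F d + ?g\<bar> \<le> 2 * real (omega m + 1) ^ i"
        using abs_moebius_weight_primepow_mult_le[OF assms False, of i j l] abs_moebius_weight_le[of i 1 j l m] by linarith
      hence "\<bar>?F d + ?g\<bar> * frac (x / real (d * m)) \<le> 2 * real (omega m + 1) ^ i * 1"
        by (intro mult_mono) (auto intro: less_imp_le[OF frac_lt_1])
      hence "mangoldt d * (\<bar>?F d + ?g\<bar> * frac (x / real (d * m))) \<le> mangoldt d * (2 * real (omega m + 1) ^ i)"
        by (intro mult_left_mono mangoldt_nonneg) simp
      thus ?thesis by (simp add: abs_mult mult_ac)
    qed simp
  qed
qed

text \<open>Only Stirling's error 1 + ln y remains. The form sqrt y suits the Cauchy-Schwarz step,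
  where m * (sqrt(x/m))^2 = x sums to at most x^2.\<close>

lemma frac_mangoldt_sum_approx:
  assumes "y \<ge> 1"
  shows "\<bar>frac_mangoldt_sum y - ((1 - mertens_const) * y + y * mertens_error y)\<bar> \<le> 3 * sqrt y"
proof -
  have e: "frac_mangoldt_sum y - ((1 - mertens_const) * y + y * mertens_error y) = y * ln y - y - log_factorial y"
    using frac_mangoldt_sum_eq[of y] assms by (simp add: mertens_error_def algebra_simps)
  have "ln y \<le> 2 * sqrt y" using assms by (intro ln_le_2_sqrt) auto
  moreover have "1 \<le> sqrt y" using assms by simp
  moreover have "ln y \<ge> 0" using assms by simp
  ultimately show ?thesis using log_factorial_bounds[OF assms] unfolding e by linarith
qed

text \<open>The floor counts the multiples of m, so the sum is a sum over n of the divisor sums of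
  the weight, each O(\<open>omega n\<close>). This is the elementary treatment of the main
  term.\<close>

lemma abs_sum_moebius_weight_floor_le:
  assumes x: "x \<ge> 0" and i: "i \<ge> 1"
  shows "\<bar>\<Sum>m\<in>nats_upto x. moebius_weight i 1 j l m * of_int \<lfloor>x / real m\<rfloor>\<bar>
    \<le> 2 ^ i * (real i + 2) ^ i * (\<Sum>m\<in>nats_upto x. real (omega m + 1) ^ i)"
proof -
  let ?g = "moebius_weight i 1 j l"
  have "(\<Sum>m\<in>nats_upto x. ?g m * of_int \<lfloor>x / real m\<rfloor>) = (\<Sum>m\<in>nats_upto x. \<Sum>d\<in>nats_upto (x / real m). ?g m)"
    using x by (intro sum.cong refl) (simp add: card_nats_upto mult.commute)
  also have "\<dots> = (\<Sum>d\<in>nats_upto x. \<Sum>m\<in>nats_upto (x / real d). ?g m)" by (rule sum_nats_upto_swap)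
  also have "\<dots> = (\<Sum>n\<in>nats_upto x. \<Sum>m | m dvd n. ?g m)"
    by (rule sum_divisors_swap[of "\<lambda>m d. ?g m", symmetric])
  finally have eq: "(\<Sum>m\<in>nats_upto x. ?g m * of_int \<lfloor>x / real m\<rfloor>) = (\<Sum>n\<in>nats_upto x. \<Sum>m | m dvd n. ?g m)" .
  show ?thesis unfolding eq sum_distrib_left
  proof (rule order.trans[OF sum_abs], rule sum_mono)
    fix n assume n: "n \<in> nats_upto x"
    have "real (omega n) \<le> real (omega n + 1) ^ 1" by simp
    also have "\<dots> \<le> real (omega n + 1) ^ i" using i by (intro power_increasing) auto
    finally have up: "2 ^ i * (real i + 2) ^ i * real (omega n) \<le> 2 ^ i * (real i + 2) ^ i * real (omega n + 1) ^ i"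
      by (intro mult_left_mono) auto
    have e: "real i + 1 + real 1 = real i + 2" by simp
    have "\<bar>\<Sum>m | m dvd n. ?g m\<bar> \<le> 2 ^ i * (real i + 1 + real 1) ^ i * real (omega n)"
      using n by (intro abs_sum_divisors_moebius_weight_le) (auto simp: nats_upto_iff)
    thus "\<bar>\<Sum>m | m dvd n. ?g m\<bar> \<le> 2 ^ i * (real i + 2) ^ i * real (omega n + 1) ^ i"
      unfolding e using up by (rule order.trans)
  qed
qed

section \<open>Decomposition after inserting the logarithm\<close>

definition frac_sum :: "nat \<Rightarrow> nat \<Rightarrow> nat \<Rightarrow> real \<Rightarrow> real" where
  "frac_sum i j l x = (\<Sum>n\<in>nats_upto x. moebius_weight i 0 j l n * frac (x / real n))"

text \<open>Here ln x = ln(x/n) + ln n. In K, 5 = 2 + 3 collects ln(x/n) \<le> 2 sqrt(x/n) and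
  Stirling's error; the rest comes from the main term, with one unit for replacing x/m by its
  floor.\<close>

lemma ln_mult_frac_sum_le:
  assumes x: "x \<ge> 1" and i: "i \<ge> 1"
  defines "K \<equiv> 5 + \<bar>1 - mertens_const\<bar> * (2 ^ i * (real i + 2) ^ i + 1)"
  shows "\<bar>ln x * frac_sum i j l x\<bar> \<le> (\<Sum>m\<in>nats_upto x. real (omega m + 1) ^ i *
    (K * sqrt (x / real m) + 2 * exceptional_mass x m + x / real m * \<bar>mertens_error (x / real m)\<bar>))"
proof -
  let ?U = "nats_upto x" and ?F = "moebius_weight i 0 j l" and ?g = "moebius_weight i 1 j l"
  let ?P = "\<lambda>m. real (omega m + 1) ^ i" and ?h = mertens_error and ?b = mertens_const
  define Q where "Q = 2 ^ i * (real i + 2) ^ i"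
  have xm: "x / real m \<ge> 1" "m > 0" if "m \<in> ?U" for m using that by (auto simp: nats_upto_iff)
  \<comment> \<open>\<open>T1\<close> carries ln(x/n), \<open>R\<close> the exceptional pairs,
    \<open>E\<close> Stirling's error and \<open>H\<close> the error \<open>h\<close>;
    \<open>G\<close> and \<open>G'\<close> are the main term with x/m split into floor and
    fractional part.\<close>
  define T1 where "T1 = (\<Sum>n\<in>?U. ?F n * frac (x / real n) * ln (x / real n))"
  define R where "R = (\<Sum>m\<in>?U. (\<Sum>d\<in>nats_upto (x / real m). mangoldt d * (?F (d * m) * frac (x / real (d * m)))) + ?g m * frac_mangoldt_sum (x / real m))"
  define E where "E = (\<Sum>m\<in>?U. ?g m * (frac_mangoldt_sum (x / real m) - ((1 - ?b) * (x / real m) + x / real m * ?h (x / real m))))"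
  define H where "H = (\<Sum>m\<in>?U. ?g m * (x / real m * ?h (x / real m)))"
  define G where "G = (\<Sum>m\<in>?U. ?g m * of_int \<lfloor>x / real m\<rfloor>)"
  define G' where "G' = (\<Sum>m\<in>?U. ?g m * frac (x / real m))"
  have "ln x * frac_sum i j l x = (\<Sum>n\<in>?U. ?F n * frac (x / real n) * ln (x / real n) + ?F n * frac (x / real n) * ln (real n))"
    unfolding frac_sum_def sum_distrib_left using x
    by (intro sum.cong refl) (auto simp: nats_upto_iff ln_div algebra_simps)
  also have "\<dots> = T1 + (\<Sum>n\<in>?U. ?F n * frac (x / real n) * ln (real n))" by (simp add: sum.distrib T1_def)
  also have "(\<Sum>n\<in>?U. ?F n * frac (x / real n) * ln (real n)) = (\<Sum>n\<in>?U. \<Sum>d | d dvd n. mangoldt d * (?F (d * (n div d)) * frac (x / real (d * (n div d)))))"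
  proof (rule sum.cong[OF refl])
    fix n assume n: "n \<in> ?U"
    have "?F n * frac (x / real n) * ln (real n) = (\<Sum>d | d dvd n. ?F n * frac (x / real n) * mangoldt d)"
      using mangoldt_sum[of n, where ?'a = real] n by (simp add: nats_upto_iff sum_distrib_left[symmetric])
    also have "\<dots> = (\<Sum>d | d dvd n. mangoldt d * (?F (d * (n div d)) * frac (x / real (d * (n div d)))))"
      by (intro sum.cong refl) simp
    finally show "?F n * frac (x / real n) * ln (real n) = (\<Sum>d | d dvd n. mangoldt d * (?F (d * (n div d)) * frac (x / real (d * (n div d)))))" .
  qed
  also have "\<dots> = (\<Sum>m\<in>?U. \<Sum>d\<in>nats_upto (x / real m). mangoldt d * (?F (d * m) * frac (x / real (d * m))))"
    by (rule sum_divisors_swap)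
  also have "\<dots> = R - (\<Sum>m\<in>?U. ?g m * frac_mangoldt_sum (x / real m))"
    unfolding R_def by (simp add: sum.distrib)
  also have "(\<Sum>m\<in>?U. ?g m * frac_mangoldt_sum (x / real m)) = E + H + (1 - ?b) * (G + G')"
    unfolding E_def H_def G_def G'_def sum.distrib[symmetric] sum_distrib_left
    by (intro sum.cong refl) (simp add: frac_def algebra_simps)
  finally have main: "ln x * frac_sum i j l x = T1 + (R - (E + H + (1 - ?b) * (G + G')))" .
  have T1: "\<bar>T1\<bar> \<le> (\<Sum>m\<in>?U. ?P m * (2 * sqrt (x / real m)))"
    unfolding T1_def
  proof (rule order.trans[OF sum_abs], rule sum_mono)
    fix n assume n: "n \<in> ?U"
    have "\<bar>?F n\<bar> \<le> ?P n" using abs_moebius_weight_le[of i 0 j l n] power_mono[of "real (omega n)" "real (omega n + 1)" i] by simp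
    hence "\<bar>?F n\<bar> * frac (x / real n) \<le> ?P n * 1" by (intro mult_mono) (auto intro: less_imp_le[OF frac_lt_1])
    moreover have "ln (x / real n) \<le> 2 * sqrt (x / real n)" using xm[OF n] by (intro ln_le_2_sqrt) linarith
    moreover have "ln (x / real n) \<ge> 0" using xm[OF n] by simp
    ultimately have "\<bar>?F n\<bar> * frac (x / real n) * ln (x / real n) \<le> ?P n * 1 * (2 * sqrt (x / real n))"
      by - (rule mult_mono, auto)
    thus "\<bar>?F n * frac (x / real n) * ln (x / real n)\<bar> \<le> ?P n * (2 * sqrt (x / real n))"
      using \<open>ln (x / real n) \<ge> 0\<close> by (simp add: abs_mult)
  qed
  have R: "\<bar>R\<bar> \<le> (\<Sum>m\<in>?U. ?P m * (2 * exceptional_mass x m))"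
    unfolding R_def
  proof (rule order.trans[OF sum_abs], rule sum_mono)
    fix m assume m: "m \<in> ?U"
    show "\<bar>(\<Sum>d\<in>nats_upto (x / real m). mangoldt d * (?F (d * m) * frac (x / real (d * m)))) + ?g m * frac_mangoldt_sum (x / real m)\<bar> \<le> ?P m * (2 * exceptional_mass x m)"
      using inner_sum_approx[OF xm(2)[OF m], where x = x and i = i and j = j and l = l] by (simp add: mult_ac)
  qed
  have gP: "\<bar>?g m * y\<bar> \<le> ?P m * z" if "\<bar>y\<bar> \<le> z" for m y z
    unfolding abs_mult using that abs_moebius_weight_le[of i 1 j l m] by (intro mult_mono) auto
  have E: "\<bar>E\<bar> \<le> (\<Sum>m\<in>?U. ?P m * (3 * sqrt (x / real m)))"
    unfolding E_def
    by (rule order.trans[OF sum_abs], rule sum_mono, rule gP, rule frac_mangoldt_sum_approx) (rule xm)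
  have H: "\<bar>H\<bar> \<le> (\<Sum>m\<in>?U. ?P m * (x / real m * \<bar>?h (x / real m)\<bar>))"
    unfolding H_def using x by (intro order.trans[OF sum_abs] sum_mono gP) (auto simp: abs_mult)
  have P1: "(\<Sum>m\<in>?U. ?P m) \<le> (\<Sum>m\<in>?U. ?P m * sqrt (x / real m))"
  proof (rule sum_mono)
    fix m assume "m \<in> ?U"
    hence "1 \<le> sqrt (x / real m)" using xm by simp
    from mult_left_mono[OF this, of "?P m"] show "?P m \<le> ?P m * sqrt (x / real m)" by simp
  qed
  have G': "\<bar>G'\<bar> \<le> (\<Sum>m\<in>?U. ?P m)"
  proof -
    have "\<bar>G'\<bar> \<le> (\<Sum>m\<in>?U. ?P m * 1)"
      unfolding G'_def by (intro order.trans[OF sum_abs] sum_mono gP) (auto intro: less_imp_le[OF frac_lt_1])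
    thus ?thesis by simp
  qed
  have G: "\<bar>G\<bar> \<le> Q * (\<Sum>m\<in>?U. ?P m)"
    unfolding G_def Q_def using x i by (intro abs_sum_moebius_weight_floor_le) auto
  have "\<bar>G + G'\<bar> \<le> (Q + 1) * (\<Sum>m\<in>?U. ?P m)" using G G' by (simp add: algebra_simps)
  also have "\<dots> \<le> (Q + 1) * (\<Sum>m\<in>?U. ?P m * sqrt (x / real m))"
    using P1 by (intro mult_left_mono) (auto simp: Q_def)
  finally have GG: "\<bar>(1 - ?b) * (G + G')\<bar> \<le> \<bar>1 - ?b\<bar> * ((Q + 1) * (\<Sum>m\<in>?U. ?P m * sqrt (x / real m)))"
    unfolding abs_mult by (intro mult_left_mono) auto
  have "\<bar>ln x * frac_sum i j l x\<bar> \<le> \<bar>T1\<bar> + \<bar>R\<bar> + \<bar>E\<bar> + \<bar>H\<bar> + \<bar>(1 - ?b) * (G + G')\<bar>"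
    unfolding main by linarith
  also have "\<dots> \<le> (\<Sum>m\<in>?U. ?P m * (2 * sqrt (x / real m))) + (\<Sum>m\<in>?U. ?P m * (2 * exceptional_mass x m))
     + (\<Sum>m\<in>?U. ?P m * (3 * sqrt (x / real m))) + (\<Sum>m\<in>?U. ?P m * (x / real m * \<bar>?h (x / real m)\<bar>))
     + \<bar>1 - ?b\<bar> * ((Q + 1) * (\<Sum>m\<in>?U. ?P m * sqrt (x / real m)))"
    by (intro add_mono T1 R E H GG)
  also have "\<dots> = (\<Sum>m\<in>?U. ?P m * (K * sqrt (x / real m) + 2 * exceptional_mass x m + x / real m * \<bar>?h (x / real m)\<bar>))"
    unfolding sum_distrib_left sum.distrib[symmetric] K_def Q_def[symmetric]
    by (intro sum.cong refl) (simp add: algebra_simps)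
  finally show ?thesis .
qed

section \<open>Cauchy-Schwarz and conclusion\<close>

lemma sum_le_sqrt_mult_sqrt:
  assumes x: "x \<ge> 1" and e: "\<And>m. m \<in> nats_upto x \<Longrightarrow> e m \<ge> (0::real)"
    and W: "(\<Sum>m\<in>nats_upto x. real (omega m + 1) ^ (2 * i) / real m) \<le> W"
    and V: "(\<Sum>m\<in>nats_upto x. real m * (e m)\<^sup>2) \<le> V"
  shows "(\<Sum>m\<in>nats_upto x. real (omega m + 1) ^ i * e m) \<le> sqrt (W * V)"
proof -
  let ?U = "nats_upto x" and ?P = "\<lambda>m. real (omega m + 1) ^ i"
  have "(\<Sum>m\<in>?U. ?P m * e m)\<^sup>2 = (\<Sum>m\<in>?U. (?P m / sqrt (real m)) * (sqrt (real m) * e m))\<^sup>2"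
    by (intro arg_cong[where f = "\<lambda>z. z\<^sup>2"] sum.cong refl) (auto simp: nats_upto_iff)
  also have "\<dots> \<le> (\<Sum>m\<in>?U. (?P m / sqrt (real m))\<^sup>2) * (\<Sum>m\<in>?U. (sqrt (real m) * e m)\<^sup>2)"
    by (rule Cauchy_Schwarz_ineq_sum)
  also have "(\<Sum>m\<in>?U. (?P m / sqrt (real m))\<^sup>2) = (\<Sum>m\<in>?U. real (omega m + 1) ^ (2 * i) / real m)"
    by (intro sum.cong refl) (simp add: power_divide mult.commute[of 2 i] power_mult del: of_nat_add)
  also have "(\<Sum>m\<in>?U. (sqrt (real m) * e m)\<^sup>2) = (\<Sum>m\<in>?U. real m * (e m)\<^sup>2)"
    by (intro sum.cong refl) (simp add: power_mult_distrib)
  also have "(\<Sum>m\<in>?U. real (omega m + 1) ^ (2 * i) / real m) * (\<Sum>m\<in>?U. real m * (e m)\<^sup>2) \<le> W * V"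
  proof (rule mult_mono[OF W V])
    show "0 \<le> W" by (rule order.trans[OF _ W]) (intro sum_nonneg, simp)
  qed (intro sum_nonneg, simp)
  finally have "\<bar>\<Sum>m\<in>?U. ?P m * e m\<bar> \<le> sqrt (W * V)" using real_le_rsqrt[of "\<bar>\<Sum>m\<in>?U. ?P m * e m\<bar>"] by simp
  thus ?thesis by linarith
qed

text \<open>The square root and Mertens parts contribute O(x^2); only the exceptional mass brings in
  ln ln x.\<close>

lemma sum_error_squares_le:
  assumes K: "K \<ge> 0"
  obtains C where "C \<ge> 0" "\<And>x. x > 1 \<Longrightarrow> ln (ln x) \<ge> 1 \<Longrightarrow> ln x \<ge> 1 \<Longrightarrow>
    (\<Sum>m\<in>nats_upto x. real m * (K * sqrt (x / real m) + 2 * exceptional_mass x m + x / real m * \<bar>mertens_error (x / real m)\<bar>)\<^sup>2)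
      \<le> C * (x\<^sup>2 * ln (ln x))"
proof -
  let ?e = "\<lambda>x m. K * sqrt (x / real m) + 2 * exceptional_mass x m + x / real m * \<bar>mertens_error (x / real m)\<bar>"
  obtain Ch where Ch: "Ch \<ge> 0" "\<And>x. x > 1 \<Longrightarrow> ln x \<ge> 1 \<Longrightarrow> (\<Sum>m\<in>nats_upto x. (mertens_error (x / real m))\<^sup>2 / real m) \<le> Ch"
    using sum_mertens_error_sq_bounded by blast
  define Ce where "Ce = 2474 + 6 * powr_three_halves_sum"
  have Ce: "Ce \<ge> 0" using powr_three_halves_sum_nonneg by (simp add: Ce_def)
  show thesis
  proof (rule that[of "3 * (K\<^sup>2 + 40 * Ce + Ch)"])
    show "3 * (K\<^sup>2 + 40 * Ce + Ch) \<ge> 0" using Ce Ch by simp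
    fix x :: real assume x: "x > 1" "ln (ln x) \<ge> 1" "ln x \<ge> 1"
    let ?U = "nats_upto x" and ?L = "ln (ln x)" and ?eps = "exceptional_mass x"
    let ?h = "\<lambda>m. mertens_error (x / real m)"
    have sq3: "(a + b + c)\<^sup>2 \<le> 3 * (a\<^sup>2 + b\<^sup>2 + c\<^sup>2)" for a b c :: real
      using zero_le_power2[of "a - b"] zero_le_power2[of "b - c"] zero_le_power2[of "a - c"]
      by (simp add: power2_eq_square algebra_simps)
    have "(\<Sum>m\<in>?U. real m * (?e x m)\<^sup>2)
       \<le> (\<Sum>m\<in>?U. 3 * (K\<^sup>2 * x + 40 * x * ?eps m + x\<^sup>2 * ((?h m)\<^sup>2 / real m)))"
    proof (rule sum_mono)
      fix m assume m: "m \<in> ?U"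
      hence m0: "real m > 0" by (simp add: nats_upto_iff)
      \<comment> \<open>Chebyshev's bound on one of the two factors makes the square linear in the
        mass, so the first moment found by the sieve is enough.\<close>
      have eps: "real m * (?eps m)\<^sup>2 \<le> 10 * x * ?eps m"
      proof -
        have "?eps m \<le> 10 * (x / real m)" using x
          by (intro order.trans[OF exceptional_mass_le_psi chebyshev_psi_le]) auto
        hence "real m * ?eps m \<le> 10 * x" using m0 by (simp add: field_simps)
        from mult_right_mono[OF this exceptional_mass_nonneg[of x m]] show ?thesis by (simp add: power2_eq_square mult_ac)
      qed
      have "real m * (?e x m)\<^sup>2
         \<le> real m * (3 * ((K * sqrt (x / real m))\<^sup>2 + (2 * ?eps m)\<^sup>2 + (x / real m * \<bar>?h m\<bar>)\<^sup>2))"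
        by (intro mult_left_mono sq3) simp
      also have "\<dots> = 3 * (K\<^sup>2 * x + 4 * (real m * (?eps m)\<^sup>2) + x\<^sup>2 * ((?h m)\<^sup>2 / real m))"
        using m0 x by (simp add: power_mult_distrib power_divide) (simp add: field_simps power2_eq_square)
      also have "\<dots> \<le> 3 * (K\<^sup>2 * x + 4 * (10 * x * ?eps m) + x\<^sup>2 * ((?h m)\<^sup>2 / real m))"
        using eps by simp
      finally show "real m * (?e x m)\<^sup>2
         \<le> 3 * (K\<^sup>2 * x + 40 * x * ?eps m + x\<^sup>2 * ((?h m)\<^sup>2 / real m))" by simp
    qed
    also have "\<dots> = 3 * (K\<^sup>2 * x * real (card ?U) + 40 * x * (\<Sum>m\<in>?U. ?eps m) + x\<^sup>2 * (\<Sum>m\<in>?U. (?h m)\<^sup>2 / real m))"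
      by (simp only: sum.distrib sum_distrib_left [symmetric] sum_constant) (simp add: mult_ac)
    also have "\<dots> \<le> 3 * (K\<^sup>2 * x * (x * ?L) + 40 * x * (Ce * (x * ?L)) + x\<^sup>2 * (Ch * ?L))"
    proof (intro mult_left_mono add_mono)
      have "real (card ?U) \<le> x * 1" using x by (subst card_nats_upto) auto
      also have "\<dots> \<le> x * ?L" using x by (intro mult_left_mono) auto
      finally show "real (card ?U) \<le> x * ?L" .
      show "(\<Sum>m\<in>?U. ?eps m) \<le> Ce * (x * ?L)" unfolding Ce_def by (rule sum_exceptional_mass_le[OF x(1,2)])
      have "(\<Sum>m\<in>?U. (?h m)\<^sup>2 / real m) \<le> Ch * 1" using Ch(2)[OF x(1,3)] by simp
      also have "\<dots> \<le> Ch * ?L" using x Ch by (intro mult_left_mono) auto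
      finally show "(\<Sum>m\<in>?U. (?h m)\<^sup>2 / real m) \<le> Ch * ?L" .
    qed (use x in auto)
    also have "\<dots> = 3 * (K\<^sup>2 + 40 * Ce + Ch) * (x\<^sup>2 * ?L)" by (simp add: power2_eq_square algebra_simps)
    finally show "(\<Sum>m\<in>?U. real m * (?e x m)\<^sup>2) \<le> 3 * (K\<^sup>2 + 40 * Ce + Ch) * (x\<^sup>2 * ?L)" .
  qed
qed

lemma frac_sum_bound:
  assumes i: "i \<ge> 1"
  obtains C where "C \<ge> 0" "\<And>x j l. x > 1 \<Longrightarrow> ln (ln x) \<ge> 1 \<Longrightarrow> ln x \<ge> 1 \<Longrightarrow>
    \<bar>frac_sum i j l x\<bar> \<le> C * (x * ln (ln x) powr (real i + 1 / 2) / sqrt (ln x))"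
proof -
  define K where "K = 5 + \<bar>1 - mertens_const\<bar> * (2 ^ i * (real i + 2) ^ i + 1)"
  have K: "K \<ge> 0" by (simp add: K_def)
  obtain C where C: "C \<ge> 0" "\<And>x. x > 1 \<Longrightarrow> ln (ln x) \<ge> 1 \<Longrightarrow> ln x \<ge> 1 \<Longrightarrow>
    (\<Sum>m\<in>nats_upto x. real m * (K * sqrt (x / real m) + 2 * exceptional_mass x m + x / real m * \<bar>mertens_error (x / real m)\<bar>)\<^sup>2)
      \<le> C * (x\<^sup>2 * ln (ln x))"
    using sum_error_squares_le[OF K] by blast
  define D :: real where "D = fact (2 * i) * exp 114"
  have D: "D \<ge> 0" by (simp add: D_def)
  show thesis
  proof (rule that[of "sqrt (D * C)"])
    show "sqrt (D * C) \<ge> 0" using D C by simp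
    fix x :: real and j l assume x: "x > 1" "ln (ln x) \<ge> 1" "ln x \<ge> 1"
    let ?L = "ln (ln x)"
    let ?e = "\<lambda>m. K * sqrt (x / real m) + 2 * exceptional_mass x m + x / real m * \<bar>mertens_error (x / real m)\<bar>"
    have "ln x * \<bar>frac_sum i j l x\<bar> = \<bar>ln x * frac_sum i j l x\<bar>" using x by (simp add: abs_mult)
    also have "\<dots> \<le> (\<Sum>m\<in>nats_upto x. real (omega m + 1) ^ i * ?e m)"
      unfolding K_def using x i by (intro ln_mult_frac_sum_le) auto
    also have "\<dots> \<le> sqrt ((D * (ln x * ?L ^ (2 * i))) * (C * (x\<^sup>2 * ?L)))"
    proof (rule sum_le_sqrt_mult_sqrt)
      show "(\<Sum>m\<in>nats_upto x. real (omega m + 1) ^ (2 * i) / real m) \<le> D * (ln x * ?L ^ (2 * i))"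
        unfolding D_def by (rule sum_omega_moment_le[OF x(1,2)])
      show "(\<Sum>m\<in>nats_upto x. real m * (?e m)\<^sup>2) \<le> C * (x\<^sup>2 * ?L)" by (rule C(2)[OF x])
      show "0 \<le> ?e m" for m
        using K x exceptional_mass_nonneg[of x m] by (intro add_nonneg_nonneg mult_nonneg_nonneg) auto
    qed (use x in auto)
    also have "\<dots> = sqrt (D * C) * (sqrt (ln x) * (x * (?L ^ i * sqrt ?L)))"
    proof -
      have e: "(D * (ln x * ?L ^ (2 * i))) * (C * (x\<^sup>2 * ?L)) = (D * C) * (ln x * (x\<^sup>2 * ((?L ^ i)\<^sup>2 * ?L)))"
        by (simp add: power_mult[symmetric] mult_ac)
      have "sqrt ((D * C) * (ln x * (x\<^sup>2 * (a\<^sup>2 * ?L)))) = sqrt (D * C) * (sqrt (ln x) * (x * (a * sqrt ?L)))"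
        if "a \<ge> 0" for a
        using x that by (simp add: real_sqrt_mult)
      thus ?thesis unfolding e using x by simp
    qed
    also have "?L ^ i * sqrt ?L = ?L powr (real i + 1 / 2)"
    proof -
      have "?L > 0" using x by linarith
      thus ?thesis by (simp add: powr_add powr_realpow powr_half_sqrt)
    qed
    finally have "ln x * \<bar>frac_sum i j l x\<bar> \<le> sqrt (D * C) * (sqrt (ln x) * (x * ?L powr (real i + 1 / 2)))" .
    also have "\<dots> = ln x * (sqrt (D * C) * (x * ?L powr (real i + 1 / 2) / sqrt (ln x)))"
    proof -
      have "sqrt (ln x) = ln x / sqrt (ln x)" using x by (simp add: real_div_sqrt)
      thus ?thesis by (metis (no_types, lifting) mult.assoc mult.commute times_divide_eq_right)
    qed
    finally show "\<bar>frac_sum i j l x\<bar> \<le> sqrt (D * C) * (x * ?L powr (real i + 1 / 2) / sqrt (ln x))"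
      using x by (subst (asm) mult_le_cancel_left_pos) auto
  qed
qed

theorem theorem6p2:
  fixes k l :: nat
  assumes "k \<ge> 4"
  shows "\<exists>C::real. \<forall>\<^sub>F x::real in at_top. \<forall>j::nat. 1 \<le> j \<and> j \<le> l \<and> gcd j l = 1 \<longrightarrow>
    \<bar>\<Sum>n | 2 \<le> n \<and> real n \<le> x \<and> [least_prime_factor n = j] (mod l).
        real_of_int (moebius_mu n) * real (omega n) ^ (k - 1) * frac (x / real n)\<bar>
      \<le> C * (x * ln (ln x) powr (real k + 1 / 2) / sqrt (ln x))"
proof -
  have "k - 1 \<ge> 1" using assms by simp
  then obtain C where C: "C \<ge> 0" "\<And>x j l. x > 1 \<Longrightarrow> ln (ln x) \<ge> 1 \<Longrightarrow> ln x \<ge> 1 \<Longrightarrow>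
    \<bar>frac_sum (k - 1) j l x\<bar> \<le> C * (x * ln (ln x) powr (real (k - 1) + 1 / 2) / sqrt (ln x))"
    using frac_sum_bound by blast
  have ev: "\<forall>\<^sub>F x::real in at_top. x > 1 \<and> ln (ln x) \<ge> 1 \<and> ln x \<ge> 1"
    by (intro eventually_conj) real_asymp+
  have "\<forall>\<^sub>F x::real in at_top. \<forall>j::nat. 1 \<le> j \<and> j \<le> l \<and> gcd j l = 1 \<longrightarrow>
    \<bar>\<Sum>n | 2 \<le> n \<and> real n \<le> x \<and> [least_prime_factor n = j] (mod l).
        real_of_int (moebius_mu n) * real (omega n) ^ (k - 1) * frac (x / real n)\<bar>
      \<le> C * (x * ln (ln x) powr (real k + 1 / 2) / sqrt (ln x))"
    using ev
  proof (eventually_elim, intro allI impI)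
    fix x :: real and j :: nat
    assume x: "x > 1 \<and> ln (ln x) \<ge> 1 \<and> ln x \<ge> 1"
    have "(\<Sum>n | 2 \<le> n \<and> real n \<le> x \<and> [least_prime_factor n = j] (mod l).
        real_of_int (moebius_mu n) * real (omega n) ^ (k - 1) * frac (x / real n)) = frac_sum (k - 1) j l x"
      unfolding frac_sum_def
      by (rule sum.mono_neutral_cong_left) (auto simp: nats_upto_iff moebius_weight_def)
    also have "\<bar>frac_sum (k - 1) j l x\<bar> \<le> C * (x * ln (ln x) powr (real (k - 1) + 1 / 2) / sqrt (ln x))"
      using x by (intro C(2)) auto
    \<comment> \<open>The exponent obtained is k - 1/2; it may be raised because ln ln x \<ge>
      1.\<close>
    also have "\<dots> \<le> C * (x * ln (ln x) powr (real k + 1 / 2) / sqrt (ln x))"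
      using x C(1) by (intro mult_left_mono divide_right_mono powr_mono) auto
    finally show "\<bar>\<Sum>n | 2 \<le> n \<and> real n \<le> x \<and> [least_prime_factor n = j] (mod l).
        real_of_int (moebius_mu n) * real (omega n) ^ (k - 1) * frac (x / real n)\<bar>
      \<le> C * (x * ln (ln x) powr (real k + 1 / 2) / sqrt (ln x))" .
  qed
  thus ?thesis by blast
qed

end
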